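(* Let $\Omega$ be a compact metric space and $\varphi:\Omega\to\Omega$ a continuous map such that $(\Omega,\varphi)$ is tame. Then $(\Omega,\varphi)$ is ergodically decomposable.
   Context: $X=C(\Omega)$, $X^*$ the space of Radon measures, pairing $(x,\mu)$; $Ux=x\circ\varphi$, $V=U^*$. $\mathrm{W^*O}$-topology on $\mathcal{L}(X^* )$: $T_n\to T$ iff $(x,T_n\mu)\to(x,T\mu)$ for all $x\in X,\mu\in X^*$. A sequence $\{V_n\}\subseteq\operatorname{co}\{V^k:k\in\mathbb{N}_0\}$ is ergodic if $(x,(\operatorname{Id}-V)V_n\mu)\to0$ for all $x,\mu$. $(\Omega,\varphi)$ is ergodically decomposable if there exists an ergodic operator sequence $\{V_n\}$ converging in the $\mathrm{W^*O}$-topology to some $Q$ such that $Q\delta_\omega$ (the weak-star limit of $V_n\delta_\omega$, $\delta_\omega$ the Dirac measure) is a $\varphi$-ergodic Borel probability measure for every $\omega\in\Omega$. $(\Omega,\varphi)$ is tame if for every $x\in X$ and every strictly increasing sequence $\{n(k)\}\subseteq\mathbb{N}_0$, $\inf_a\|\sum_k a_k\,x\circ\varphi^{n(k)}\|_X=0$, the infimum over finitely supported scalar sequences with $\sum_k|a_k|=1$. *)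

theory Defs
  imports "HOL-Probability.Probability"
begin

text \<open>X = C(Omega) is rendered as the bounded continuous functions (which on a compact
space is all of C(Omega)); X* is its (norm) dual, i.e. bounded linear functionals,
identified with Radon measures by the Riesz representation theorem; the pairing
(x, mu) is application mu x.\<close>

type_synonym 'a dualC = "('a \<Rightarrow>\<^sub>C real) \<Rightarrow>\<^sub>L real"

definition koopman :: "('a::metric_space \<Rightarrow> 'a) \<Rightarrow> ('a \<Rightarrow>\<^sub>C real) \<Rightarrow>\<^sub>L ('a \<Rightarrow>\<^sub>C real)" where
  "koopman \<phi> = Blinfun (\<lambda>x. Bcontfun (apply_bcontfun x \<circ> \<phi>))"

definition dual_op :: "('a::metric_space \<Rightarrow>\<^sub>C real) \<Rightarrow>\<^sub>L ('a \<Rightarrow>\<^sub>C real) \<Rightarrow> 'a dualC \<Rightarrow>\<^sub>L 'a dualC" where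
  "dual_op T = Blinfun (\<lambda>\<mu>. \<mu> o\<^sub>L T)"

definition opow :: "('b::real_normed_vector \<Rightarrow>\<^sub>L 'b) \<Rightarrow> nat \<Rightarrow> 'b \<Rightarrow>\<^sub>L 'b" where
  "opow T k = ((\<lambda>S. T o\<^sub>L S) ^^ k) id_blinfun"

definition dirac :: "'a::metric_space \<Rightarrow> 'a dualC" where
  "dirac \<omega> = Blinfun (\<lambda>x. apply_bcontfun x \<omega>)"

definition wstar_op_conv :: "(nat \<Rightarrow> 'a::metric_space dualC \<Rightarrow>\<^sub>L 'a dualC) \<Rightarrow> ('a dualC \<Rightarrow>\<^sub>L 'a dualC) \<Rightarrow> bool" where
  "wstar_op_conv Tn T \<longleftrightarrow> (\<forall>x \<mu>. (\<lambda>n. Tn n \<mu> x) \<longlonglongrightarrow> T \<mu> x)"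

definition ergodic_op_seq :: "('a::metric_space \<Rightarrow> 'a) \<Rightarrow> (nat \<Rightarrow> 'a dualC \<Rightarrow>\<^sub>L 'a dualC) \<Rightarrow> bool" where
  "ergodic_op_seq \<phi> Vn \<longleftrightarrow>
     (\<forall>n. Vn n \<in> convex hull (range (opow (dual_op (koopman \<phi>))))) \<and>
     (\<forall>x \<mu>. (\<lambda>n. ((id_blinfun - dual_op (koopman \<phi>)) (Vn n \<mu>)) x) \<longlonglongrightarrow> 0)"

definition ergodic_prob :: "('a::metric_space \<Rightarrow> 'a) \<Rightarrow> 'a measure \<Rightarrow> bool" where
  "ergodic_prob \<phi> M \<longleftrightarrow> prob_space M \<and> sets M = sets borel \<and>
     \<phi> \<in> measurable M M \<and> (\<forall>A\<in>sets M. emeasure M (\<phi> -` A) = emeasure M A) \<and>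
     (\<forall>A\<in>sets M. \<phi> -` A = A \<longrightarrow> measure M A = 0 \<or> measure M A = 1)"

definition ergodically_decomposable :: "('a::metric_space \<Rightarrow> 'a) \<Rightarrow> bool" where
  "ergodically_decomposable \<phi> \<longleftrightarrow>
     (\<exists>Vn Q. ergodic_op_seq \<phi> Vn \<and> wstar_op_conv Vn Q \<and>
        (\<forall>\<omega>. \<exists>M. ergodic_prob \<phi> M \<and>
              (\<forall>x. Q (dirac \<omega>) x = (\<integral>t. apply_bcontfun x t \<partial>M))))"

definition tame :: "('a::metric_space \<Rightarrow> 'a) \<Rightarrow> bool" where
  "tame \<phi> \<longleftrightarrow>
     (\<forall>(x::'a \<Rightarrow>\<^sub>C real) (n::nat \<Rightarrow> nat). strict_mono n \<longrightarrow>
        (INF a\<in>{a::nat \<Rightarrow> real. finite {k. a k \<noteq> 0} \<and> (\<Sum>k\<in>{k. a k \<noteq> 0}. \<bar>a k\<bar>) = 1}.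
            norm (\<Sum>k\<in>{k. a k \<noteq> 0}. a k *\<^sub>R opow (koopman \<phi>) (n k) x)) = 0)"

end

theory Submission
  imports Defs
begin

text \<open>
  Take an extreme invariant mean \<open>m\<close> (Banach limit) on bounded sequences. For every point \<open>\<omega>\<close> the
  functional \<open>x \<mapsto> m(x(\<phi>\<^sup>k \<omega>))\<close> is integration against a probability measure, and extremality of \<open>m\<close>
  makes this measure ergodic: an invariant set \<open>A\<close> cuts out of \<open>m\<close> the invariant functional
  \<open>m(1\<^sub>A(\<phi>\<^sup>k \<omega>) u\<^sub>k)\<close>, which has to be a multiple of \<open>m\<close>. It thus suffices that the operator
  \<open>Q\<close> belonging to \<open>m\<close> is the limit of a sequence of convex combinations of the powers of \<open>V\<close>, and
  this is where tameness is used.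

  Write \<open>x\<^sub>m(\<omega>) = m(x(\<phi>\<^sup>k \<omega>))\<close>. If \<open>x\<^sub>m\<close> were not of the first Baire class, or if
  \<open>\<integral> x\<^sub>m d\<mu> = m(\<integral> x \<circ> \<phi>\<^sup>k d\<mu>)\<close> failed for some measure \<open>\<mu>\<close>, there would be convex combinations of
  disjoint blocks of the functions \<open>x \<circ> \<phi>\<^sup>k\<close> realizing all patterns of being small or large. These
  carry a measure for which their signs are orthonormal, and some term of each block correlates with
  the sign of the block. Such terms have a subsequence that realizes all patterns itself, hence is an
  \<open>l\<^sup>1\<close> sequence, contradicting tameness. So \<open>x\<^sub>m\<close> is a limit of continuous functions whose integrals
  converge to the right value, and by the Hahn-Banach theorem (Mazur's lemma) convex combinations of
  these functions come arbitrarily close to convex combinations of the \<open>x \<circ> \<phi>\<^sup>k\<close>, simultaneously for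
  finitely many \<open>x\<close>. A diagonal choice over a countable total family of \<open>x\<close> gives the sequence.
\<close>

section \<open>Sublinear functionals\<close>

text \<open>The limit operator has to send every Dirac measure to an ergodic measure, with no
  exceptional set of points. Limits of Cesaro averages are invariant but need not be ergodic,
  whereas one extreme mean serves all points at once, since its choice refers to no point. The price
  is that such a mean comes from Zorn's lemma and is only finitely additive: no sequence of averages
  converging to it is at hand, not even along the orbits alone. The two ways in which convergence
  could break down lead to one combinatorial situation: a class of nonempty sets such that for
  finitely many of them a single convex combination of arbitrarily late iterates is small on a part
  of each and large on another, both parts being again in the class. In one case these are the
  relatively open subsets of a given set, in the other the relatively open subsets of positive
  measure. Convex combinations are unavoidable here, because they approximate a mean at finitely
  many functionals and single iterates need not; getting back to single iterates is what the
  orthonormal signs are for.\<close>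

definition sublinear :: "('v::real_vector \<Rightarrow> real) \<Rightarrow> bool" where
  "sublinear p \<longleftrightarrow> (\<forall>x y. p (x + y) \<le> p x + p y) \<and> (\<forall>c x. 0 \<le> c \<longrightarrow> p (c *\<^sub>R x) = c * p x)"

lemma sublinearD:
  assumes "sublinear p"
  shows "p (x + y) \<le> p x + p y" "0 \<le> c \<Longrightarrow> p (c *\<^sub>R x) = c * p x"
  using assms unfolding sublinear_def by auto

lemma sublinear_0: "sublinear p \<Longrightarrow> p 0 = 0"
  using sublinearD(2)[of p 0 0] by simp

lemma sublinear_minus: assumes "sublinear p" shows "- p (- x) \<le> p x"
  using sublinearD(1)[OF assms, of x "- x"] sublinear_0[OF assms] by simp

lemma sublinearI:
  assumes add: "\<And>x y. p (x + y) \<le> p x + p y"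
    and pos: "\<And>c x. 0 < c \<Longrightarrow> p (c *\<^sub>R x) \<le> c * p x" and zero: "p 0 = 0"
  shows "sublinear p"
  unfolding sublinear_def
proof safe
  fix c :: real and x assume "0 \<le> c"
  show "p (c *\<^sub>R x) = c * p x"
  proof (cases "c = 0")
    case False
    then have c: "c > 0" using \<open>0 \<le> c\<close> by simp
    have "p (inverse c *\<^sub>R (c *\<^sub>R x)) \<le> inverse c * p (c *\<^sub>R x)"
      using c by (intro pos) simp
    then have "c * p x \<le> p (c *\<^sub>R x)" using c by (simp add: field_simps)
    then show ?thesis using pos[OF c, of x] by simp
  qed (simp add: zero)
qed (rule add)

lemma linear_if_sublinear_odd:
  assumes "sublinear p" "\<And>x. p (- x) \<le> - p x"
  shows "linear p"
proof -
  have odd: "p (- x) = - p x" for x using assms(2)[of x] sublinear_minus[OF assms(1), of x] by simp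
  show ?thesis
  proof (rule linearI)
    fix x y show "p (x + y) = p x + p y"
      using sublinearD(1)[OF assms(1), of x y] sublinearD(1)[OF assms(1), of "- x" "- y"]
        odd[of x] odd[of y] odd[of "x + y"] by simp
  next
    fix c :: real and x show "p (c *\<^sub>R x) = c *\<^sub>R p x"
    proof (cases "0 \<le> c")
      case False
      then have "p ((- c) *\<^sub>R x) = - c * p x" using sublinearD(2)[OF assms(1), of "- c" x] by simp
      then show ?thesis using odd[of "c *\<^sub>R x"] by simp
    qed (simp add: sublinearD(2)[OF assms(1)])
  qed
qed

text \<open>A sublinear functional \<open>q\<close> stands for the convex set of linear functionals
  below it; the condition makes this set a face of the one of \<open>p\<close>. Encoding faces by
  functionals turns the Krein-Milman argument into one about pointwise infima, with no topology on
  the dual.\<close>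

definition facial :: "('v::real_vector \<Rightarrow> real) \<Rightarrow> ('v \<Rightarrow> real) \<Rightarrow> bool" where
  "facial p q \<longleftrightarrow> (\<forall>a b. linear a \<longrightarrow> linear b \<longrightarrow> a \<le> p \<longrightarrow> b \<le> p \<longrightarrow>
     (\<forall>x. (a x + b x) / 2 \<le> q x) \<longrightarrow> a \<le> q \<and> b \<le> q)"

text \<open>The functional cutting out the face of the dominated linear functionals that are
  maximal at \<open>v\<close>.\<close>

definition exposed :: "('v::real_vector \<Rightarrow> real) \<Rightarrow> 'v \<Rightarrow> 'v \<Rightarrow> real" where
  "exposed q v x = (INF t\<in>{0..}. q (x + t *\<^sub>R v) - t * q v)"

lemma exposed_bdd:
  assumes "sublinear q" shows "bdd_below ((\<lambda>t. q (x + t *\<^sub>R v) - t * q v) ` {0..})"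
proof (rule bdd_belowI2)
  fix t :: real assume "t \<in> {0..}"
  then have t: "q (t *\<^sub>R v) = t * q v" using sublinearD(2)[OF assms] by simp
  have "q (t *\<^sub>R v) \<le> q (x + t *\<^sub>R v) + q (- x)"
    using sublinearD(1)[OF assms, of "x + t *\<^sub>R v" "- x"] by simp
  then show "- q (- x) \<le> q (x + t *\<^sub>R v) - t * q v" using t by simp
qed

lemma exposed_le:
  assumes "sublinear q" "0 \<le> t" shows "exposed q v x \<le> q (x + t *\<^sub>R v) - t * q v"
  unfolding exposed_def using assms(2) by (intro cINF_lower exposed_bdd[OF assms(1)]) simp

lemma exposed_less:
  assumes "exposed q v x < r" obtains t where "0 \<le> t" "q (x + t *\<^sub>R v) - t * q v < r"
proof (rule ccontr)
  assume "\<not> thesis"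
  then have "\<forall>t\<in>{0..}. r \<le> q (x + t *\<^sub>R v) - t * q v" using that by force
  then have "r \<le> exposed q v x" unfolding exposed_def by (intro cINF_greatest) auto
  then show False using assms by simp
qed

lemma sublinear_exposed:
  assumes q: "sublinear q" shows "sublinear (exposed q v)"
proof (rule sublinearI)
  fix x y
  show "exposed q v (x + y) \<le> exposed q v x + exposed q v y"
  proof (rule field_le_epsilon)
    fix e :: real assume "0 < e"
    obtain s where s: "0 \<le> s" "q (x + s *\<^sub>R v) - s * q v < exposed q v x + e / 2"
      using exposed_less[of q v x "exposed q v x + e / 2"] \<open>0 < e\<close> by auto
    obtain t where t: "0 \<le> t" "q (y + t *\<^sub>R v) - t * q v < exposed q v y + e / 2"
      using exposed_less[of q v y "exposed q v y + e / 2"] \<open>0 < e\<close> by auto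
    have "exposed q v (x + y) \<le> q ((x + y) + (s + t) *\<^sub>R v) - (s + t) * q v"
      using s t by (intro exposed_le[OF q]) auto
    also have "(x + y) + (s + t) *\<^sub>R v = (x + s *\<^sub>R v) + (y + t *\<^sub>R v)" by (simp add: algebra_simps)
    also have "q \<dots> - (s + t) * q v \<le> (q (x + s *\<^sub>R v) - s * q v) + (q (y + t *\<^sub>R v) - t * q v)"
      using sublinearD(1)[OF q, of "x + s *\<^sub>R v" "y + t *\<^sub>R v"] by (simp add: algebra_simps)
    finally show "exposed q v (x + y) \<le> exposed q v x + exposed q v y + e" using s t by simp
  qed
next
  fix c :: real and x assume c: "0 < c"
  show "exposed q v (c *\<^sub>R x) \<le> c * exposed q v x"
  proof (rule field_le_epsilon)
    fix e :: real assume "0 < e"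
    obtain s where s: "0 \<le> s" "q (x + s *\<^sub>R v) - s * q v < exposed q v x + e / c"
      using exposed_less[of q v x "exposed q v x + e / c"] \<open>0 < e\<close> c by auto
    have "exposed q v (c *\<^sub>R x) \<le> q (c *\<^sub>R x + (c * s) *\<^sub>R v) - (c * s) * q v"
      using s c by (intro exposed_le[OF q]) auto
    also have "c *\<^sub>R x + (c * s) *\<^sub>R v = c *\<^sub>R (x + s *\<^sub>R v)" by (simp add: algebra_simps)
    also have "q \<dots> - (c * s) * q v = c * (q (x + s *\<^sub>R v) - s * q v)"
      using sublinearD(2)[OF q, of c "x + s *\<^sub>R v"] c by (simp add: right_diff_distrib)
    also have "\<dots> \<le> c * (exposed q v x + e / c)" using s c by (intro mult_left_mono) auto
    finally show "exposed q v (c *\<^sub>R x) \<le> c * exposed q v x + e" using c by (simp add: algebra_simps)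
  qed
next
  have "q (0 + t *\<^sub>R v) - t * q v = 0" if "t \<in> {0..}" for t
    using that sublinearD(2)[OF q] by simp
  then have "exposed q v 0 = (INF t\<in>{0..}::real set. 0)" unfolding exposed_def by (intro INF_cong) auto
  then show "exposed q v 0 = 0" by simp
qed

text \<open>A midpoint below \<open>exposed q v\<close> is below \<open>q\<close>, so both ends are
  below \<open>q\<close>. At \<open>- v\<close> with \<open>t = 1\<close> it also yields a midpoint
  value of at least \<open>q v\<close> at \<open>v\<close>, so both ends attain \<open>q v\<close>
  there, and a functional below \<open>q\<close> with this value is below every term of the
  infimum.\<close>

lemma facial_exposed:
  assumes q: "sublinear q" and f: "facial p q"
  shows "facial p (exposed q v)"
  unfolding facial_def
proof (intro allI impI)
  fix a b :: "'a \<Rightarrow> real"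
  assume lin: "linear a" "linear b" and le: "a \<le> p" "b \<le> p"
    and avg: "\<forall>x. (a x + b x) / 2 \<le> exposed q v x"
  have "exposed q v x \<le> q x" for x using exposed_le[OF q, of 0 v x] by simp
  then have "\<forall>x. (a x + b x) / 2 \<le> q x" using avg order_trans by blast
  then have ab: "a \<le> q" "b \<le> q" using f lin le unfolding facial_def by blast+
  have "(a (- v) + b (- v)) / 2 \<le> q (- v + 1 *\<^sub>R v) - 1 * q v"
    using avg exposed_le[OF q, of 1 v "- v"] order_trans by (metis zero_le_one)
  then have "q v \<le> (a v + b v) / 2"
    using lin sublinear_0[OF q] by (simp add: linear_neg)
  moreover have "a v \<le> q v" "b v \<le> q v" using ab by (auto simp: le_fun_def)
  ultimately have v: "a v = q v" "b v = q v" by simp_all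
  have *: "c \<le> exposed q v" if c: "linear c" "c \<le> q" "c v = q v" for c
    unfolding le_fun_def exposed_def
  proof (intro allI cINF_greatest)
    fix x and t :: real assume "t \<in> {0..}"
    have "c x + t * c v \<le> q (x + t *\<^sub>R v)"
      using c(2) c(1) by (metis le_fun_def linear_add linear_scale real_scaleR_def)
    then show "c x \<le> q (x + t *\<^sub>R v) - t * q v" using c by simp
  qed auto
  show "a \<le> exposed q v \<and> b \<le> exposed q v" using * lin ab v by blast
qed

text \<open>Hahn-Banach and Krein-Milman in one: a minimal facial functional cannot be cut down by
  exposing it at any vector, which forces it to be odd and hence linear, and a linear facial
  functional is extreme.\<close>

theorem extreme_linear_below_sublinear:
  fixes p :: "'v::real_vector \<Rightarrow> real"
  assumes p: "sublinear p"
  obtains l where "linear l" "l \<le> p"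
    "\<And>a b. linear a \<Longrightarrow> linear b \<Longrightarrow> a \<le> p \<Longrightarrow> b \<le> p \<Longrightarrow> (\<And>x. l x = (a x + b x) / 2) \<Longrightarrow> a = l"
proof -
  define A where "A = {q. sublinear q \<and> q \<le> p \<and> facial p q}"
  have "\<exists>m\<in>A. \<forall>a\<in>A. a \<le> m \<longrightarrow> a = m"
  proof (rule predicate_Zorn[where P = "\<lambda>x y. y \<le> x"])
    show "partial_order_on A (relation_of (\<lambda>x y. y \<le> x) A)"
      by (auto simp: partial_order_on_def preorder_on_def refl_on_def trans_def antisym_def relation_of_def)
  next
    fix C assume "C \<in> Chains (relation_of (\<lambda>x y. y \<le> x) A)"
    then have CA: "C \<subseteq> A" and ch: "\<And>x y. x \<in> C \<Longrightarrow> y \<in> C \<Longrightarrow> x \<le> y \<or> y \<le> x"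
      unfolding Chains_def relation_of_def by auto
    show "\<exists>u\<in>A. \<forall>a\<in>C. u \<le> a"
    proof (cases "C = {}")
      case True
      then show ?thesis using p by (intro bexI[of _ p]) (auto simp: A_def facial_def)
    next
      case False
      define u where "u x = (INF q\<in>C. q x)" for x
      \<comment> \<open>All members lie below \<open>p\<close>, and sublinearity at \<open>x\<close>
        and \<open>- x\<close> turns this upper bound into the common lower bound
        \<open>- p (- x)\<close>.\<close>
      have bdd: "bdd_below ((\<lambda>q. q x) ` C)" for x
      proof (rule bdd_belowI2)
        fix q assume "q \<in> C"
        then have "sublinear q" "q (- x) \<le> p (- x)" using CA by (auto simp: A_def le_fun_def)
        then show "- p (- x) \<le> q x" using sublinear_minus[of q x] by linarith
      qed
      have low: "u x \<le> q x" if "q \<in> C" for q x unfolding u_def using that by (intro cINF_lower bdd)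
      have less: "\<exists>q\<in>C. q x < r" if "u x < r" for x r
        using that False bdd cINF_less_iff[of C "\<lambda>q. q x" r] unfolding u_def by auto
      have "sublinear u"
      proof (rule sublinearI)
        fix x y
        show "u (x + y) \<le> u x + u y"
        proof (rule field_le_epsilon)
          fix e :: real assume "0 < e"
          obtain q where q: "q \<in> C" "q x < u x + e / 2" using less[of x "u x + e / 2"] \<open>0 < e\<close> by auto
          obtain r where r: "r \<in> C" "r y < u y + e / 2" using less[of y "u y + e / 2"] \<open>0 < e\<close> by auto
          obtain s where s: "s \<in> C" "s \<le> q" "s \<le> r" using ch[OF q(1) r(1)] q(1) r(1) by auto
          have "u (x + y) \<le> s (x + y)" using s low by auto
          also have "\<dots> \<le> s x + s y" using s CA by (intro sublinearD) (auto simp: A_def)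
          also have "\<dots> \<le> q x + r y" using s by (intro add_mono) (auto simp: le_fun_def)
          finally show "u (x + y) \<le> u x + u y + e" using q r by simp
        qed
      next
        fix c :: real and x assume c: "0 < c"
        show "u (c *\<^sub>R x) \<le> c * u x"
        proof (rule field_le_epsilon)
          fix e :: real assume "0 < e"
          obtain q where q: "q \<in> C" "q x < u x + e / c" using less[of x "u x + e / c"] \<open>0 < e\<close> c by auto
          have "u (c *\<^sub>R x) \<le> q (c *\<^sub>R x)" using q low by auto
          also have "\<dots> = c * q x" using q CA c by (intro sublinearD) (auto simp: A_def)
          also have "\<dots> \<le> c * (u x + e / c)" using q c by (intro mult_left_mono) auto
          finally show "u (c *\<^sub>R x) \<le> c * u x + e" using c by (simp add: algebra_simps)
        qed
      next
        have "u 0 = (INF q\<in>C. 0)" unfolding u_def using CA by (intro INF_cong) (auto simp: A_def sublinear_0)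
        then show "u 0 = 0" using False by simp
      qed
      moreover have "u \<le> p"
      proof -
        obtain q where "q \<in> C" using False by blast
        then have "u \<le> q" "q \<le> p" using low CA by (auto simp: le_fun_def A_def)
        then show ?thesis by simp
      qed
      moreover have "facial p u"
        unfolding facial_def
      proof (intro allI impI)
        fix a b :: "'v \<Rightarrow> real"
        assume *: "linear a" "linear b" "a \<le> p" "b \<le> p" "\<forall>x. (a x + b x) / 2 \<le> u x"
        have "a \<le> q \<and> b \<le> q" if "q \<in> C" for q
        proof -
          have "\<forall>x. (a x + b x) / 2 \<le> q x" using *(5) low[OF that] order_trans by blast
          moreover have "facial p q" using CA that by (auto simp: A_def)
          ultimately show ?thesis using * unfolding facial_def by blast
        qed
        then show "a \<le> u \<and> b \<le> u"
          unfolding u_def le_fun_def using False by (auto intro!: cINF_greatest)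
      qed
      ultimately have "u \<in> A" by (simp add: A_def)
      then show ?thesis using low by (auto simp: le_fun_def)
    qed
  qed
  then obtain l where l: "l \<in> A" "\<And>a. a \<in> A \<Longrightarrow> a \<le> l \<Longrightarrow> a = l" by blast
  then have sl: "sublinear l" and lp: "l \<le> p" and fl: "facial p l" by (auto simp: A_def)
  have ex: "exposed l v = l" for v
  proof (rule l(2))
    show *: "exposed l v \<le> l" using exposed_le[OF sl, of 0 v] by (auto simp: le_fun_def)
    show "exposed l v \<in> A"
      using * lp sublinear_exposed[OF sl] facial_exposed[OF sl fl] by (auto simp: A_def)
  qed
  \<comment> \<open>The term \<open>t = 1\<close> of the infimum at \<open>- v\<close> is
    \<open>l 0 - l v\<close>.\<close>
  have "l (- v) \<le> - l v" for v
    using exposed_le[OF sl, of 1 v "- v"] ex sublinear_0[OF sl] by simp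
  then have lin: "linear l" by (intro linear_if_sublinear_odd sl)
  show thesis
  proof (rule that[OF lin lp])
    fix a b :: "'v \<Rightarrow> real"
    assume ab: "linear a" "linear b" "a \<le> p" "b \<le> p" "\<And>x. l x = (a x + b x) / 2"
    then have "a \<le> l" using fl unfolding facial_def by auto
    show "a = l"
    proof
      fix x
      have "a x \<le> l x" "a (- x) \<le> l (- x)" using \<open>a \<le> l\<close> by (auto simp: le_fun_def)
      then show "a x = l x" using linear_neg[OF ab(1), of x] linear_neg[OF lin, of x] by linarith
    qed
  qed
qed

text \<open>A pair \<open>(s, t)\<close> of the cone is the constraint \<open>t \<le> l s\<close>.
  All constraints are absorbed into the sublinear \<open>p v = inf (q (v + s) - t)\<close>: the
  linear functionals below \<open>p\<close> are exactly those below \<open>q\<close> that obey them,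
  so extremality below \<open>p\<close> is extremality among the admissible functionals.\<close>

theorem extreme_mazur_orlicz:
  fixes q :: "'v::real_vector \<Rightarrow> real" and S :: "('v \<times> real) set"
  assumes q: "sublinear q" and zero: "(0, 0) \<in> S"
    and add: "\<And>s t s' t'. (s, t) \<in> S \<Longrightarrow> (s', t') \<in> S \<Longrightarrow> (s + s', t + t') \<in> S"
    and scale: "\<And>c s t. 0 < c \<Longrightarrow> (s, t) \<in> S \<Longrightarrow> (c *\<^sub>R s, c * t) \<in> S"
    and le: "\<And>s t. (s, t) \<in> S \<Longrightarrow> t \<le> q s"
  obtains l where "linear l" "l \<le> q" "\<And>s t. (s, t) \<in> S \<Longrightarrow> t \<le> l s"
    "\<And>a b. \<lbrakk>linear a; linear b; a \<le> q; b \<le> q; \<And>s t. (s, t) \<in> S \<Longrightarrow> t \<le> a s;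
      \<And>s t. (s, t) \<in> S \<Longrightarrow> t \<le> b s; \<And>x. l x = (a x + b x) / 2\<rbrakk> \<Longrightarrow> a = l"
proof -
  define p where "p v = (INF (s, t)\<in>S. q (v + s) - t)" for v
  have bdd: "bdd_below ((\<lambda>(s, t). q (v + s) - t) ` S)" for v
  proof (rule bdd_belowI2, clarify)
    fix s t assume "(s, t) \<in> S"
    then have "t \<le> q ((v + s) + (- v))" using le by simp
    also have "\<dots> \<le> q (v + s) + q (- v)" by (rule sublinearD[OF q])
    finally show "- q (- v) \<le> q (v + s) - t" by simp
  qed
  have low: "p v \<le> q (v + s) - t" if "(s, t) \<in> S" for v s t
    unfolding p_def using that by (intro cINF_lower2[OF bdd]) auto
  have less: "\<exists>s t. (s, t) \<in> S \<and> q (v + s) - t < r" if "p v < r" for v r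
    using that zero bdd[of v] unfolding p_def by (subst (asm) cINF_less_iff) auto
  have p0: "p 0 = 0"
  proof (rule antisym)
    show "p 0 \<le> 0" using low[OF zero, of 0] sublinear_0[OF q] by simp
    show "0 \<le> p 0" unfolding p_def using zero le by (intro cINF_greatest) auto
  qed
  have sub: "sublinear p"
  proof (rule sublinearI)
    fix x y
    show "p (x + y) \<le> p x + p y"
    proof (rule field_le_epsilon)
      fix e :: real assume "0 < e"
      obtain s t where s: "(s, t) \<in> S" "q (x + s) - t < p x + e / 2"
        using less[of x "p x + e / 2"] \<open>0 < e\<close> by auto
      obtain s' t' where s': "(s', t') \<in> S" "q (y + s') - t' < p y + e / 2"
        using less[of y "p y + e / 2"] \<open>0 < e\<close> by auto
      have "p (x + y) \<le> q ((x + y) + (s + s')) - (t + t')" by (rule low[OF add[OF s(1) s'(1)]])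
      also have "(x + y) + (s + s') = (x + s) + (y + s')" by simp
      also have "q \<dots> - (t + t') \<le> (q (x + s) - t) + (q (y + s') - t')"
        using sublinearD(1)[OF q, of "x + s" "y + s'"] by simp
      finally show "p (x + y) \<le> p x + p y + e" using s s' by simp
    qed
  next
    fix c :: real and x assume c: "0 < c"
    show "p (c *\<^sub>R x) \<le> c * p x"
    proof (rule field_le_epsilon)
      fix e :: real assume "0 < e"
      obtain s t where s: "(s, t) \<in> S" "q (x + s) - t < p x + e / c"
        using less[of x "p x + e / c"] \<open>0 < e\<close> c by auto
      have "p (c *\<^sub>R x) \<le> q (c *\<^sub>R x + c *\<^sub>R s) - c * t" by (rule low[OF scale[OF c s(1)]])
      also have "c *\<^sub>R x + c *\<^sub>R s = c *\<^sub>R (x + s)" by (simp add: algebra_simps)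
      also have "q \<dots> - c * t = c * (q (x + s) - t)"
        using sublinearD(2)[OF q, of c "x + s"] c by (simp add: right_diff_distrib)
      also have "\<dots> \<le> c * (p x + e / c)" using s c by (intro mult_left_mono) auto
      finally show "p (c *\<^sub>R x) \<le> c * p x + e" using c by (simp add: algebra_simps)
    qed
  qed (rule p0)
  have iff: "l \<le> p \<longleftrightarrow> l \<le> q \<and> (\<forall>s t. (s, t) \<in> S \<longrightarrow> t \<le> l s)" if l: "linear l" for l :: "'v \<Rightarrow> real"
  proof safe
    assume lp: "l \<le> p"
    have "p \<le> q" using low[OF zero] by (auto simp: le_fun_def)
    with lp show "l \<le> q" by simp
    fix s t assume "(s, t) \<in> S"
    then have "p (- s) \<le> - t" using low[of s t "- s"] sublinear_0[OF q] by simp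
    moreover have "l (- s) \<le> p (- s)" using lp by (simp add: le_fun_def)
    ultimately show "t \<le> l s" using linear_neg[OF l] by simp
  next
    assume lq: "l \<le> q" and S: "\<forall>s t. (s, t) \<in> S \<longrightarrow> t \<le> l s"
    show "l \<le> p"
      unfolding le_fun_def p_def
    proof (intro allI cINF_greatest)
      fix x st assume st: "st \<in> S"
      then have "snd st \<le> l (fst st)" using S by simp
      moreover have "l (x + fst st) \<le> q (x + fst st)" using lq by (simp add: le_fun_def)
      ultimately show "l x \<le> (case st of (s, t) \<Rightarrow> q (x + s) - t)"
        using linear_add[OF l, of x "fst st"] by (simp add: case_prod_beta)
    qed (use zero in auto)
  qed
  from extreme_linear_below_sublinear[OF sub] obtain l where l: "linear l" "l \<le> p"
    "\<And>a b. linear a \<Longrightarrow> linear b \<Longrightarrow> a \<le> p \<Longrightarrow> b \<le> p \<Longrightarrow> (\<And>x. l x = (a x + b x) / 2) \<Longrightarrow> a = l"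
    by blast
  show thesis
    by (rule that[of l]) (use l iff in auto)
qed

text \<open>Otherwise Mazur-Orlicz, applied to the cone of the pairs \<open>(t z, t e)\<close> with \<open>z\<close> in the hull,
  gives a functional that is at least \<open>e\<close> on \<open>S\<close>.\<close>

lemma zero_in_closure_convex_hull:
  fixes S :: "'v::real_normed_vector set"
  assumes ne: "S \<noteq> {}" and e: "0 < e"
    and fn: "\<And>l. linear l \<Longrightarrow> (\<And>x. l x \<le> norm x) \<Longrightarrow> \<exists>s\<in>S. l s < e"
  obtains z where "z \<in> convex hull S" "norm z < e"
proof (rule ccontr)
  assume "\<not> thesis"
  then have far: "e \<le> norm z" if "z \<in> convex hull S" for z
    using that \<open>\<And>z. z \<in> convex hull S \<Longrightarrow> norm z < e \<Longrightarrow> thesis\<close> by force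
  define T where "T = {(t *\<^sub>R z, t * e) |t z. 0 \<le> t \<and> z \<in> convex hull S}"
  obtain s0 where s0: "s0 \<in> convex hull S" using ne hull_inc by fastforce
  have nrm: "sublinear (norm :: 'v \<Rightarrow> real)"
    by (auto simp: sublinear_def norm_triangle_ineq)
  have "\<exists>l. linear l \<and> l \<le> (norm :: 'v \<Rightarrow> real) \<and> (\<forall>s t. (s, t) \<in> T \<longrightarrow> t \<le> l s)"
  proof (rule extreme_mazur_orlicz[OF nrm, of T])
    show "(0, 0) \<in> T" unfolding T_def using s0 by (auto intro!: exI[of _ 0] exI[of _ s0])
  next
    fix s t s' t' assume "(s, t) \<in> T" "(s', t') \<in> T"
    then obtain z z' c c' where *: "s = c *\<^sub>R z" "t = c * e" "0 \<le> c" "z \<in> convex hull S"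
      "s' = c' *\<^sub>R z'" "t' = c' * e" "0 \<le> c'" "z' \<in> convex hull S" unfolding T_def by auto
    show "(s + s', t + t') \<in> T"
    proof (cases "c + c' = 0")
      case True
      then have "c = 0" "c' = 0" using * by auto
      then show ?thesis using * unfolding T_def by (auto intro!: exI[of _ 0] exI[of _ z])
    next
      case False
      then have cc: "c + c' > 0" using * by simp
      define w where "w = (c / (c + c')) *\<^sub>R z + (c' / (c + c')) *\<^sub>R z'"
      have "w \<in> convex hull S"
        unfolding w_def using * cc
        by (intro convexD[OF convex_convex_hull]) (auto simp: add_divide_distrib[symmetric])
      moreover have "(c + c') *\<^sub>R w = s + s'"
        unfolding w_def using cc * by (simp add: scaleR_add_right)
      moreover have "t + t' = (c + c') * e" using * by (simp add: algebra_simps)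
      ultimately show ?thesis unfolding T_def using cc
        by (auto intro!: exI[of _ "c + c'"] exI[of _ w])
    qed
  next
    fix c :: real and s t assume "0 < c" "(s, t) \<in> T"
    then obtain z d where "s = d *\<^sub>R z" "t = d * e" "0 \<le> d" "z \<in> convex hull S" unfolding T_def by auto
    then show "(c *\<^sub>R s, c * t) \<in> T" unfolding T_def using \<open>0 < c\<close>
      by (auto intro!: exI[of _ "c * d"] exI[of _ z])
  next
    fix s t assume "(s, t) \<in> T"
    then show "t \<le> norm s" unfolding T_def using far by (auto intro!: mult_left_mono)
  qed blast
  then obtain l where l: "linear l" "l \<le> norm" "\<And>s t. (s, t) \<in> T \<Longrightarrow> t \<le> l s" by blast
  obtain s where s: "s \<in> S" "l s < e" using fn[OF l(1)] l(2) by (auto simp: le_fun_def)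
  have "(1 *\<^sub>R s, 1 * e) \<in> T" unfolding T_def using s(1) hull_inc[of s S convex]
    by (intro CollectI exI[of _ 1] exI[of _ s]) auto
  then show False using l(3) s(2) by fastforce
qed

section \<open>Means on bounded sequences\<close>

abbreviation bseq :: "(nat \<Rightarrow> real) \<Rightarrow> bool" where
  "bseq u \<equiv> bounded (range u)"

lemma bseqI: "(\<And>k. \<bar>u k\<bar> \<le> C) \<Longrightarrow> bseq u"
  by (auto intro!: boundedI)

lemma bseqD: assumes "bseq u" obtains C where "\<And>k. \<bar>u k\<bar> \<le> C"
  using assms by (auto simp: bounded_iff)

lemma bseq_add: assumes "bseq u" "bseq v" shows "bseq (\<lambda>k. u k + v k)"
  using assms by (rule bounded_plus_comp)

lemma bseq_mult: assumes "bseq u" "bseq v" shows "bseq (\<lambda>k. u k * v k :: real)"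
proof -
  obtain C where C: "\<And>k. \<bar>u k\<bar> \<le> C" using assms(1) by (rule bseqD) blast
  obtain D where D: "\<And>k. \<bar>v k\<bar> \<le> D" using assms(2) by (rule bseqD) blast
  have "\<bar>u k * v k\<bar> \<le> C * D" for k
    unfolding abs_mult using C[of k] D[of k] abs_ge_zero[of "u k"] by (intro mult_mono) auto
  then show ?thesis by (rule bseqI)
qed

lemma bseq_const: "bseq (\<lambda>k. c)" by (auto intro: bseqI)

lemma bseq_cmult: "bseq u \<Longrightarrow> bseq (\<lambda>k. c * u k)" by (intro bseq_mult bseq_const)

lemma bseq_minus: "bseq u \<Longrightarrow> bseq (\<lambda>k. - u k)" using bseq_cmult[of u "-1"] by simp

lemma bseq_diff: "bseq u \<Longrightarrow> bseq v \<Longrightarrow> bseq (\<lambda>k. u k - v k)"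
  using bseq_add[of u "\<lambda>k. - v k"] bseq_minus by simp

lemma bseq_abs: "bseq u \<Longrightarrow> bseq (\<lambda>k. \<bar>u k\<bar>)"
  by (auto simp: bounded_iff)

lemma bseq_shift: "bseq u \<Longrightarrow> bseq (\<lambda>k. u (k + n))"
  by (auto simp: bounded_iff)

lemma bseq_Suc: "bseq u \<Longrightarrow> bseq (\<lambda>k. u (Suc k))"
  using bseq_shift[of u 1] by simp

lemma bseq_sum: "(\<And>i. i \<in> I \<Longrightarrow> bseq (u i)) \<Longrightarrow> bseq (\<lambda>k. \<Sum>i\<in>I. u i k)"
  by (induction I rule: infinite_finite_induct) (auto intro: bseq_const bseq_add)

lemmas bseq_intros = bseq_add bseq_mult bseq_const bseq_cmult bseq_minus bseq_diff bseq_abs bseq_sum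

text \<open>Only the values on bounded sequences matter. The bound is required eventually, so a mean
  ignores finitely many terms.\<close>

definition is_mean :: "((nat \<Rightarrow> real) \<Rightarrow> real) \<Rightarrow> bool" where
  "is_mean m \<longleftrightarrow>
     (\<forall>u v. bseq u \<longrightarrow> bseq v \<longrightarrow> m (\<lambda>k. u k + v k) = m u + m v) \<and>
     (\<forall>c u. bseq u \<longrightarrow> m (\<lambda>k. c * u k) = c * m u) \<and>
     (\<forall>C u. bseq u \<longrightarrow> (\<forall>\<^sub>F k in sequentially. u k \<le> C) \<longrightarrow> m u \<le> C)"

lemma
  assumes m: "is_mean m"
  shows mean_add: "bseq u \<Longrightarrow> bseq v \<Longrightarrow> m (\<lambda>k. u k + v k) = m u + m v"
    and mean_cmult: "bseq u \<Longrightarrow> m (\<lambda>k. c * u k) = c * m u"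
    and mean_le: "bseq u \<Longrightarrow> \<forall>\<^sub>F k in sequentially. u k \<le> C \<Longrightarrow> m u \<le> C"
  using m unfolding is_mean_def by blast+

lemma mean_minus: "is_mean m \<Longrightarrow> bseq u \<Longrightarrow> m (\<lambda>k. - u k) = - m u"
  using mean_cmult[of m u "- 1"] by simp

lemma mean_diff: "is_mean m \<Longrightarrow> bseq u \<Longrightarrow> bseq v \<Longrightarrow> m (\<lambda>k. u k - v k) = m u - m v"
  using mean_add[of m u "\<lambda>k. - v k"] by (simp add: mean_minus bseq_minus)

lemma mean_ge: assumes "is_mean m" "bseq u" "\<forall>\<^sub>F k in sequentially. C \<le> u k" shows "C \<le> m u"
  using mean_le[OF assms(1), of "\<lambda>k. - u k" "- C"] assms by (simp add: mean_minus bseq_minus)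

lemma mean_const: "is_mean m \<Longrightarrow> m (\<lambda>k. c) = c"
  using mean_le[of m "\<lambda>k. c" c] mean_ge[of m "\<lambda>k. c" c] by (auto simp: bseq_const)

lemma mean_mono_ev:
  assumes "is_mean m" "bseq u" "bseq v" "\<forall>\<^sub>F k in sequentially. u k \<le> v k" shows "m u \<le> m v"
  using mean_le[OF assms(1), of "\<lambda>k. u k - v k" 0] assms by (simp add: mean_diff bseq_diff)

lemma mean_mono:
  assumes "is_mean m" "bseq u" "bseq v" "\<And>k. u k \<le> v k" shows "m u \<le> m v"
  using assms by (intro mean_mono_ev) auto

lemma mean_cong_ev:
  assumes "is_mean m" "bseq u" "bseq v" "\<forall>\<^sub>F k in sequentially. u k = v k" shows "m u = m v"
  using assms by (intro antisym mean_mono_ev) (auto elim: eventually_mono)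

lemma mean_nonneg: "is_mean m \<Longrightarrow> bseq u \<Longrightarrow> (\<And>k. 0 \<le> u k) \<Longrightarrow> 0 \<le> m u"
  by (rule mean_ge) auto

lemma mean_abs_le:
  assumes "is_mean m" "bseq u" shows "\<bar>m u\<bar> \<le> m (\<lambda>k. \<bar>u k\<bar>)"
proof -
  have "m u \<le> m (\<lambda>k. \<bar>u k\<bar>)"
    by (intro mean_mono[OF assms(1)] bseq_abs assms(2)) simp
  moreover have "m (\<lambda>k. - u k) \<le> m (\<lambda>k. \<bar>u k\<bar>)"
    by (intro mean_mono[OF assms(1)] bseq_abs bseq_minus assms(2)) simp
  ultimately show ?thesis using mean_minus[OF assms] by simp
qed

lemma mean_abs_bound:
  assumes "is_mean m" "\<And>k. \<bar>u k\<bar> \<le> C" shows "\<bar>m u\<bar> \<le> C"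
proof -
  have u: "bseq u" using assms(2) by (rule bseqI)
  have "m (\<lambda>k. \<bar>u k\<bar>) \<le> C"
    using assms(2) by (intro mean_le[OF assms(1)] bseq_abs u) auto
  then show ?thesis using mean_abs_le[OF assms(1) u] by simp
qed

lemma mean_sum:
  assumes "is_mean m" "\<And>i. i \<in> I \<Longrightarrow> bseq (u i)"
  shows "m (\<lambda>k. \<Sum>i\<in>I. u i k) = (\<Sum>i\<in>I. m (u i))"
  using assms(2)
proof (induction I rule: infinite_finite_induct)
  case (insert i I)
  have "m (\<lambda>k. u i k + (\<Sum>i\<in>I. u i k)) = m (u i) + m (\<lambda>k. \<Sum>i\<in>I. u i k)"
    using insert.prems by (intro mean_add[OF assms(1)] bseq_sum) auto
  then show ?case using insert by simp
qed (simp_all add: mean_const[OF assms(1)])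

text \<open>Only the finitely many coordinates \<open>l (f k)\<close> matter, so this is a Euclidean
  separation argument: the squared distance \<open>\<Phi>\<close> to the vector of means is made
  small on the hull. Its infimum need not be attained, hence the use of a near-minimizer. Tails are
  allowed because a mean ignores finitely many terms.\<close>

lemma mean_in_closure_convex_hull:
  fixes f :: "nat \<Rightarrow> 'v::real_vector" and L :: "('v \<Rightarrow> real) set"
  assumes m: "is_mean m" and fin: "finite L" and lin: "\<And>l. l \<in> L \<Longrightarrow> linear l"
    and bdd: "\<And>l. l \<in> L \<Longrightarrow> bseq (\<lambda>k. l (f k))" and e: "0 < e"
  shows "\<exists>c\<in>convex hull (f ` {N..}). \<forall>l\<in>L. \<bar>l c - m (\<lambda>k. l (f k))\<bar> < e"
proof -
  define b where "b l = m (\<lambda>k. l (f k))" for l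
  define H where "H = convex hull (f ` {N..})"
  define \<Phi> where "\<Phi> c = (\<Sum>l\<in>L. (l c - b l)\<^sup>2)" for c
  define d where "d = (INF c\<in>H. \<Phi> c)"
  have H0: "f N \<in> H" unfolding H_def by (intro hull_inc) auto
  have \<Phi>0: "0 \<le> \<Phi> c" for c unfolding \<Phi>_def by (intro sum_nonneg) auto
  have bddH: "bdd_below (\<Phi> ` H)" using \<Phi>0 by (intro bdd_belowI2) auto
  have d_le: "d \<le> \<Phi> c" if "c \<in> H" for c unfolding d_def using that by (intro cINF_lower bddH)
  have d_less: "\<exists>c\<in>H. \<Phi> c < r" if "d < r" for r
    using that H0 bddH unfolding d_def by (subst (asm) cINF_less_iff) auto
  have "\<exists>K. \<forall>k. \<bar>l (f k)\<bar> \<le> K" if "l \<in> L" for l using bdd[OF that] by (rule bseqD) blast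
  then obtain K where K: "\<And>l k. l \<in> L \<Longrightarrow> \<bar>l (f k)\<bar> \<le> K l" by metis
  have KH: "\<bar>l c\<bar> \<le> K l" if "l \<in> L" "c \<in> H" for l c
  proof -
    have "H \<subseteq> l -` cball 0 (K l)"
      unfolding H_def using that K
      by (intro hull_minimal convex_linear_vimage lin convex_cball) auto
    then show ?thesis using that by auto
  qed
  define B where "B = (\<Sum>l\<in>L. (2 * K l)\<^sup>2)"
  have B0: "0 \<le> B" unfolding B_def by (intro sum_nonneg) auto
  have "d \<le> 0"
  proof (rule ccontr)
    assume "\<not> d \<le> 0"
    then have d: "d > 0" by simp
    \<comment> \<open>Moving from \<open>c\<close> a distance \<open>t\<close> towards
      \<open>f k\<close> costs at most \<open>t * t * B\<close> in second order, and
      \<open>c\<close> is chosen within \<open>t * d / 2\<close> of the infimum. With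
      \<open>t * B \<le> d\<close> the averaged first-order term is at most
      \<open>d / 4 + d / 2\<close>, but its mean over \<open>k\<close> is exactly
      \<open>\<Phi> c \<ge> d\<close>.\<close>
    define t where "t = min 1 (d / (B + 1))"
    have t: "0 < t" "t \<le> 1" "t * B \<le> d"
    proof -
      show "0 < t" "t \<le> 1" using d B0 by (auto simp: t_def)
      have "t * B \<le> d / (B + 1) * B" unfolding t_def using B0 by (intro mult_right_mono) auto
      also have "\<dots> \<le> d" using d B0 by (simp add: field_simps)
      finally show "t * B \<le> d" .
    qed
    obtain c where c: "c \<in> H" "\<Phi> c < d + t * d / 2" using d_less[of "d + t * d / 2"] d t by auto
    have *: "(\<Sum>l\<in>L. (l c - b l) * (l c - l (f k))) \<le> (t * d / 2 + t * t * B) / (2 * t)" if k: "N \<le> k" for k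
    proof -
      define c' where "c' = (1 - t) *\<^sub>R c + t *\<^sub>R f k"
      have "f k \<in> H" using k unfolding H_def by (intro hull_inc) auto
      moreover have "convex H" unfolding H_def by (rule convex_convex_hull)
      ultimately have "c' \<in> H" unfolding c'_def using c(1) t(1,2)
        by (simp add: convexD)
      then have "d \<le> \<Phi> c'" by (rule d_le)
      also have "\<Phi> c' = (\<Sum>l\<in>L. (l c - b l)\<^sup>2 - 2 * t * ((l c - b l) * (l c - l (f k))) + t * t * (l c - l (f k))\<^sup>2)"
        unfolding \<Phi>_def
      proof (rule sum.cong[OF refl])
        fix l assume "l \<in> L"
        have eq: "l c' = (1 - t) * l c + t * l (f k)"
          unfolding c'_def using lin[OF \<open>l \<in> L\<close>] by (simp add: linear_add linear_scale)
        show "(l c' - b l)\<^sup>2 = (l c - b l)\<^sup>2 - 2 * t * ((l c - b l) * (l c - l (f k))) + t * t * (l c - l (f k))\<^sup>2"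
          unfolding eq by (simp add: power2_eq_square algebra_simps)
      qed
      also have "\<dots> = \<Phi> c - 2 * t * (\<Sum>l\<in>L. (l c - b l) * (l c - l (f k))) + t * t * (\<Sum>l\<in>L. (l c - l (f k))\<^sup>2)"
        by (simp add: \<Phi>_def sum.distrib sum_subtractf sum_distrib_left)
      also have "(\<Sum>l\<in>L. (l c - l (f k))\<^sup>2) \<le> B"
        unfolding B_def
      proof (rule sum_mono)
        fix l assume "l \<in> L"
        then have "\<bar>l c - l (f k)\<bar> \<le> \<bar>2 * K l\<bar>" using KH[of l c] K[of l k] c by linarith
        then show "(l c - l (f k))\<^sup>2 \<le> (2 * K l)\<^sup>2" by (simp add: abs_le_square_iff)
      qed
      finally have "2 * t * (\<Sum>l\<in>L. (l c - b l) * (l c - l (f k))) \<le> t * d / 2 + t * t * B"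
        using c t by (simp add: mult_left_mono)
      then show ?thesis using t by (simp add: field_simps)
    qed
    have bs1: "bseq (\<lambda>k. l c - l (f k))" if "l \<in> L" for l
      by (rule bseq_diff[OF bseq_const bdd[OF that]])
    have bs: "bseq (\<lambda>k. (l c - b l) * (l c - l (f k)))" if "l \<in> L" for l
      by (rule bseq_cmult[OF bs1[OF that]])
    have "m (\<lambda>k. \<Sum>l\<in>L. (l c - b l) * (l c - l (f k))) \<le> (t * d / 2 + t * t * B) / (2 * t)"
      using * by (intro mean_le[OF m bseq_sum[OF bs]]) (auto simp: eventually_sequentially)
    also have "m (\<lambda>k. \<Sum>l\<in>L. (l c - b l) * (l c - l (f k))) = (\<Sum>l\<in>L. m (\<lambda>k. (l c - b l) * (l c - l (f k))))"
      by (rule mean_sum[OF m bs])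
    also have "\<dots> = \<Phi> c"
      unfolding \<Phi>_def
    proof (rule sum.cong[OF refl])
      fix l assume l: "l \<in> L"
      have "m (\<lambda>k. (l c - b l) * (l c - l (f k))) = (l c - b l) * m (\<lambda>k. l c - l (f k))"
        by (rule mean_cmult[OF m bs1[OF l]])
      also have "m (\<lambda>k. l c - l (f k)) = l c - b l"
        using mean_diff[OF m bseq_const bdd[OF l], of "l c"] mean_const[OF m] by (simp add: b_def)
      finally show "m (\<lambda>k. (l c - b l) * (l c - l (f k))) = (l c - b l)\<^sup>2" by (simp add: power2_eq_square)
    qed
    finally have "d \<le> (t * d / 2 + t * t * B) / (2 * t)" using d_le[OF c(1)] by simp
    also have "\<dots> \<le> (t * d / 2 + t * d) / (2 * t)"
      using t by (intro divide_right_mono) (auto intro: mult_left_mono simp: mult.assoc)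
    also have "\<dots> = 3 / 4 * d" using t by (simp add: field_simps)
    finally show False using d by simp
  qed
  then have "d < e\<^sup>2" using e by (meson le_less_trans zero_less_power)
  then obtain c where c: "c \<in> H" "\<Phi> c < e\<^sup>2" using d_less[of "e\<^sup>2"] by blast
  show ?thesis
  proof (intro bexI[of _ c] ballI)
    show "c \<in> convex hull (f ` {N..})" using c by (simp add: H_def)
    fix l assume "l \<in> L"
    then have "(l c - b l)\<^sup>2 \<le> \<Phi> c" unfolding \<Phi>_def using fin by (intro member_le_sum) auto
    then have "(l c - b l)\<^sup>2 < e\<^sup>2" using c by simp
    then have "\<bar>l c - b l\<bar> < e" using e by (rule_tac power2_less_imp_less) auto
    then show "\<bar>l c - m (\<lambda>k. l (f k))\<bar> < e" using e by (simp add: b_def)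
  qed
qed

section \<open>Shift-invariant means (Banach limits) and their extreme points\<close>

definition shift_inv :: "((nat \<Rightarrow> real) \<Rightarrow> real) \<Rightarrow> bool" where
  "shift_inv m \<longleftrightarrow> (\<forall>u. bseq u \<longrightarrow> m (\<lambda>k. u (Suc k)) = m u)"

text \<open>A bound for all terms suffices here, since invariance allows any finite initial segment
  to be shifted away.\<close>

lemma is_mean_shift_invI:
  assumes add: "\<And>u v. bseq u \<Longrightarrow> bseq v \<Longrightarrow> m (\<lambda>k. u k + v k) = m u + m v"
    and cmult: "\<And>c u. bseq u \<Longrightarrow> m (\<lambda>k. c * u k) = c * m u"
    and le: "\<And>C u. bseq u \<Longrightarrow> (\<And>k. u k \<le> C) \<Longrightarrow> m u \<le> C"
    and inv: "shift_inv m"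
  shows "is_mean m"
  unfolding is_mean_def
proof (intro conjI allI impI)
  fix C u assume u: "bseq u" and ev: "\<forall>\<^sub>F k in sequentially. u k \<le> C"
  have sh: "m (\<lambda>k. u (k + n)) = m u" for n
  proof (induction n)
    case (Suc n)
    have "m (\<lambda>k. u (Suc k + n)) = m (\<lambda>k. u (k + n))"
      using inv[unfolded shift_inv_def, rule_format, OF bseq_shift[OF u, of n]] by simp
    then show ?case using Suc by simp
  qed simp
  obtain N where "\<And>k. N \<le> k \<Longrightarrow> u k \<le> C" using ev by (auto simp: eventually_sequentially)
  then have "m (\<lambda>k. u (k + N)) \<le> C" using u by (intro le bseq_shift) auto
  then show "m u \<le> C" using sh by simp
qed (use add cmult in auto)

lemma apply_Bcontfun_bseq: "bseq u \<Longrightarrow> apply_bcontfun (Bcontfun u) = u"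
  by (intro Bcontfun_inverse) (auto simp: bcontfun_def)

text \<open>Below the supremum functional, invariance is a family of Mazur-Orlicz constraints, so
  extremality among invariant means comes with the existence theorem. Sequences enter as bounded
  continuous functions on the discrete space of naturals.\<close>

theorem extreme_banach_limit:
  obtains m where "is_mean m" "shift_inv m"
    "\<And>a b u. is_mean a \<Longrightarrow> is_mean b \<Longrightarrow> shift_inv a \<Longrightarrow> shift_inv b \<Longrightarrow>
       (\<And>u. bseq u \<Longrightarrow> m u = (a u + b u) / 2) \<Longrightarrow> bseq u \<Longrightarrow> a u = m u"
proof -
  define q where "q (v :: nat \<Rightarrow>\<^sub>C real) = (SUP k. v k)" for v
  have bd: "bdd_above (range (apply_bcontfun v))" for v :: "nat \<Rightarrow>\<^sub>C real"
    by (intro bounded_imp_bdd_above) auto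
  have q_ge: "v k \<le> q v" for v :: "nat \<Rightarrow>\<^sub>C real" and k unfolding q_def by (intro cSUP_upper bd) auto
  have q_le: "q v \<le> C" if "\<And>k. v k \<le> C" for v :: "nat \<Rightarrow>\<^sub>C real" and C unfolding q_def using that by (intro cSUP_least) auto
  have q: "sublinear q"
  proof (rule sublinearI)
    show "q (x + y) \<le> q x + q y" for x y using q_ge[of x] q_ge[of y] by (intro q_le) (auto intro: add_mono)
    show "q (c *\<^sub>R x) \<le> c * q x" if "0 < c" for c x using q_ge[of x] that by (intro q_le) auto
    show "q 0 = 0" by (simp add: q_def)
  qed
  define sh where "sh (w :: nat \<Rightarrow>\<^sub>C real) = Bcontfun (\<lambda>k. w (Suc k))" for w
  have sh: "apply_bcontfun (sh w) k = w (Suc k)" for w :: "nat \<Rightarrow>\<^sub>C real" and k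
    unfolding sh_def by (subst apply_Bcontfun_bseq) (auto intro!: bseq_Suc)
  have sh_lin: "sh (v + w) = sh v + sh w" "sh (c *\<^sub>R v) = c *\<^sub>R sh v" for v w c
    by (auto intro!: bcontfun_eqI simp: sh)
  \<comment> \<open>The set contains the negative of each of its elements, so the inequality
    \<open>0 \<le> l (w - sh w)\<close> amounts to equality.\<close>
  define S where "S = (\<lambda>w. (w - sh w, 0 :: real)) ` UNIV"
  have S0: "(0, 0) \<in> S" unfolding S_def using sh_lin(2)[of 0 0] by (auto intro!: image_eqI[of _ _ 0])
  have S_add: "(s + s', t + t') \<in> S" if "(s, t) \<in> S" "(s', t') \<in> S" for s t s' t'
  proof -
    obtain v w where "s = v - sh v" "s' = w - sh w" "t = 0" "t' = 0" using \<open>(s, t) \<in> S\<close> \<open>(s', t') \<in> S\<close> by (auto simp: S_def)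
    then show "(s + s', t + t') \<in> S" by (auto simp: S_def sh_lin intro!: image_eqI[of _ _ "v + w"])
  qed
  have S_scale: "(c *\<^sub>R s, c * t) \<in> S" if "0 < c" "(s, t) \<in> S" for c s t
  proof -
    obtain v where "s = v - sh v" "t = 0" using \<open>(s, t) \<in> S\<close> by (auto simp: S_def)
    then show "(c *\<^sub>R s, c * t) \<in> S"
      by (auto simp: S_def sh_lin scaleR_diff_right intro!: image_eqI[of _ _ "c *\<^sub>R v"])
  qed
  \<comment> \<open>The constraints are compatible with the supremum: if all differences
    \<open>v k - v (Suc k)\<close> were below a negative number, \<open>v\<close> would grow
    linearly.\<close>
  have S_le: "t \<le> q s" if "(s, t) \<in> S" for s t
  proof (rule ccontr)
    obtain v where v: "s = v - sh v" "t = 0" using \<open>(s, t) \<in> S\<close> by (auto simp: S_def)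
    assume "\<not> t \<le> q s"
    then have neg: "q s < 0" using v by simp
    have step: "v k - v (Suc k) \<le> q s" for k using q_ge[of s k] v by (simp add: sh)
    have grow: "v 0 - real n * q s \<le> v n" for n
    proof (induction n)
      case (Suc n)
      then show ?case using step[of n] by (simp add: algebra_simps)
    qed simp
    obtain C where C: "\<And>k. \<bar>v k\<bar> \<le> C" using bounded_apply_bcontfun[of v] by (rule bseqD) blast
    obtain n :: nat where "2 * C / (- q s) < real n" using reals_Archimedean2 by blast
    then have "2 * C < real n * (- q s)" using neg by (simp add: field_simps)
    then show False using grow[of n] C[of n] C[of 0] by linarith
  qed
  show thesis
  proof (rule extreme_mazur_orlicz[OF q S0 S_add S_scale S_le])
    fix l assume l: "linear l" "l \<le> q" "\<And>s t. (s, t) \<in> S \<Longrightarrow> t \<le> l s"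
      and ext: "\<And>a b. \<lbrakk>linear a; linear b; a \<le> q; b \<le> q; \<And>s t. (s, t) \<in> S \<Longrightarrow> t \<le> a s;
        \<And>s t. (s, t) \<in> S \<Longrightarrow> t \<le> b s; \<And>x. l x = (a x + b x) / 2\<rbrakk> \<Longrightarrow> a = l"
  have l_sh: "l (sh w) = l w" for w
  proof -
    have "0 \<le> l (w - sh w)" "0 \<le> l ((- 1) *\<^sub>R w - sh ((- 1) *\<^sub>R w))" using l(3) unfolding S_def by blast+
    then show ?thesis using l(1) unfolding sh_lin by (simp add: linear_diff linear_add linear_neg)
  qed
  define m where "m u = l (Bcontfun u)" for u
  have Bf: "apply_bcontfun (Bcontfun u) = u" if "bseq u" for u using that by (rule apply_Bcontfun_bseq)
  have inv: "shift_inv m"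
    unfolding shift_inv_def m_def
  proof (intro allI impI)
    fix u assume "bseq u"
    then have "Bcontfun (\<lambda>k. u (Suc k)) = sh (Bcontfun u)" by (intro bcontfun_eqI) (simp add: sh Bf bseq_Suc)
    then show "l (Bcontfun (\<lambda>k. u (Suc k))) = l (Bcontfun u)" by (simp add: l_sh)
  qed
  have mean: "is_mean m"
  proof (rule is_mean_shift_invI[OF _ _ _ inv])
    fix u v assume "bseq u" "bseq v"
    then have "Bcontfun (\<lambda>k. u k + v k) = Bcontfun u + Bcontfun v" by (intro bcontfun_eqI) (simp add: Bf bseq_intros)
    then show "m (\<lambda>k. u k + v k) = m u + m v" by (simp add: m_def linear_add[OF l(1)])
  next
    fix c u assume "bseq u"
    then have "Bcontfun (\<lambda>k. c * u k) = c *\<^sub>R Bcontfun u" by (intro bcontfun_eqI) (simp add: Bf bseq_intros)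
    then show "m (\<lambda>k. c * u k) = c * m u" by (simp add: m_def linear_scale[OF l(1)])
  next
    fix C u assume "bseq u" "\<And>k. u k \<le> C"
    then have "q (Bcontfun u) \<le> C" by (intro q_le) (simp add: Bf)
    then show "m u \<le> C" using l(2) by (auto simp: m_def le_fun_def intro: order_trans)
  qed
  show thesis
  proof (rule that[OF mean inv])
    fix a b u
    assume ab: "is_mean a" "is_mean b" "shift_inv a" "shift_inv b"
      and avg: "\<And>u. bseq u \<Longrightarrow> m u = (a u + b u) / 2" and u: "bseq u"
    have *: "linear (\<lambda>v. a (apply_bcontfun v))" "(\<lambda>v. a (apply_bcontfun v)) \<le> q"
      "(s, t) \<in> S \<Longrightarrow> t \<le> a (apply_bcontfun s)" if "is_mean a" "shift_inv a" for a s t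
    proof -
      show "linear (\<lambda>v. a (apply_bcontfun v))"
        by (rule linearI) (simp_all add: mean_add[OF that(1)] mean_cmult[OF that(1)])
      show "(\<lambda>v. a (apply_bcontfun v)) \<le> q"
        unfolding le_fun_def using q_ge by (auto intro!: mean_le[OF that(1)])
      assume "(s, t) \<in> S"
      then obtain v where "s = v - sh v" "t = 0" by (auto simp: S_def)
      moreover have "a (apply_bcontfun (sh v)) = a (apply_bcontfun v)"
        using that(2)[unfolded shift_inv_def, rule_format, of "apply_bcontfun v"]
        unfolding sh[abs_def] by simp
      ultimately show "t \<le> a (apply_bcontfun s)"
        by (simp add: minus_bcontfun.rep_eq[abs_def] mean_diff[OF that(1)])
    qed
    have "(\<lambda>v. a (apply_bcontfun v)) = l"
    proof (rule ext)
      show "l x = (a (apply_bcontfun x) + b (apply_bcontfun x)) / 2" for x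
        using avg[of "apply_bcontfun x"] by (simp add: m_def apply_bcontfun_inverse)
    qed (use * ab in auto)
    then have "a (apply_bcontfun (Bcontfun u)) = l (Bcontfun u)" by (rule fun_cong)
    then show "a u = m u" using u by (simp add: m_def Bf)
  qed
qed
qed

section \<open>The Riesz representation theorem on compact metric spaces\<close>

text \<open>Integer levels below \<open>y\<close> recover \<open>y\<close> up to an error of one;
  after scaling, this is the discretization both of the integral of a continuous function and of a
  function separated at equidistant levels.\<close>

lemma count_levels:
  fixes y :: real
  shows "min (max y 0) (real m) \<le> 1 + (\<Sum>j<m. of_bool (real j + 1 \<le> y))"
    and "(\<Sum>j<m. of_bool (real j < y)) \<le> max y 0 + (1 :: real)"
proof (induction m)
  case (Suc m)
  {
    case 1
    show ?case
    proof (cases "real m \<le> y")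
      case True
      then have "(\<Sum>j<m. of_bool (real j + 1 \<le> y)) = (\<Sum>j<m. 1 :: real)" by (intro sum.cong) auto
      then show ?thesis by auto
    qed (use Suc in auto)
  next
    case 2
    show ?case
    proof (cases "real m < y")
      case True
      have "(\<Sum>j<m. of_bool (real j < y)) \<le> (\<Sum>j<m. 1 :: real)" by (intro sum_mono) auto
      then show ?thesis using True by auto
    qed (use Suc in auto)
  }
qed auto

definition pos_functional :: "(('a::topological_space \<Rightarrow> real) \<Rightarrow> real) \<Rightarrow> bool" where
  "pos_functional L \<longleftrightarrow>
     (\<forall>f g. continuous_on UNIV f \<longrightarrow> continuous_on UNIV g \<longrightarrow> L (\<lambda>x. f x + g x) = L f + L g) \<and>
     (\<forall>c f. continuous_on UNIV f \<longrightarrow> L (\<lambda>x. c * f x) = c * L f) \<and>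
     (\<forall>f. continuous_on UNIV f \<longrightarrow> (\<forall>x. 0 \<le> f x) \<longrightarrow> 0 \<le> L f)"

locale pos_functional_on =
  fixes L :: "('a::metric_space \<Rightarrow> real) \<Rightarrow> real"
  assumes pos_functional: "pos_functional L" and compact_UNIV: "compact (UNIV :: 'a set)"
begin

abbreviation cont :: "('a \<Rightarrow> real) \<Rightarrow> bool" where "cont f \<equiv> continuous_on UNIV f"

lemma L_add: "cont f \<Longrightarrow> cont g \<Longrightarrow> L (\<lambda>x. f x + g x) = L f + L g"
  and L_cmult: "cont f \<Longrightarrow> L (\<lambda>x. c * f x) = c * L f"
  and L_nonneg: "cont f \<Longrightarrow> (\<And>x. 0 \<le> f x) \<Longrightarrow> 0 \<le> L f"
  using pos_functional unfolding pos_functional_def by blast+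

lemma L_0: "L (\<lambda>x. 0) = 0"
  using L_cmult[of "\<lambda>x. 0" 0] by simp

lemma L_diff: assumes "cont f" "cont g" shows "L (\<lambda>x. f x - g x) = L f - L g"
proof -
  have "cont (\<lambda>x. - 1 * g x)" using assms(2) by (intro continuous_intros)
  then show ?thesis using L_add[OF assms(1), of "\<lambda>x. - 1 * g x"] L_cmult[OF assms(2), of "- 1"] by simp
qed

lemma L_mono: assumes "cont f" "cont g" "\<And>x. f x \<le> g x" shows "L f \<le> L g"
  using L_nonneg[of "\<lambda>x. g x - f x"] L_diff[OF assms(2,1)] assms by (auto intro: continuous_intros)

lemma L_sum: "(\<And>i. i \<in> I \<Longrightarrow> cont (f i)) \<Longrightarrow> L (\<lambda>x. \<Sum>i\<in>I. f i x) = (\<Sum>i\<in>I. L (f i))"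
proof (induction I rule: infinite_finite_induct)
  case (insert i I)
  have "cont (\<lambda>x. \<Sum>i\<in>I. f i x)" using insert.prems by (intro continuous_intros) auto
  then have "L (\<lambda>x. f i x + (\<Sum>i\<in>I. f i x)) = L (f i) + L (\<lambda>x. \<Sum>i\<in>I. f i x)"
    using insert.prems by (intro L_add) auto
  then show ?case using insert by simp
qed (simp_all add: L_0)

section \<open>The outer measure of a positive functional\<close>

definition cover :: "'a set \<Rightarrow> (nat \<Rightarrow> 'a \<Rightarrow> real) \<Rightarrow> bool" where
  "cover A F \<longleftrightarrow> (\<forall>i. cont (F i)) \<and> (\<forall>i x. 0 \<le> F i x) \<and> (\<forall>x\<in>A. 1 \<le> (\<Sum>i. ennreal (F i x)))"

text \<open>A Daniell-type outer measure: sets are covered by countable sums of nonnegative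
  continuous functions rather than by open sets, so that the price of a cover is directly a value of
  \<open>L\<close>.\<close>

definition om :: "'a set \<Rightarrow> ennreal" where
  "om A = (INF F\<in>Collect (cover A). \<Sum>i. ennreal (L (F i)))"

lemma om_le: "cover A F \<Longrightarrow> om A \<le> (\<Sum>i. ennreal (L (F i)))"
  unfolding om_def by (intro INF_lower) auto

lemma om_le_single:
  assumes "cont f" "\<And>x. 0 \<le> f x" "\<And>x. x \<in> A \<Longrightarrow> 1 \<le> f x"
  shows "om A \<le> ennreal (L f)"
proof -
  have fin: "(\<Sum>i. ennreal (g i)) = ennreal (g 0)" if "\<And>i. i \<noteq> 0 \<Longrightarrow> g i = 0" for g :: "nat \<Rightarrow> real"
    using that by (subst suminf_finite[of "{0}"]) auto
  have c: "cover A (\<lambda>i x. if i = (0::nat) then f x else 0)"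
    unfolding cover_def
  proof (intro conjI allI ballI)
    show "cont (\<lambda>x. if i = (0::nat) then f x else 0)" for i using assms(1) by (cases "i = 0") auto
    fix x assume "x \<in> A"
    then show "1 \<le> (\<Sum>i. ennreal (if i = (0::nat) then f x else 0))"
      using assms(3) by (subst fin) auto
  qed (use assms(2) in auto)
  have "om A \<le> (\<Sum>i. ennreal (L (\<lambda>x. if i = (0::nat) then f x else 0)))" by (rule om_le[OF c])
  then show ?thesis by (subst (asm) fin) (auto simp: L_0)
qed

lemma om_empty: "om {} = 0"
  using om_le_single[of "\<lambda>x. 0" "{}"] by (simp add: L_0)

lemma om_mono: "A \<subseteq> B \<Longrightarrow> om A \<le> om B"
  unfolding om_def by (intro INF_superset_mono) (auto simp: cover_def subset_iff)

lemma cover_prod_decode: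
  assumes "\<And>n i. cont (F n i)" "\<And>n i x. 0 \<le> F n i x"
    and "\<And>x. x \<in> A \<Longrightarrow> 1 \<le> (\<Sum>n. \<Sum>i. ennreal (F n i x))"
  shows "om A \<le> (\<Sum>n. \<Sum>i. ennreal (L (F n i)))"
proof -
  define G where "G j = (case prod_decode j of (n, i) \<Rightarrow> F n i)" for j
  have G: "(\<Sum>j. ennreal (h (G j))) = (\<Sum>n. \<Sum>i. ennreal (h (F n i)))" for h
    using suminf_ennreal_2dimen[of "\<lambda>n. \<Sum>i. ennreal (h (F n i))" "\<lambda>(n, i). ennreal (h (F n i))"]
    by (simp add: G_def o_def case_prod_beta)
  have "cover A G"
    unfolding cover_def using assms G[of "\<lambda>f. f x" for x] by (auto simp: G_def split: prod.splits)
  then show ?thesis using om_le[of A G] G[of L] by simp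
qed

lemma om_subadditive: "om (\<Union>i. A i) \<le> (\<Sum>n. om (A n))"
proof (rule ennreal_le_epsilon)
  fix e :: real assume e: "0 < e" and fin: "(\<Sum>n. om (A n)) < top"
  have "om (A n) < om (A n) + ennreal (e * (1/2) ^ Suc n)" for n
    using fin e by (auto simp: less_top dest!: ennreal_suminf_lessD)
  then have "\<exists>F. cover (A n) F \<and> (\<Sum>i. ennreal (L (F i))) < om (A n) + ennreal (e * (1/2) ^ Suc n)" for n
    unfolding om_def[of "A n", unfolded INF_less_iff] by (simp add: om_def INF_less_iff Bex_def)
  then obtain F where F: "\<And>n. cover (A n) (F n)"
    "\<And>n. (\<Sum>i. ennreal (L (F n i))) < om (A n) + ennreal (e * (1/2) ^ Suc n)" by metis
  have "om (\<Union>i. A i) \<le> (\<Sum>n. \<Sum>i. ennreal (L (F n i)))"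
  proof (rule cover_prod_decode)
    fix x assume "x \<in> (\<Union>i. A i)"
    then obtain n where "x \<in> A n" by blast
    then have "1 \<le> (\<Sum>i. ennreal (F n i x))" using F(1) by (simp add: cover_def)
    also have "\<dots> \<le> (\<Sum>n. \<Sum>i. ennreal (F n i x))"
      using sum_le_suminf[of "\<lambda>n. \<Sum>i. ennreal (F n i x)" "{n}"] by (simp add: summableI)
    finally show "1 \<le> (\<Sum>n. \<Sum>i. ennreal (F n i x))" .
  qed (use F(1) in \<open>auto simp: cover_def\<close>)
  also have "\<dots> \<le> (\<Sum>n. om (A n) + ennreal (e * (1/2) ^ Suc n))"
    using F(2) by (intro suminf_le summableI less_imp_le)
  also have "\<dots> = (\<Sum>n. om (A n)) + (\<Sum>n. ennreal (e * (1/2) ^ Suc n))"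
    by (intro suminf_add[symmetric] summableI)
  also have "(\<Sum>n. ennreal (e * (1/2) ^ Suc n)) = ennreal e"
    using e power_half_series by (subst suminf_ennreal_eq[of _ e]) (auto dest: sums_mult[of _ _ e])
  finally show "om (\<Union>i. A i) \<le> (\<Sum>n. om (A n)) + ennreal e" .
qed

lemma om_subadditive2: "om (A \<union> B) \<le> om A + om B"
proof -
  define S where "S n = (if n = 0 then A else if n = 1 then B else {})" for n :: nat
  have "A \<union> B = (\<Union>n. S n)" by (auto simp: S_def split: if_splits)
  moreover have "(\<Sum>n. om (S n)) = om A + om B"
    by (subst suminf_finite[of "{0, 1}"]) (auto simp: S_def om_empty)
  ultimately show ?thesis using om_subadditive[of S] by simp
qed

text \<open>Splitting a cover along \<open>u n\<close>, which increases to the indicator of \<open>U\<close>.\<close>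

lemma om_split_open:
  assumes U: "open U"
  shows "om (A \<inter> U) + om (A - U) \<le> om A"
proof (cases "U = UNIV")
  \<comment> \<open>Treated apart because \<open>infdist\<close> to the empty set is 0 by
    convention, which would make the functions \<open>u n\<close> vanish.\<close>
  case True
  then show ?thesis by (simp add: om_empty)
next
  case False
  define u where "u n x = min 1 (real n * infdist x (- U))" for n and x :: 'a
  have ne: "- U \<noteq> {}" using False by auto
  have uc: "cont (u n)" for n unfolding u_def by (intro continuous_intros)
  have u01: "0 \<le> u n x" "u n x \<le> 1" for n x unfolding u_def using infdist_nonneg[of x] by auto
  have u_out: "u n x = 0" if "x \<notin> U" for n x unfolding u_def using that by simp
  have u_mono: "u n x \<le> u (Suc n) x" for n x
    unfolding u_def using infdist_nonneg[of x "- U"] by (intro min.mono mult_right_mono) auto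
  have u_lim: "(\<lambda>n. u n x) \<longlonglongrightarrow> 1" if "x \<in> U" for x
  proof -
    have "infdist x (- U) > 0"
      using U that ne by (metis ComplD closed_Compl in_closed_iff_infdist_zero infdist_nonneg less_eq_real_def)
    then obtain N :: nat where N: "1 < real N * infdist x (- U)"
      using reals_Archimedean3 by blast
    have "\<forall>\<^sub>F n in sequentially. u n x = 1"
      unfolding eventually_sequentially
    proof (intro exI allI impI)
      fix n assume "N \<le> n"
      then have "real N * infdist x (- U) \<le> real n * infdist x (- U)"
        by (intro mult_right_mono infdist_nonneg) auto
      then show "u n x = 1" using N by (simp add: u_def)
    qed
    then show ?thesis by (rule tendsto_eventually)
  qed
  show ?thesis
    unfolding om_def[of A]
  proof (intro INF_greatest, clarify)
    fix F assume F: "cover A F"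
    have Fc: "cont (F i)" and F0: "0 \<le> F i x" for i x using F by (auto simp: cover_def)
    have F1: "1 \<le> (\<Sum>i. ennreal (F i x))" if "x \<in> A" for x using F that by (auto simp: cover_def)
    \<comment> \<open>Each \<open>F i\<close> is cut along the increments of \<open>u\<close>. All
      increments together cover \<open>A \<inter> U\<close>; the first \<open>N\<close> of them add
      up to \<open>F i * u N\<close>, as \<open>u 0 = 0\<close>, and the remainder
      \<open>F i * (1 - u N)\<close> covers \<open>A - U\<close>, since \<open>u N\<close> vanishes
      off \<open>U\<close>. Hence the two covers share the price of \<open>F\<close>.\<close>
    define G where "G n i x = F i x * (u (Suc n) x - u n x)" for n i x
    have Gc: "cont (G n i)" for n i unfolding G_def by (intro continuous_intros Fc uc)
    have G0: "0 \<le> G n i x" for n i x unfolding G_def using F0 u_mono by simp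
    have "om (A \<inter> U) \<le> (\<Sum>n. \<Sum>i. ennreal (L (G n i)))"
    proof (rule cover_prod_decode[OF Gc G0])
      fix x assume x: "x \<in> A \<inter> U"
      have "(\<lambda>n. u (Suc n) x - u n x) sums (1 - u 0 x)"
        using u_lim x by (intro telescope_sums) auto
      then have s: "(\<Sum>n. ennreal (u (Suc n) x - u n x)) = 1"
        using u_mono by (subst suminf_ennreal_eq) (auto simp: u_def)
      have "(\<Sum>n. \<Sum>i. ennreal (G n i x)) = (\<Sum>n. (\<Sum>i. ennreal (F i x)) * ennreal (u (Suc n) x - u n x))"
        unfolding G_def using F0 u_mono by (simp add: ennreal_mult ennreal_suminf_multc)
      also have "\<dots> = (\<Sum>i. ennreal (F i x))"
        by (simp add: ennreal_suminf_cmult s)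
      finally show "1 \<le> (\<Sum>n. \<Sum>i. ennreal (G n i x))" using F1 x by simp
    qed
    then have "om (A \<inter> U) + om (A - U) \<le> (\<Sum>n. \<Sum>i. ennreal (L (G n i))) + om (A - U)"
      by (rule add_right_mono)
    also have "\<dots> \<le> (\<Sum>i. ennreal (L (F i)))"
    proof (rule ennreal_suminf_bound_add)
      fix N
      have Fuc: "cont (\<lambda>x. F i x * u n x)" for i n by (intro continuous_intros Fc uc)
      have Fvc: "cont (\<lambda>x. F i x * (1 - u n x))" for i n by (intro continuous_intros Fc uc)
      have "(\<Sum>n<N. \<Sum>i. ennreal (L (G n i))) = (\<Sum>i. \<Sum>n<N. ennreal (L (G n i)))"
        by (intro suminf_sum[symmetric] summableI)
      also have "\<dots> = (\<Sum>i. ennreal (L (\<lambda>x. F i x * u N x)))"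
      proof (rule suminf_cong)
        fix i
        have "(\<Sum>n<N. ennreal (L (G n i))) = ennreal (\<Sum>n<N. L (G n i))"
          using L_nonneg[OF Gc G0] by (intro sum_ennreal) auto
        also have "(\<Sum>n<N. L (G n i)) = L (\<lambda>x. \<Sum>n<N. G n i x)"
          by (intro L_sum[symmetric] Gc)
        also have "(\<lambda>x. \<Sum>n<N. G n i x) = (\<lambda>x. F i x * u N x)"
          unfolding G_def
          using sum_lessThan_telescope[of "\<lambda>n. u n x" N for x]
          by (simp add: sum_distrib_left[symmetric]) (simp add: u_def)
        finally show "(\<Sum>n<N. ennreal (L (G n i))) = ennreal (L (\<lambda>x. F i x * u N x))" .
      qed
      finally have 1: "(\<Sum>n<N. \<Sum>i. ennreal (L (G n i))) = (\<Sum>i. ennreal (L (\<lambda>x. F i x * u N x)))" .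
      have "om (A - U) \<le> (\<Sum>i. ennreal (L (\<lambda>x. F i x * (1 - u N x))))"
        using F Fvc u01 by (intro om_le) (auto simp: cover_def u_out)
      then have "(\<Sum>n<N. \<Sum>i. ennreal (L (G n i))) + om (A - U)
        \<le> (\<Sum>i. ennreal (L (\<lambda>x. F i x * u N x))) + (\<Sum>i. ennreal (L (\<lambda>x. F i x * (1 - u N x))))"
        unfolding 1 by (rule add_left_mono)
      also have "\<dots> = (\<Sum>i. ennreal (L (\<lambda>x. F i x * u N x)) + ennreal (L (\<lambda>x. F i x * (1 - u N x))))"
        by (intro suminf_add summableI)
      also have "\<dots> = (\<Sum>i. ennreal (L (F i)))"
      proof (rule suminf_cong)
        fix i
        have "L (F i) = L (\<lambda>x. F i x * u N x) + L (\<lambda>x. F i x * (1 - u N x))"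
          using L_add[OF Fuc[of i N] Fvc[of i N]] by (simp add: algebra_simps)
        moreover have "0 \<le> L (\<lambda>x. F i x * u N x)" "0 \<le> L (\<lambda>x. F i x * (1 - u N x))"
          using F0 u01 by (intro L_nonneg Fuc Fvc mult_nonneg_nonneg; simp)+
        ultimately show "ennreal (L (\<lambda>x. F i x * u N x)) + ennreal (L (\<lambda>x. F i x * (1 - u N x))) = ennreal (L (F i))"
          by (simp add: ennreal_plus)
      qed
      finally show "(\<Sum>n<N. \<Sum>i. ennreal (L (G n i))) + om (A - U) \<le> (\<Sum>i. ennreal (L (F i)))" .
    qed
    finally show "om (A \<inter> U) + om (A - U) \<le> (\<Sum>i. ennreal (L (F i)))" .
  qed
qed

section \<open>The representing measure\<close>

definition rmeasure :: "'a measure" where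
  "rmeasure = measure_of UNIV (sets borel) om"

lemma sets_rmeasure: "sets rmeasure = sets borel"
  unfolding rmeasure_def using sets.sigma_sets_eq[of "borel :: 'a measure"] by (subst sets_measure_of) auto

lemma space_rmeasure: "space rmeasure = UNIV"
  unfolding rmeasure_def by (subst space_measure_of) auto

text \<open>Caratheodory on the power set: \<open>om_split_open\<close> puts the open sets into the
  system of measurable sets, which is a sigma-algebra and therefore contains the Borel sets.\<close>

lemma measure_space_om: "measure_space UNIV (sets borel) om"
proof -
  interpret P: sigma_algebra "UNIV :: 'a set" "UNIV :: 'a set set"
    using sigma_algebra_Pow[of "UNIV :: 'a set"] by simp
  define \<Lambda> where "\<Lambda> = lambda_system UNIV (UNIV :: 'a set set) om"
  have "outer_measure_space (UNIV :: 'a set set) om"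
    unfolding outer_measure_space_def
    using om_empty om_mono om_subadditive by (auto simp: positive_def increasing_def countably_subadditive_def)
  then have ms: "measure_space UNIV \<Lambda> om" unfolding \<Lambda>_def by (rule P.caratheodory_lemma)
  then have "sigma_algebra UNIV \<Lambda>" by (simp add: measure_space_def)
  moreover have "{S. open S} \<subseteq> \<Lambda>"
    unfolding \<Lambda>_def P.lambda_system_eq
  proof (clarsimp)
    fix U A :: "'a set" assume "open U"
    have "om A \<le> om (A \<inter> U) + om (A - U)"
      using om_subadditive2[of "A \<inter> U" "A - U"] by (simp add: Un_Diff_Int Int_Diff_Un)
    then show "om (A \<inter> U) + om (A - U) = om A" using om_split_open[OF \<open>open U\<close>] by (intro antisym)
  qed
  ultimately have "sets (borel :: 'a measure) \<subseteq> \<Lambda>"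
    unfolding borel_def by (simp add: sigma_algebra.sigma_sets_subset)
  then show ?thesis
    using ms sets.sigma_algebra_axioms[of "borel :: 'a measure"]
    by (auto simp: measure_space_def countably_additive_def positive_def)
qed

lemma emeasure_rmeasure: "A \<in> sets borel \<Longrightarrow> emeasure rmeasure A = om A"
  unfolding rmeasure_def using measure_space_om
  by (intro emeasure_measure_of_sigma) (auto simp: measure_space_def)

text \<open>The lower bound is where compactness enters, as in Dini's theorem: the partial sums of a
  cover of the whole space exceed \<open>1 - d\<close> on increasing open sets that exhaust the
  space, so one finite partial sum does so everywhere and can be compared with
  \<open>L\<close>.\<close>

lemma om_UNIV: "om UNIV = ennreal (L (\<lambda>x. 1))"
proof (rule antisym)
  show "om UNIV \<le> ennreal (L (\<lambda>x. 1))" by (rule om_le_single) auto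
  have L1: "0 \<le> L (\<lambda>x. 1)" by (rule L_nonneg) auto
  show "ennreal (L (\<lambda>x. 1)) \<le> om UNIV"
    unfolding om_def
  proof (intro INF_greatest, clarify)
    fix F assume F: "cover UNIV F"
    have Fc: "cont (F i)" and F0: "0 \<le> F i x" and F1: "1 \<le> (\<Sum>i. ennreal (F i x))" for i x
      using F by (auto simp: cover_def)
    show "ennreal (L (\<lambda>x. 1)) \<le> (\<Sum>i. ennreal (L (F i)))"
    proof (rule ennreal_le_epsilon)
      fix e :: real assume e: "0 < e"
      \<comment> \<open>Chosen so that the loss \<open>d * L (\<lambda>x. 1)\<close> is at most
        \<open>e\<close>, also when this value of \<open>L\<close> is 0.\<close>
      define d where "d = e / (1 + L (\<lambda>x. 1))"
      have d: "0 < d" using e L1 by (simp add: d_def)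
      define V where "V n = {x. 1 - d < (\<Sum>i<n. F i x)}" for n
      have "open (V n)" for n
        unfolding V_def by (intro open_Collect_less continuous_intros Fc)
      moreover have "\<exists>n. x \<in> V n" for x
      proof (rule ccontr)
        assume "\<not> ?thesis"
        then have "(\<Sum>i<n. F i x) \<le> 1 - d" for n by (simp add: V_def not_less)
        then have "(\<Sum>i<n. ennreal (F i x)) \<le> ennreal (1 - d)" for n
          using F0 by (simp add: sum_ennreal ennreal_leI)
        then have "(\<Sum>i. ennreal (F i x)) \<le> ennreal (1 - d)" by (intro suminf_le_const summableI)
        also have "\<dots> < 1" using d by (simp add: ennreal_less_one_iff)
        finally show False using F1[of x] by simp
      qed
      ultimately obtain T where T: "finite T" "UNIV \<subseteq> (\<Union>n\<in>T. V n)"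
        using compactE_image[OF compact_UNIV, of UNIV V] by (metis UNIV_I UN_iff subsetI)
      define N where "N = Max (insert 0 T)"
      have N: "1 - d \<le> (\<Sum>i<N. F i x)" for x
      proof -
        obtain n where n: "n \<in> T" "x \<in> V n" using T by auto
        then have "n \<le> N" using T unfolding N_def by (intro Max_ge) auto
        then have "(\<Sum>i<n. F i x) \<le> (\<Sum>i<N. F i x)" using F0 by (intro sum_mono2) auto
        then show ?thesis using n by (simp add: V_def)
      qed
      have "L (\<lambda>x. (1 - d) * 1) \<le> L (\<lambda>x. \<Sum>i<N. F i x)"
        using N by (intro L_mono continuous_intros Fc) auto
      then have "(1 - d) * L (\<lambda>x. 1) \<le> (\<Sum>i<N. L (F i))"
        by (subst (asm) L_cmult, simp, subst (asm) L_sum) (auto intro: Fc)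
      moreover have "d * L (\<lambda>x. 1) \<le> e" using e L1 by (simp add: d_def field_simps)
      ultimately have "L (\<lambda>x. 1) \<le> (\<Sum>i<N. L (F i)) + e" by (simp add: algebra_simps)
      then have "ennreal (L (\<lambda>x. 1)) \<le> ennreal ((\<Sum>i<N. L (F i)) + e)" by (rule ennreal_leI)
      also have "\<dots> = (\<Sum>i<N. ennreal (L (F i))) + ennreal e"
        using L_nonneg[OF Fc F0] e by (simp add: sum_ennreal sum_nonneg ennreal_plus)
      also have "(\<Sum>i<N. ennreal (L (F i))) \<le> (\<Sum>i. ennreal (L (F i)))"
        by (intro sum_le_suminf summableI) auto
      finally show "ennreal (L (\<lambda>x. 1)) \<le> (\<Sum>i. ennreal (L (F i))) + ennreal e"
        by (simp add: add_right_mono)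
    qed
  qed
qed

lemma finite_measure_rmeasure: "finite_measure rmeasure"
  by (rule finite_measureI) (simp add: space_rmeasure emeasure_rmeasure om_UNIV)

lemma measure_rmeasure_UNIV: "measure rmeasure UNIV = L (\<lambda>x. 1)"
  using L_nonneg[of "\<lambda>x. 1"] by (simp add: measure_def emeasure_rmeasure om_UNIV)

lemma cont_measurable: "cont f \<Longrightarrow> f \<in> borel_measurable rmeasure"
  using borel_measurable_continuous_onI[of f] by (simp add: measurable_cong_sets[OF sets_rmeasure refl])

text \<open>The function \<open>n f\<close> is the sum of the slices \<open>h j\<close>. A slice is
  1 on the level set \<open>E j\<close>, which bounds the measure of \<open>E j\<close> by
  \<open>L (h j)\<close>, and \<open>n f\<close> exceeds the number of level sets containing a point
  by at most one. The error \<open>L (\<lambda>x. 1) / n\<close> is then made small.\<close>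

lemma integral_le_L:
  assumes f: "cont f" "\<And>x. 0 \<le> f x" "\<And>x. f x \<le> 1"
  shows "(\<integral>x. f x \<partial>rmeasure) \<le> L f"
proof (rule field_le_epsilon)
  interpret finite_measure rmeasure by (rule finite_measure_rmeasure)
  fix e :: real assume "0 < e"
  obtain n :: nat where n0: "L (\<lambda>x. 1) / e < real n" using reals_Archimedean2 by blast
  have L1: "0 \<le> L (\<lambda>x. 1)" by (rule L_nonneg) auto
  have n: "0 < n" "L (\<lambda>x. 1) / real n \<le> e"
  proof -
    have "0 \<le> L (\<lambda>x. 1) / e" using L1 \<open>0 < e\<close> by simp
    then show "0 < n" using n0 by (cases n) auto
    then show "L (\<lambda>x. 1) / real n \<le> e" using n0 \<open>0 < e\<close> by (simp add: field_simps)
  qed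
  define h where "h j x = min (max (real n * f x - real j) 0) 1" for j :: nat and x
  define E where "E j = {x. real j + 1 \<le> real n * f x}" for j :: nat
  have hc: "cont (h j)" for j unfolding h_def by (intro continuous_intros f)
  have telescoped: "(\<Sum>j<m. min (max (y - real j) 0) 1) = min (max y 0) (real m)" for y :: real and m
    by (induction m) auto
  have nf: "min (max (real n * f x) 0) (real n) = real n * f x" for x
  proof -
    have "0 \<le> real n * f x" "real n * f x \<le> real n" using f(2,3)[of x] by (auto intro: mult_left_le)
    then show ?thesis by simp
  qed
  have hsum: "(\<Sum>j<n. h j x) = real n * f x" for x
    unfolding h_def telescoped by (rule nf)
  have E: "E j \<in> sets rmeasure" for j
  proof -
    have "closed (E j)" unfolding E_def by (intro closed_Collect_le continuous_intros f)
    then show ?thesis by (simp add: sets_rmeasure)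
  qed
  have Ei: "integrable rmeasure (indicat_real (E j))" for j
    using E by (intro integrable_real_indicator) (simp_all add: emeasure_eq_measure)
  have fint: "integrable rmeasure f"
    using f by (intro integrable_const_bound[of _ 1] cont_measurable) auto
  have "real n * (\<integral>x. f x \<partial>rmeasure) = (\<integral>x. real n * f x \<partial>rmeasure)" by simp
  also have "\<dots> \<le> (\<integral>x. 1 + (\<Sum>j<n. indicator (E j) x) \<partial>rmeasure)"
  proof (rule integral_mono)
    show "integrable rmeasure (\<lambda>x. 1 + (\<Sum>j<n. indicator (E j) x :: real))"
      by (intro Bochner_Integration.integrable_add Bochner_Integration.integrable_sum Ei) simp
    fix x
    show "real n * f x \<le> 1 + (\<Sum>j<n. indicator (E j) x)"
      using count_levels(1)[of "real n * f x" n] nf[of x] by (simp add: E_def indicator_def of_bool_def)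
  qed (use fint in simp)
  also have "\<dots> = L (\<lambda>x. 1) + (\<Sum>j<n. measure rmeasure (E j))"
    using E Ei by (subst Bochner_Integration.integral_add)
      (auto simp: space_rmeasure measure_rmeasure_UNIV intro!: Bochner_Integration.integrable_sum)
  also have "(\<Sum>j<n. measure rmeasure (E j)) \<le> (\<Sum>j<n. L (h j))"
  proof (rule sum_mono)
    fix j
    have "om (E j) \<le> ennreal (L (h j))" by (intro om_le_single hc) (auto simp: h_def E_def)
    then have "emeasure rmeasure (E j) \<le> ennreal (L (h j))"
      using E by (simp add: emeasure_rmeasure sets_rmeasure)
    moreover have "0 \<le> L (h j)" by (intro L_nonneg hc) (auto simp: h_def)
    ultimately show "measure rmeasure (E j) \<le> L (h j)"
      by (simp add: emeasure_eq_measure)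
  qed
  also have "(\<Sum>j<n. L (h j)) = real n * L f"
    using L_sum[of "{..<n}" h] hc L_cmult[OF f(1), of "real n"] by (simp add: hsum)
  finally have "(\<integral>x. f x \<partial>rmeasure) \<le> L f + L (\<lambda>x. 1) / real n" using n(1) by (simp add: field_simps)
  then show "(\<integral>x. f x \<partial>rmeasure) \<le> L f + e" using n(2) by simp
qed

text \<open>Since the total mass is exactly \<open>L (\<lambda>x. 1)\<close>, the one-sided estimate
  for \<open>1 - g\<close> is the reverse estimate for \<open>g\<close>. An arbitrary continuous
  function is an affine image of one with values in the unit interval.\<close>

lemma integral_rmeasure:
  assumes f: "cont f" shows "(\<integral>x. f x \<partial>rmeasure) = L f"
proof -
  interpret finite_measure rmeasure by (rule finite_measure_rmeasure)
  have *: "(\<integral>x. g x \<partial>rmeasure) = L g" if g: "cont g" "\<And>x. 0 \<le> g x" "\<And>x. g x \<le> 1" for g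
  proof (rule antisym)
    show "(\<integral>x. g x \<partial>rmeasure) \<le> L g" by (rule integral_le_L[OF g])
    have "integrable rmeasure g"
      using g by (intro integrable_const_bound[of _ 1] cont_measurable) auto
    then have "(\<integral>x. 1 - g x \<partial>rmeasure) = L (\<lambda>x. 1) - (\<integral>x. g x \<partial>rmeasure)"
      by (subst Bochner_Integration.integral_diff) (auto simp: space_rmeasure measure_rmeasure_UNIV)
    moreover have "(\<integral>x. 1 - g x \<partial>rmeasure) \<le> L (\<lambda>x. 1 - g x)"
      using g by (intro integral_le_L continuous_intros) auto
    moreover have "L (\<lambda>x. 1 - g x) = L (\<lambda>x. 1) - L g" using g by (intro L_diff) auto
    ultimately show "L g \<le> (\<integral>x. g x \<partial>rmeasure)" by simp
  qed
  have "bounded (range f)" using compact_continuous_image[OF f compact_UNIV] by (rule compact_imp_bounded)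
  then obtain K where K: "\<And>x. \<bar>f x\<bar> \<le> K" by (auto simp: bounded_iff)
  define C where "C = \<bar>K\<bar> + 1"
  have C: "0 < C" "- C \<le> f x" "f x \<le> C" for x using K[of x] by (auto simp: C_def)
  define g where "g x = (f x + C) / (2 * C)" for x
  have g: "cont g" "\<And>x. 0 \<le> g x" "\<And>x. g x \<le> 1"
    unfolding g_def using C by (auto intro!: continuous_intros f simp: field_simps) (smt (verit) C(2))
  have f_eq: "f = (\<lambda>x. 2 * C * g x - C * 1)" using C(1) by (auto simp: g_def)
  have gint: "integrable rmeasure g"
    using g by (intro integrable_const_bound[of _ 1] cont_measurable) auto
  have "(\<integral>x. f x \<partial>rmeasure) = 2 * C * (\<integral>x. g x \<partial>rmeasure) - C * L (\<lambda>x. 1)"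
    unfolding f_eq using gint
    by (subst Bochner_Integration.integral_diff) (auto simp: space_rmeasure measure_rmeasure_UNIV)
  also have "\<dots> = L f"
  proof -
    have "cont (\<lambda>x. 2 * C * g x)" "cont (\<lambda>x. C * 1)" using g by (auto intro!: continuous_intros)
    then have "L f = L (\<lambda>x. 2 * C * g x) - L (\<lambda>x. C * 1)" unfolding f_eq by (rule L_diff)
    then show ?thesis using *[OF g] L_cmult[OF g(1), of "2 * C"] L_cmult[of "\<lambda>x. 1" C] by simp
  qed
  finally show ?thesis .
qed

end

theorem riesz_representation:
  fixes L :: "('a::metric_space \<Rightarrow> real) \<Rightarrow> real"
  assumes "compact (UNIV :: 'a set)" "pos_functional L"
  shows "\<exists>M. finite_measure M \<and> sets M = sets borel \<and>
    (\<forall>f. continuous_on UNIV f \<longrightarrow> (\<integral>x. f x \<partial>M) = L f)"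
proof -
  interpret pos_functional_on L by standard (use assms in auto)
  show ?thesis using finite_measure_rmeasure sets_rmeasure integral_rmeasure by blast
qed

section \<open>Finite Borel measures on metric spaces\<close>

lemma borel_measurableI_continuous:
  assumes "sets M = sets borel" "continuous_on UNIV f"
  shows "f \<in> borel_measurable M"
  using borel_measurable_continuous_onI[OF assms(2)] by (simp add: measurable_cong_sets[OF assms(1) refl])

lemma space_eq_UNIV: "sets M = sets (borel :: 'a::topological_space measure) \<Longrightarrow> space M = UNIV"
  using sets_eq_imp_space_eq[of M borel] by simp

lemma (in finite_measure) bounded_integrable:
  assumes "f \<in> borel_measurable M" "\<And>x. \<bar>f x\<bar> \<le> C" shows "integrable M (f :: 'a \<Rightarrow> real)"
  using assms by (intro integrable_const_bound[of _ C]) auto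

lemma (in finite_measure) bounded_convergence:
  assumes "\<And>i. s i \<in> borel_measurable M" "f \<in> borel_measurable M" "\<And>i x. \<bar>s i x\<bar> \<le> (C::real)"
    "\<And>x. (\<lambda>i. s i x) \<longlonglongrightarrow> (f x :: real)"
  shows "(\<lambda>i. \<integral>x. s i x \<partial>M) \<longlonglongrightarrow> (\<integral>x. f x \<partial>M)"
  using assms by (intro integral_dominated_convergence[where w = "\<lambda>x. C"]) auto

lemma compact_continuous_bounded:
  fixes f :: "'a::metric_space \<Rightarrow> real"
  assumes "compact (UNIV :: 'a set)" "continuous_on UNIV f"
  obtains C where "\<And>x. \<bar>f x\<bar> \<le> C"
proof -
  have "bounded (range f)" using compact_continuous_image[OF assms(2,1)] by (rule compact_imp_bounded)
  then show thesis using that by (auto simp: bounded_iff)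
qed

lemma urysohn_metric:
  fixes S T :: "'a::metric_space set"
  assumes S: "closed S" and T: "closed T" and disj: "S \<inter> T = {}"
  obtains f :: "'a \<Rightarrow> real" where "continuous_on UNIV f" "\<And>x. 0 \<le> f x" "\<And>x. f x \<le> 1"
    "\<And>x. x \<in> S \<Longrightarrow> f x = 1" "\<And>x. x \<in> T \<Longrightarrow> f x = 0"
proof (cases "S = {} \<or> T = {}")
  case True
  then show thesis
  proof
    assume "S = {}" then show thesis by (intro that[of "\<lambda>x. 0"]) auto
  next
    assume "T = {}" then show thesis by (intro that[of "\<lambda>x. 1"]) auto
  qed
next
  case False
  have pos: "0 < infdist x T + infdist x S" for x
  proof -
    have "x \<notin> S \<or> x \<notin> T" using disj by auto
    then show ?thesis
      using infdist_pos_not_in_closed[OF S] infdist_pos_not_in_closed[OF T] False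
        infdist_nonneg[of x S] infdist_nonneg[of x T] by (meson add_nonneg_pos add_pos_nonneg)
  qed
  show thesis
  proof (rule that[of "\<lambda>x. infdist x T / (infdist x T + infdist x S)"])
    show "continuous_on UNIV (\<lambda>x. infdist x T / (infdist x T + infdist x S))"
      using pos by (intro continuous_intros) (auto simp: less_imp_neq[symmetric])
    fix x
    show "0 \<le> infdist x T / (infdist x T + infdist x S)" "infdist x T / (infdist x T + infdist x S) \<le> 1"
      using infdist_nonneg[of x T] infdist_nonneg[of x S] by (auto simp: divide_le_eq_1)
    show "infdist x T / (infdist x T + infdist x S) = 1" if "x \<in> S" using that pos[of x] by simp
    show "infdist x T / (infdist x T + infdist x S) = 0" if "x \<in> T" using that by simp
  qed
qed

lemma open_Union_closed:
  fixes A :: "'a::metric_space set"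
  assumes A: "open A"
  obtains F where "\<And>n::nat. closed (F n)" "incseq F" "(\<Union>n. F n) = A"
proof (cases "A = UNIV")
  case True
  then show thesis by (intro that[of "\<lambda>n. UNIV"]) (auto simp: incseq_def)
next
  case False
  define F where "F n = {x. 1 \<le> real n * infdist x (- A)}" for n
  show thesis
  proof (rule that[of F])
    show "closed (F n)" for n unfolding F_def by (intro closed_Collect_le continuous_intros)
    show "incseq F"
      unfolding incseq_def F_def by (auto elim!: order_trans intro!: mult_right_mono infdist_nonneg)
    show "(\<Union>n. F n) = A"
    proof (rule set_eqI, rule iffI)
      fix x assume "x \<in> A"
      then have "0 < infdist x (- A)" using A False by (intro infdist_pos_not_in_closed) auto
      then obtain n :: nat where "1 < real n * infdist x (- A)" using reals_Archimedean3 by blast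
      then show "x \<in> (\<Union>n. F n)" by (auto simp: F_def intro: less_imp_le)
    next
      fix x assume "x \<in> (\<Union>n. F n)"
      then show "x \<in> A" by (cases "x \<in> A") (auto simp: F_def)
    qed
  qed
qed

lemma sets_borel_sigma_open: "sets (borel :: 'a::topological_space measure) = sigma_sets UNIV (Collect open)"
  unfolding borel_def by (subst sets_measure_of) auto

theorem borel_regular:
  fixes M :: "'a::metric_space measure"
  assumes fin: "finite_measure M" and sets: "sets M = sets borel" and A: "A \<in> sets borel" and e: "0 < e"
  obtains F U where "closed F" "open U" "F \<subseteq> A" "A \<subseteq> U" "measure M (U - F) < e"
proof -
  interpret finite_measure M by fact
  have op: "open U \<Longrightarrow> U \<in> sets M" for U by (simp add: sets)
  have cl: "closed U \<Longrightarrow> U \<in> sets M" for U by (simp add: sets)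
  define P where "P A \<longleftrightarrow> (\<forall>e>0. \<exists>F U. closed F \<and> open U \<and> F \<subseteq> A \<and> A \<subseteq> U \<and> measure M (U - F) < e)" for A
  have "Int_stable (Collect (open :: 'a set \<Rightarrow> bool))" by (auto simp: Int_stable_def)
  moreover have "Collect (open :: 'a set \<Rightarrow> bool) \<subseteq> Pow UNIV" by simp
  moreover have "A \<in> sigma_sets UNIV (Collect open)" using A by (simp add: sets_borel_sigma_open)
  ultimately have "P A"
  proof (induction A rule: sigma_sets_induct_disjoint)
    show "P {}" unfolding P_def by (auto intro!: exI[of _ "{}"])
  next
    fix A :: "'a set" assume "A \<in> Collect open"
    then have A: "open A" by simp
    obtain F where F: "\<And>n::nat. closed (F n)" "incseq F" "(\<Union>n. F n) = A" by (rule open_Union_closed[OF A]) blast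
    show "P A"
      unfolding P_def
    proof (intro allI impI)
      fix e :: real assume "0 < e"
      have "(\<lambda>n. measure M (F n)) \<longlonglongrightarrow> measure M A"
        using finite_Lim_measure_incseq[of F] F cl by auto
      then have "\<forall>\<^sub>F n in sequentially. measure M A - e < measure M (F n)"
        using \<open>0 < e\<close> by (intro order_tendstoD) auto
      then obtain n where n: "measure M A - e < measure M (F n)"
        by (auto simp: eventually_sequentially)
      have "F n \<subseteq> A" using F by auto
      then have "measure M (A - F n) < e" using n finite_measure_Diff[OF op[OF A] cl[OF F(1)]] by simp
      then show "\<exists>F U. closed F \<and> open U \<and> F \<subseteq> A \<and> A \<subseteq> U \<and> measure M (U - F) < e"
        using F(1) A \<open>F n \<subseteq> A\<close> by (intro exI[of _ "F n"] exI[of _ A]) simp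
    qed
  next
    fix A assume PA: "P A"
    show "P (UNIV - A)"
      unfolding P_def
    proof (intro allI impI)
      fix e :: real assume "0 < e"
      obtain F U where FU: "closed F" "open U" "F \<subseteq> A" "A \<subseteq> U" "measure M (U - F) < e"
        using PA[unfolded P_def, rule_format, OF \<open>0 < e\<close>] by auto
      have "- F - - U = U - F" by auto
      then show "\<exists>F U. closed F \<and> open U \<and> F \<subseteq> UNIV - A \<and> UNIV - A \<subseteq> U \<and> measure M (U - F) < e"
        using FU by (intro exI[of _ "- U"] exI[of _ "- F"]) auto
    qed
  next
    fix A :: "nat \<Rightarrow> 'a set" assume PA: "\<And>i. P (A i)"
    show "P (\<Union>i. A i)"
      unfolding P_def
    proof (intro allI impI)
      fix e :: real assume e: "0 < e"
      have "\<exists>F U. closed F \<and> open U \<and> F \<subseteq> A i \<and> A i \<subseteq> U \<and> measure M (U - F) < e / 2 * (1/2) ^ Suc i" for i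
        using PA[of i, unfolded P_def, rule_format, of "e / 2 * (1/2) ^ Suc i"] e by simp
      then obtain F U where FU: "\<And>i. closed (F i)" "\<And>i. open (U i)" "\<And>i. F i \<subseteq> A i" "\<And>i. A i \<subseteq> U i"
        "\<And>i. measure M (U i - F i) < e / 2 * (1/2) ^ Suc i" by metis
      define V where "V = (\<Union>i. U i)"
      have V: "open V" unfolding V_def using FU by auto
      have s: "(\<lambda>i. e / 2 * (1/2) ^ Suc i) sums (e / 2)"
        using sums_mult[OF power_half_series, of "e / 2"] by simp
      have ms: "U i - F i \<in> sets M" "V - (\<Union>i\<in>I. F i) \<in> sets M" for i I
        using op[OF FU(2)] cl[OF FU(1)] op[OF V] by auto
      have leh: "measure M (U i - F i) \<le> e / 2 * (1/2) ^ Suc i" for i using FU(5)[of i] by simp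
      have sm: "summable (\<lambda>i. measure M (U i - F i))"
        by (rule summable_comparison_test'[OF sums_summable[OF s], of 0]) (use leh in simp)
      have "measure M (V - (\<Union>i. F i)) \<le> measure M (\<Union>i. U i - F i)"
        by (rule finite_measure_mono) (use ms(1) in \<open>auto simp: V_def\<close>)
      also have "\<dots> \<le> (\<Sum>i. measure M (U i - F i))"
        by (rule finite_measure_subadditive_countably[OF _ sm]) (use ms(1) in auto)
      also have "\<dots> \<le> e / 2"
        using suminf_le[OF leh sm sums_summable[OF s]] sums_unique[OF s] by simp
      finally have le: "measure M (V - (\<Union>i. F i)) \<le> e / 2" .
      \<comment> \<open>The infinite union of the closed sets need not be closed. Continuity from
        above lets a finite union replace it, and the factor one half in the series bound leaves
        room for this.\<close>
      define D where "D n = V - (\<Union>i<n. F i)" for n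
      have "(\<lambda>n. measure M (D n)) \<longlonglongrightarrow> measure M (\<Inter>n. D n)"
      proof (rule finite_Lim_measure_decseq)
        show "range D \<subseteq> sets M" unfolding D_def using ms(2) by auto
        show "decseq D" unfolding D_def decseq_def by force
      qed
      moreover have "(\<Inter>n. D n) = V - (\<Union>i. F i)" unfolding D_def by auto
      ultimately have "\<forall>\<^sub>F n in sequentially. measure M (D n) < e"
        using le e by (intro order_tendstoD(2)[where y = "measure M (V - (\<Union>i. F i))"]) auto
      then obtain n where n: "measure M (D n) < e" by (auto simp: eventually_sequentially)
      show "\<exists>F U. closed F \<and> open U \<and> F \<subseteq> (\<Union>i. A i) \<and> (\<Union>i. A i) \<subseteq> U \<and> measure M (U - F) < e"
      proof (intro exI conjI)
        show "closed (\<Union>i<n. F i)" using FU(1) by (intro closed_UN) auto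
        show "open V" by (rule V)
        show "(\<Union>i<n. F i) \<subseteq> (\<Union>i. A i)" "(\<Union>i. A i) \<subseteq> V" unfolding V_def using FU(3,4) by blast+
        show "measure M (V - (\<Union>i<n. F i)) < e" using n by (simp add: D_def)
      qed
    qed
  qed
  from this[unfolded P_def, rule_format, OF e] show thesis by (auto intro: that)
qed

text \<open>A Urysohn function between the closed inner and the open outer approximation differs
  from the indicator only on \<open>U - F\<close>. This makes invariant Borel sets accessible to a
  mean along an orbit, which is tied to the measure through continuous functions only.\<close>

lemma indicator_L1_approx:
  fixes M :: "'a::metric_space measure"
  assumes fin: "finite_measure M" and sets: "sets M = sets borel" and A: "A \<in> sets borel" and e: "0 < e"
  obtains h :: "'a \<Rightarrow> real" where "continuous_on UNIV h" "\<And>x. 0 \<le> h x" "\<And>x. h x \<le> 1"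
    "(\<integral>x. \<bar>indicator A x - h x\<bar> \<partial>M) < e"
proof -
  interpret finite_measure M by fact
  obtain F U where FU: "closed F" "open U" "F \<subseteq> A" "A \<subseteq> U" "measure M (U - F) < e"
    by (rule borel_regular[OF assms])
  obtain h :: "'a \<Rightarrow> real" where h: "continuous_on UNIV h" "\<And>x. 0 \<le> h x" "\<And>x. h x \<le> 1"
    "\<And>x. x \<in> F \<Longrightarrow> h x = 1" "\<And>x. x \<in> - U \<Longrightarrow> h x = 0"
    using urysohn_metric[of F "- U"] FU by (metis closed_Compl disjoint_eq_subset_Compl double_compl order_trans)
  have [measurable]: "h \<in> borel_measurable M" "A \<in> sets M" "U - F \<in> sets M"
    using borel_measurableI_continuous[OF sets h(1)] A FU(1,2) by (auto simp: sets)
  have le: "\<bar>indicator A x - h x\<bar> \<le> indicator (U - F) x" for x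
    using FU(3,4) h(2-5)[of x] by (cases "x \<in> A"; cases "x \<in> F"; cases "x \<in> U") (auto simp: indicator_def abs_if)
  have "(\<integral>x. \<bar>indicator A x - h x\<bar> \<partial>M) \<le> (\<integral>x. indicator (U - F) x \<partial>M)"
  proof (rule integral_mono)
    show "integrable M (\<lambda>x. \<bar>indicator A x - h x\<bar>)"
    proof (rule bounded_integrable[of _ 1])
      fix x
      have "indicator (U - F) x \<le> (1 :: real)" by (simp add: indicator_def)
      then show "\<bar>\<bar>indicator A x - h x\<bar>\<bar> \<le> 1" using le[of x] by linarith
    qed measurable
  qed (use le in \<open>auto simp: emeasure_eq_measure\<close>)
  also have "\<dots> = measure M (U - F)" by (simp add: space_eq_UNIV[OF sets])
  finally show thesis using FU(5) h that by simp
qed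

lemma finite_borel_measure_eqI:
  fixes M N :: "'a::metric_space measure"
  assumes M: "finite_measure M" "sets M = sets borel" and N: "finite_measure N" "sets N = sets borel"
    and eq: "\<And>f :: 'a \<Rightarrow> real. continuous_on UNIV f \<Longrightarrow> (\<And>x. 0 \<le> f x) \<Longrightarrow> (\<And>x. f x \<le> 1) \<Longrightarrow>
      (\<integral>x. f x \<partial>M) = (\<integral>x. f x \<partial>N)"
  shows "M = N"
proof (rule measure_eqI_generator_eq[where E = "Collect open" and \<Omega> = UNIV and A = "\<lambda>i. UNIV"])
  interpret M: finite_measure M by fact
  interpret N: finite_measure N by fact
  show "Int_stable (Collect (open :: 'a set \<Rightarrow> bool))" by (auto simp: Int_stable_def)
  show "sets M = sigma_sets UNIV (Collect open)" "sets N = sigma_sets UNIV (Collect open)"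
    using M N by (simp_all add: sets_borel_sigma_open)
  fix U :: "'a set" assume "U \<in> Collect open"
  then have U: "open U" by simp
  obtain F where F: "\<And>n::nat. closed (F n)" "incseq F" "(\<Union>n. F n) = U" by (rule open_Union_closed[OF U]) blast
  have "\<exists>f :: 'a \<Rightarrow> real. continuous_on UNIV f \<and> (\<forall>x. 0 \<le> f x \<and> f x \<le> 1) \<and> (\<forall>x\<in>F n. f x = 1) \<and> (\<forall>x\<in>- U. f x = 0)" for n
    using urysohn_metric[of "F n" "- U"] F U by (metis ComplD Int_emptyI UN_I UNIV_I closed_Compl)
  then obtain f :: "nat \<Rightarrow> 'a \<Rightarrow> real" where f: "\<And>n. continuous_on UNIV (f n)" "\<And>n x. 0 \<le> f n x" "\<And>n x. f n x \<le> 1"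
    "\<And>n x. x \<in> F n \<Longrightarrow> f n x = 1" "\<And>n x. x \<in> - U \<Longrightarrow> f n x = 0" by metis
  have lim: "(\<lambda>n. f n x) \<longlonglongrightarrow> indicator U x" for x
  proof (cases "x \<in> U")
    case True
    then obtain m where "x \<in> F m" using F by auto
    then have "\<forall>\<^sub>F n in sequentially. f n x = indicator U x"
      using F(2) f(4) True unfolding eventually_sequentially incseq_def by (intro exI[of _ m]) (auto simp: subset_iff)
    then show ?thesis by (rule tendsto_eventually)
  qed (use f(5) in auto)
  have "(\<lambda>n. \<integral>x. f n x \<partial>K) \<longlonglongrightarrow> measure K U" if K: "finite_measure K" "sets K = sets borel" for K
  proof -
    interpret K: finite_measure K by fact
    have "(\<lambda>n. \<integral>x. f n x \<partial>K) \<longlonglongrightarrow> (\<integral>x. indicator U x \<partial>K)"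
    proof (rule K.bounded_convergence[where C = 1])
      show "f n \<in> borel_measurable K" for n by (rule borel_measurableI_continuous[OF K(2) f(1)])
      show "indicator U \<in> borel_measurable K" using borel_open[OF U] K(2) by (intro borel_measurable_indicator) simp
    qed (use f lim in auto)
    then show ?thesis by (simp add: space_eq_UNIV[OF K(2)])
  qed
  from this[OF M] this[OF N] have "measure M U = measure N U"
    using eq f by (simp add: LIMSEQ_unique)
  then show "emeasure M U = emeasure N U" by (simp add: M.emeasure_eq_measure N.emeasure_eq_measure)
qed (use M in \<open>auto simp: finite_measure.emeasure_finite\<close>)

section \<open>Functionals on continuous functions\<close>

lemma apply_Bcontfun_compact:
  fixes f :: "'a::metric_space \<Rightarrow> real"
  assumes "compact (UNIV :: 'a set)" "continuous_on UNIV f"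
  shows "apply_bcontfun (Bcontfun f) = f"
proof -
  have "bounded (range f)" using compact_continuous_image[OF assms(2,1)] by (rule compact_imp_bounded)
  then show ?thesis using assms(2) by (intro Bcontfun_inverse) (auto simp: bcontfun_def)
qed

lemma abs_apply_le_norm: "\<bar>apply_bcontfun x t\<bar> \<le> norm x" for x :: "'a::topological_space \<Rightarrow>\<^sub>C real"
  using norm_bounded[of x t] by simp

lemma pos_functionalI:
  fixes l :: "('a::metric_space \<Rightarrow>\<^sub>C real) \<Rightarrow> real"
  assumes c: "compact (UNIV :: 'a set)" and l: "linear l" and pos: "\<And>x. (\<And>t. 0 \<le> apply_bcontfun x t) \<Longrightarrow> 0 \<le> l x"
  shows "pos_functional (\<lambda>f. l (Bcontfun f))"
  unfolding pos_functional_def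
proof (intro conjI allI impI)
  fix f g :: "'a \<Rightarrow> real" assume fg: "continuous_on UNIV f" "continuous_on UNIV g"
  then have "Bcontfun (\<lambda>x. f x + g x) = Bcontfun f + Bcontfun g"
    by (intro bcontfun_eqI) (simp add: apply_Bcontfun_compact[OF c] continuous_intros)
  then show "l (Bcontfun (\<lambda>x. f x + g x)) = l (Bcontfun f) + l (Bcontfun g)" by (simp add: linear_add[OF l])
next
  fix a and f :: "'a \<Rightarrow> real" assume f: "continuous_on UNIV f"
  then have "Bcontfun (\<lambda>x. a * f x) = a *\<^sub>R Bcontfun f"
    by (intro bcontfun_eqI) (simp add: apply_Bcontfun_compact[OF c] continuous_intros)
  then show "l (Bcontfun (\<lambda>x. a * f x)) = a * l (Bcontfun f)" by (simp add: linear_scale[OF l])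
next
  fix f :: "'a \<Rightarrow> real" assume "continuous_on UNIV f" "\<forall>x. 0 \<le> f x"
  then show "0 \<le> l (Bcontfun f)" by (intro pos) (simp add: apply_Bcontfun_compact[OF c])
qed

text \<open>A positive functional \<open>l\<close> with \<open>\<mu> \<le> l\<close> on nonnegative functions is obtained from
  the Mazur-Orlicz theorem, so that \<open>\<mu> = l - (l - \<mu>)\<close>.\<close>

theorem dualC_signed_measure:
  fixes \<mu> :: "'a::metric_space dualC"
  assumes c: "compact (UNIV :: 'a set)"
  obtains M N where "finite_measure M" "sets M = sets borel" "finite_measure N" "sets N = sets borel"
    "\<And>x. blinfun_apply \<mu> x = (\<integral>t. apply_bcontfun x t \<partial>M) - (\<integral>t. apply_bcontfun x t \<partial>N)"
proof -
  define q where "q v = norm \<mu> * norm v" for v :: "'a \<Rightarrow>\<^sub>C real"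
  have q: "sublinear q"
    unfolding sublinear_def q_def by (auto simp: distrib_left[symmetric] intro!: mult_left_mono norm_triangle_ineq)
  \<comment> \<open>One cone holds two families of constraints: \<open>g = 0\<close> yields that
    \<open>l\<close> dominates \<open>\<mu>\<close> on nonnegative functions, \<open>f = 0\<close>
    that \<open>l\<close> is positive. They are consistent with the norm bound because adding a
    nonnegative \<open>g\<close> to \<open>f\<close> cannot decrease the norm.\<close>
  define S where "S = {(f + g, blinfun_apply \<mu> f) |f g. (\<forall>t. 0 \<le> apply_bcontfun f t) \<and> (\<forall>t. 0 \<le> apply_bcontfun g t)}"
  have S0: "(0, 0) \<in> S"
    unfolding S_def by (auto intro!: exI[of _ 0])
  have S_add: "(s + s', t + t') \<in> S" if st: "(s, t) \<in> S" and st': "(s', t') \<in> S" for s t s' t'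
  proof -
    obtain f g where 1: "s = f + g" "t = \<mu> f" "\<forall>t. 0 \<le> apply_bcontfun f t" "\<forall>t. 0 \<le> apply_bcontfun g t"
      using st unfolding S_def by blast
    obtain f' g' where 2: "s' = f' + g'" "t' = \<mu> f'"
      "\<forall>t. 0 \<le> apply_bcontfun f' t" "\<forall>t. 0 \<le> apply_bcontfun g' t"
      using st' unfolding S_def by blast
    show ?thesis unfolding S_def
      by (rule CollectI, rule exI[of _ "f + f'"], rule exI[of _ "g + g'"]) (use 1 2 in \<open>simp add: blinfun.add_right\<close>)
  qed
  have S_scale: "(a *\<^sub>R s, a * t) \<in> S" if "0 < a" and st: "(s, t) \<in> S" for a s t
  proof -
    obtain f g where *: "s = f + g" "t = \<mu> f" "\<forall>t. 0 \<le> apply_bcontfun f t" "\<forall>t. 0 \<le> apply_bcontfun g t"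
      using st unfolding S_def by blast
    show ?thesis unfolding S_def
      by (rule CollectI, rule exI[of _ "a *\<^sub>R f"], rule exI[of _ "a *\<^sub>R g"])
        (use * \<open>0 < a\<close> in \<open>simp add: blinfun.scaleR_right scaleR_add_right\<close>)
  qed
  have S_le: "t \<le> q s" if st: "(s, t) \<in> S" for s t
  proof -
    obtain f g where *: "s = f + g" "t = \<mu> f" "\<forall>t. 0 \<le> apply_bcontfun f t" "\<forall>t. 0 \<le> apply_bcontfun g t"
      using st unfolding S_def by blast
    have "norm f \<le> norm s"
    proof (rule norm_bound)
      fix x
      have "\<bar>apply_bcontfun f x\<bar> \<le> \<bar>apply_bcontfun s x\<bar>" using * by simp
      also have "\<dots> \<le> norm s" by (rule abs_apply_le_norm)
      finally show "norm (apply_bcontfun f x) \<le> norm s" by simp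
    qed
    then have "norm (\<mu> f) \<le> norm \<mu> * norm s"
      using norm_blinfun[of \<mu> f] by (meson mult_left_mono norm_ge_zero order_trans)
    then show ?thesis using * by (simp add: q_def)
  qed
  show thesis
  proof (rule extreme_mazur_orlicz[OF q S0 S_add S_scale S_le])
    fix l assume l: "linear l" "l \<le> q" "\<And>s t. (s, t) \<in> S \<Longrightarrow> t \<le> l s"
    have ge: "\<mu> x \<le> l x" if "\<And>t. 0 \<le> apply_bcontfun x t" for x
    proof (rule l(3))
      show "(x, \<mu> x) \<in> S" unfolding S_def
        by (rule CollectI, rule exI[of _ x], rule exI[of _ 0]) (use that in simp)
    qed
    have pos: "0 \<le> l x" if "\<And>t. 0 \<le> apply_bcontfun x t" for x
    proof (rule l(3))
      show "(x, 0) \<in> S" unfolding S_def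
        by (rule CollectI, rule exI[of _ 0], rule exI[of _ x]) (use that in simp)
    qed
    have l2: "linear (\<lambda>x. l x - \<mu> x)"
      using l(1) by (intro linearI) (simp_all add: linear_add linear_scale blinfun.add_right blinfun.scaleR_right algebra_simps)
    obtain M where M: "finite_measure M" "sets M = sets borel"
      "\<And>f. continuous_on UNIV f \<Longrightarrow> (\<integral>x. f x \<partial>M) = l (Bcontfun f)"
      using riesz_representation[OF c pos_functionalI[OF c l(1) pos]] by blast
    have pos2: "0 \<le> l x - \<mu> x" if "\<And>t. 0 \<le> apply_bcontfun x t" for x using ge[OF that] by simp
    obtain N where N: "finite_measure N" "sets N = sets borel"
      "\<And>f. continuous_on UNIV f \<Longrightarrow> (\<integral>x. f x \<partial>N) = l (Bcontfun f) - \<mu> (Bcontfun f)"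
      using riesz_representation[OF c pos_functionalI[OF c l2 pos2]] by blast
    show thesis
      by (rule that[OF M(1,2) N(1,2)]) (simp add: M(3) N(3) apply_bcontfun_inverse)
  qed
qed

section \<open>Independent sequences of sets\<close>

text \<open>A choice \<open>c\<close> carries two sets \<open>lo c\<close> and \<open>hi c\<close>; the abstract class \<open>P\<close> of sets that
  survive indefinitely often replaces positivity of measure or being relatively open.\<close>

lemma independent_sequence:
  fixes P :: "'a set set" and lo hi :: "'c \<Rightarrow> 'a set" and adm :: "nat \<Rightarrow> 'c \<Rightarrow> bool" and top :: "'c \<Rightarrow> nat"
  assumes P0: "E0 \<in> P" and ne: "{} \<notin> P"
    and step: "\<And>\<E> N. finite \<E> \<Longrightarrow> \<E> \<subseteq> P \<Longrightarrow> \<exists>c. adm N c \<and>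
      (\<forall>E\<in>\<E>. (\<exists>E'\<in>P. E' \<subseteq> E \<inter> lo c) \<and> (\<exists>E'\<in>P. E' \<subseteq> E \<inter> hi c))"
  obtains c :: "nat \<Rightarrow> 'c" and N where "adm N (c 0)" "\<And>n. adm (top (c n)) (c (Suc n))"
    "\<And>n \<sigma>. \<exists>x. \<forall>i<n. x \<in> (if \<sigma> i then hi (c i) else lo (c i))"
proof -
  \<comment> \<open>The state consists of a finite family of surviving sets and the last choice
    made. Each step refines every member both ways by the same choice, so after \<open>n\<close>
    steps the family has a member for each of the patterns of length \<open>n\<close>.\<close>
  define Good where "Good s \<longleftrightarrow> finite (fst s) \<and> fst s \<subseteq> P \<and> fst s \<noteq> {}" for s :: "'a set set \<times> 'c"
  define Next where "Next s t \<longleftrightarrow> adm (top (snd s)) (snd t) \<and>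
    (\<forall>E\<in>fst s. (\<exists>E'\<in>fst t. E' \<subseteq> E \<inter> lo (snd t)) \<and> (\<exists>E'\<in>fst t. E' \<subseteq> E \<inter> hi (snd t)))"
    for s t :: "'a set set \<times> 'c"
  have "\<exists>s. \<forall>n. Good (s n) \<and> Next (s n) (s (Suc n))"
  proof (rule dependent_nat_choice)
    \<comment> \<open>There is no choice yet, so its component is arbitrary; the \<open>N\<close> of
      the conclusion is the \<open>top\<close> of this dummy.\<close>
    show "\<exists>s. Good s" unfolding Good_def using P0 by (intro exI[of _ "({E0}, undefined)"]) auto
  next
    fix s and n :: nat assume "Good s"
    then have "finite (fst s)" "fst s \<subseteq> P" unfolding Good_def by auto
    from step[OF this, of "top (snd s)"] obtain c where c: "adm (top (snd s)) c"
      "\<forall>E\<in>fst s. (\<exists>E'\<in>P. E' \<subseteq> E \<inter> lo c) \<and> (\<exists>E'\<in>P. E' \<subseteq> E \<inter> hi c)" by auto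
    have "\<forall>E\<in>fst s. \<exists>E'. E' \<in> P \<and> E' \<subseteq> E \<inter> lo c" using c(2) by auto
    from bchoice[OF this] obtain l where l: "\<And>E. E \<in> fst s \<Longrightarrow> l E \<in> P \<and> l E \<subseteq> E \<inter> lo c" by auto
    have "\<forall>E\<in>fst s. \<exists>E'. E' \<in> P \<and> E' \<subseteq> E \<inter> hi c" using c(2) by auto
    from bchoice[OF this] obtain h where h: "\<And>E. E \<in> fst s \<Longrightarrow> h E \<in> P \<and> h E \<subseteq> E \<inter> hi c" by auto
    have lh: "\<And>E. E \<in> fst s \<Longrightarrow> l E \<in> P" "\<And>E. E \<in> fst s \<Longrightarrow> l E \<subseteq> E \<inter> lo c"
      "\<And>E. E \<in> fst s \<Longrightarrow> h E \<in> P" "\<And>E. E \<in> fst s \<Longrightarrow> h E \<subseteq> E \<inter> hi c"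
      using l h by blast+
    have "Good (l ` fst s \<union> h ` fst s, c)" using \<open>Good s\<close> lh unfolding Good_def by auto
    moreover have "Next s (l ` fst s \<union> h ` fst s, c)"
      unfolding Next_def
    proof (intro conjI ballI)
      show "adm (top (snd s)) (snd (l ` fst s \<union> h ` fst s, c))" using c by simp
      fix E assume E: "E \<in> fst s"
      show "\<exists>E'\<in>fst (l ` fst s \<union> h ` fst s, c). E' \<subseteq> E \<inter> lo (snd (l ` fst s \<union> h ` fst s, c))"
        using lh(2)[OF E] E by (intro bexI[of _ "l E"]) auto
      show "\<exists>E'\<in>fst (l ` fst s \<union> h ` fst s, c). E' \<subseteq> E \<inter> hi (snd (l ` fst s \<union> h ` fst s, c))"
        using lh(4)[OF E] E by (intro bexI[of _ "h E"]) auto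
    qed
    ultimately show "\<exists>t. Good t \<and> Next s t" by blast
  qed
  then obtain s where s: "\<And>n. Good (s n)" "\<And>n. Next (s n) (s (Suc n))" by blast
  define c where "c n = snd (s (Suc n))" for n
  have pat: "\<exists>E\<in>fst (s n). \<forall>i<n. E \<subseteq> (if \<sigma> i then hi (c i) else lo (c i))" for n \<sigma>
  proof (induction n)
    case 0
    then show ?case using s(1)[of 0] unfolding Good_def by auto
  next
    case (Suc n)
    then obtain E where E: "E \<in> fst (s n)" "\<forall>i<n. E \<subseteq> (if \<sigma> i then hi (c i) else lo (c i))" by blast
    have "\<exists>E'\<in>fst (s (Suc n)). E' \<subseteq> E \<inter> (if \<sigma> n then hi (c n) else lo (c n))"
      using s(2)[of n] E(1) unfolding Next_def c_def by auto
    then obtain E' where E': "E' \<in> fst (s (Suc n))" "E' \<subseteq> E \<inter> (if \<sigma> n then hi (c n) else lo (c n))" by blast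
    show ?case
    proof (intro bexI[OF _ E'(1)] allI impI)
      fix i assume "i < Suc n"
      then consider "i < n" | "i = n" by linarith
      then show "E' \<subseteq> (if \<sigma> i then hi (c i) else lo (c i))" using E(2) E'(2) by cases blast+
    qed
  qed
  show thesis
  proof (rule that[of "top (snd (s 0))" c])
    show "adm (top (snd (s 0))) (c 0)" "\<And>n. adm (top (c n)) (c (Suc n))"
      using s(2) unfolding Next_def c_def by auto
    fix n and \<sigma> :: "nat \<Rightarrow> bool"
    obtain E where E: "E \<in> fst (s n)" "\<forall>i<n. E \<subseteq> (if \<sigma> i then hi (c i) else lo (c i))" using pat by blast
    then have "E \<noteq> {}" using s(1)[of n] ne unfolding Good_def by auto
    then obtain x where "x \<in> E" by blast
    then have "\<forall>i<n. x \<in> (if \<sigma> i then hi (c i) else lo (c i))" using E(2) by blast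
    then show "\<exists>x. \<forall>i<n. x \<in> (if \<sigma> i then hi (c i) else lo (c i))" by blast
  qed
qed

section \<open>Ultrafilter limits\<close>

lemma ultrafilter_exists:
  fixes F :: "'a filter"
  assumes "F \<noteq> bot"
  obtains U where "U \<le> F" "U \<noteq> bot" "\<And>P. eventually P U \<or> eventually (\<lambda>x. \<not> P x) U"
proof -
  define A where "A = {G. G \<noteq> bot \<and> G \<le> F}"
  have "\<exists>m\<in>A. \<forall>a\<in>A. a \<le> m \<longrightarrow> a = m"
  proof (rule predicate_Zorn[where P = "\<lambda>x y. y \<le> x"])
    show "partial_order_on A (relation_of (\<lambda>x y. y \<le> x) A)"
      by (auto simp: partial_order_on_def preorder_on_def refl_on_def trans_def antisym_def relation_of_def)
  next
    fix C assume "C \<in> Chains (relation_of (\<lambda>x y. y \<le> x) A)"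
    then have CA: "C \<subseteq> A" and ch: "\<And>x y. x \<in> C \<Longrightarrow> y \<in> C \<Longrightarrow> x \<le> y \<or> y \<le> x"
      unfolding Chains_def relation_of_def by auto
    show "\<exists>u\<in>A. \<forall>a\<in>C. u \<le> a"
    proof (cases "C = {}")
      case True
      then show ?thesis using assms by (intro bexI[of _ F]) (auto simp: A_def)
    next
      case False
      have "eventually P (Inf C) \<longleftrightarrow> (\<exists>b\<in>C. eventually P b)" for P
      proof (rule eventually_Inf_base[OF False])
        fix x y assume xy: "x \<in> C" "y \<in> C"
        show "\<exists>z\<in>C. z \<le> inf x y"
          using ch[OF xy] xy by (auto intro: bexI[of _ x] bexI[of _ y])
      qed
      then have "Inf C \<noteq> bot" using CA unfolding trivial_limit_def A_def by auto
      moreover obtain c where "c \<in> C" using False by blast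
      then have "Inf C \<le> F" using CA by (auto simp: A_def intro: Inf_lower2)
      ultimately have "Inf C \<in> A" by (simp add: A_def)
      then show ?thesis by (auto intro: Inf_lower)
    qed
  qed
  then obtain U where U: "U \<in> A" "\<And>a. a \<in> A \<Longrightarrow> a \<le> U \<Longrightarrow> a = U" by blast
  show thesis
  proof (rule that)
    show "U \<le> F" "U \<noteq> bot" using U(1) by (auto simp: A_def)
    fix P
    show "eventually P U \<or> eventually (\<lambda>x. \<not> P x) U"
    proof (rule disjCI)
      assume n: "\<not> eventually (\<lambda>x. \<not> P x) U"
      define V where "V = inf U (principal {x. P x})"
      have "V \<noteq> bot"
        using n unfolding V_def trivial_limit_def eventually_inf_principal by simp
      then have "V \<in> A" using U(1) by (auto simp: A_def V_def intro: le_infI1)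
      then have "V = U" by (rule U(2)) (simp add: V_def)
      then have "U \<le> principal {x. P x}" unfolding V_def by (metis inf_le2)
      then show "eventually P U" by (simp add: le_principal)
    qed
  qed
qed

text \<open>A general mean gives averages but no index at which finitely many conditions hold
  together. For a mean that is a limit along an ultrafilter, strict inequalities between means hold
  eventually, and eventual properties can be intersected.\<close>

lemma ultrafilter_mean:
  "\<exists>(U :: nat filter) m. U \<le> sequentially \<and> U \<noteq> bot \<and> is_mean m \<and> (\<forall>u. bseq u \<longrightarrow> (u \<longlongrightarrow> m u) U)"
proof -
  obtain U :: "nat filter" where U: "U \<le> sequentially" "U \<noteq> bot"
    "\<And>P. eventually P U \<or> eventually (\<lambda>x. \<not> P x) U"
    using ultrafilter_exists[OF sequentially_bot] by metis
  have conv: "\<exists>l. (u \<longlongrightarrow> l) U" if u: "bseq u" for u :: "nat \<Rightarrow> real"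
  proof -
    obtain C where C: "\<And>k. \<bar>u k\<bar> \<le> C" by (rule bseqD[OF u]) blast
    have "compact {-C..C}" by simp
    moreover have "filtermap u U \<noteq> bot" using U(2) by (simp add: filtermap_bot_iff)
    moreover have "eventually (\<lambda>x. x \<in> {-C..C}) (filtermap u U)"
      unfolding eventually_filtermap using C by (intro always_eventually allI) (simp add: abs_le_iff minus_le_iff)
    ultimately obtain l where l: "inf (nhds l) (filtermap u U) \<noteq> bot"
      unfolding compact_filter by blast
    have "(u \<longlongrightarrow> l) U"
    proof (rule topological_tendstoI)
      fix S assume S: "open S" "l \<in> S"
      show "eventually (\<lambda>x. u x \<in> S) U"
      proof (rule ccontr)
        assume "\<not> ?thesis"
        then have "eventually (\<lambda>x. u x \<notin> S) U" using U(3)[of "\<lambda>x. u x \<in> S"] by blast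
        then have "eventually (\<lambda>x. x \<notin> S) (filtermap u U)" by (simp add: eventually_filtermap)
        moreover have "eventually (\<lambda>x. x \<in> S) (nhds l)" using S by (rule eventually_nhds_in_open)
        ultimately have "eventually (\<lambda>x. False) (inf (nhds l) (filtermap u U))"
          unfolding eventually_inf by blast
        then show False using l by (simp add: trivial_limit_def)
      qed
    qed
    then show ?thesis by blast
  qed
  define m where "m u = Lim U u" for u :: "nat \<Rightarrow> real"
  have m: "(u \<longlongrightarrow> m u) U" if "bseq u" for u
    using conv[OF that] tendsto_Lim[OF U(2)] unfolding m_def by blast
  have eq: "m u = l" if "(u \<longlongrightarrow> l) U" for u l unfolding m_def by (rule tendsto_Lim[OF U(2) that])
  have "is_mean m"
    unfolding is_mean_def
  proof (intro conjI allI impI)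
    fix u v assume "bseq u" "bseq v"
    then show "m (\<lambda>k. u k + v k) = m u + m v" by (intro eq tendsto_add m)
  next
    fix c u assume "bseq u"
    then show "m (\<lambda>k. c * u k) = c * m u" by (intro eq tendsto_mult m tendsto_const)
  next
    fix C u assume "bseq u" "\<forall>\<^sub>F k in sequentially. u k \<le> C"
    then have "(u \<longlongrightarrow> m u) U" "\<forall>\<^sub>F k in U. u k \<le> C" using m U(1) by (auto intro: filter_leD)
    then show "m u \<le> C" using U(2) by (intro tendsto_upperbound)
  qed
  then show ?thesis using U(1,2) m by auto
qed

section \<open>Averaging functions against a mean\<close>

lemma (in finite_measure) abs_integral_le:
  assumes "f \<in> borel_measurable M" "\<And>x. \<bar>f x\<bar> \<le> (C::real)" "E \<in> sets M"
  shows "\<bar>\<integral>x. indicator E x * f x \<partial>M\<bar> \<le> C * measure M E"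
proof -
  have C: "0 \<le> C" using assms(2) abs_ge_zero order_trans by blast
  have "\<bar>\<integral>x. indicator E x * f x \<partial>M\<bar> \<le> (\<integral>x. \<bar>indicator E x * f x\<bar> \<partial>M)" by (rule integral_abs_bound)
  also have "\<dots> \<le> (\<integral>x. C * indicator E x \<partial>M)"
  proof (rule integral_mono)
    show "integrable M (\<lambda>x. \<bar>indicator E x * f x\<bar>)"
      using assms C by (intro bounded_integrable[of _ C]) (auto simp: indicator_def)
    show "integrable M (\<lambda>x. C * indicator E x)"
      using assms C by (intro bounded_integrable[of _ C]) (auto simp: indicator_def)
  qed (use assms(2) C in \<open>auto simp: indicator_def\<close>)
  also have "\<dots> = C * measure M E" using assms(3) by (simp add: sets.Int_space_eq2)
  finally show ?thesis .
qed

text \<open>The mean of the set functions \<open>E \<mapsto> \<integral>\<^sub>E f k\<close> is absolutely continuous, so it has a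
  density.\<close>

lemma (in finite_measure) mean_density:
  fixes f :: "nat \<Rightarrow> 'a \<Rightarrow> real"
  assumes m: "is_mean m" and f: "\<And>k. f k \<in> borel_measurable M" "\<And>k x. \<bar>f k x\<bar> \<le> C"
  shows "\<exists>g. integrable M g \<and>
    (\<forall>E\<in>sets M. m (\<lambda>k. \<integral>x. indicator E x * f k x \<partial>M) = (\<integral>x. indicator E x * g x \<partial>M))"
proof -
  have C: "0 \<le> C" using f(2) abs_ge_zero order_trans by blast
  \<comment> \<open>The shift by \<open>C\<close> makes the set functions nonnegative, so that the
    measure-theoretic Radon-Nikodym theorem applies; it is undone at the end.\<close>
  define h where "h k x = f k x + C" for k x
  have h: "h k \<in> borel_measurable M" "0 \<le> h k x" "\<bar>h k x\<bar> \<le> 2 * C" for k x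
    using f(1)[of k] f(2)[of k x] unfolding h_def by auto
  define \<nu> where "\<nu> E = m (\<lambda>k. \<integral>x. indicator E x * h k x \<partial>M)" for E
  have bs: "bseq (\<lambda>k. \<integral>x. indicator E x * h k x \<partial>M)" if "E \<in> sets M" for E
    using abs_integral_le[OF h(1,3) that] by (rule bseqI)
  have \<nu>0: "0 \<le> \<nu> E" if "E \<in> sets M" for E
    unfolding \<nu>_def using h by (intro mean_nonneg[OF m bs[OF that]] integral_nonneg) (simp add: h_def)
  have \<nu>_le: "\<nu> E \<le> 2 * C * measure M E" if "E \<in> sets M" for E
    unfolding \<nu>_def using abs_integral_le[OF h(1,3) that] by (intro mean_le[OF m bs[OF that]]) (auto simp: abs_le_iff)
  have ih: "integrable M (\<lambda>x. indicator E x * h k x)" if "E \<in> sets M" for E k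
    using h C that by (intro bounded_integrable[of _ "2 * C"]) (auto simp: indicator_def)
  have add: "\<nu> (A \<union> B) = \<nu> A + \<nu> B" if AB: "A \<in> sets M" "B \<in> sets M" "A \<inter> B = {}" for A B
  proof -
    have "(\<integral>x. indicator (A \<union> B) x * h k x \<partial>M) = (\<integral>x. indicator A x * h k x \<partial>M) + (\<integral>x. indicator B x * h k x \<partial>M)" for k
    proof -
      have "indicator (A \<union> B) x * h k x = indicator A x * h k x + indicator B x * h k x" for x
        using AB(3) by (auto simp: indicator_def)
      then show ?thesis using ih[OF AB(1)] ih[OF AB(2)] by (simp add: Bochner_Integration.integral_add)
    qed
    then show ?thesis unfolding \<nu>_def using mean_add[OF m bs[OF AB(1)] bs[OF AB(2)]] by simp
  qed
  define N where "N = measure_of (space M) (sets M) (\<lambda>E. ennreal (\<nu> E))"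
  have pos: "positive (sets M) (\<lambda>E. ennreal (\<nu> E))"
    using \<nu>_le[of "{}"] \<nu>0[of "{}"] by (simp add: positive_def)
  \<comment> \<open>The mean gives finite additivity only. The bound
    \<open>\<nu> E \<le> 2 * C * measure M E\<close>, which is uniform in \<open>k\<close>, supplies
    continuity at the empty set.\<close>
  have "countably_additive (sets M) (\<lambda>E. ennreal (\<nu> E))"
  proof (rule sets.empty_continuous_imp_countably_additive[OF pos])
    show "additive (sets M) (\<lambda>E. ennreal (\<nu> E))"
      unfolding additive_def using add \<nu>0 by (simp add: ennreal_plus)
    fix A :: "nat \<Rightarrow> 'a set" assume A: "range A \<subseteq> sets M" "decseq A" "(\<Inter>i. A i) = {}"
    have "(\<lambda>i. 2 * C * measure M (A i)) \<longlonglongrightarrow> 2 * C * measure M (\<Inter>i. A i)"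
      by (intro tendsto_mult tendsto_const finite_Lim_measure_decseq A)
    then have "(\<lambda>i. 2 * C * measure M (A i)) \<longlonglongrightarrow> 0" using A by simp
    then have "(\<lambda>i. \<nu> (A i)) \<longlonglongrightarrow> 0"
      using A \<nu>0 \<nu>_le by (intro tendsto_sandwich[OF _ _ tendsto_const, of 0 "\<lambda>i. \<nu> (A i)"]) auto
    then show "(\<lambda>i. ennreal (\<nu> (A i))) \<longlonglongrightarrow> 0" using tendsto_ennrealI by fastforce
  qed simp
  then have N: "emeasure N E = ennreal (\<nu> E)" if "E \<in> sets M" for E
    unfolding N_def using pos that by (intro emeasure_measure_of_sigma sets.sigma_algebra_axioms) auto
  have sN: "sets N = sets M" unfolding N_def by simp
  have "absolutely_continuous M N"
    unfolding absolutely_continuous_def null_sets_def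
  proof safe
    fix E assume "E \<in> sets M" "emeasure M E = 0"
    then show "E \<in> sets N" "emeasure N E = 0"
      using \<nu>_le[of E] \<nu>0[of E] by (auto simp: sN N measure_def)
  qed
  then obtain G where G: "G \<in> borel_measurable M" "density M G = N"
    using Radon_Nikodym[of N] sN by blast
  have "(\<integral>\<^sup>+x. G x \<partial>M) = emeasure N (space M)"
    unfolding G(2)[symmetric] using G(1) by (subst emeasure_density) (auto intro!: nn_integral_cong)
  then have "(\<integral>\<^sup>+x. G x \<partial>M) \<noteq> \<infinity>" using N[of "space M"] by simp
  then have Gfin: "AE x in M. G x \<noteq> \<infinity>" using G(1) by (intro nn_integral_PInf_AE)
  define g where "g x = enn2real (G x)" for x
  have gm: "g \<in> borel_measurable M" unfolding g_def using G(1) by measurable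
  have nn: "(\<integral>\<^sup>+x. ennreal (indicator E x * g x) \<partial>M) = ennreal (\<nu> E)" if E: "E \<in> sets M" for E
  proof -
    have "(\<integral>\<^sup>+x. ennreal (indicator E x * g x) \<partial>M) = (\<integral>\<^sup>+x. G x * indicator E x \<partial>M)"
      using Gfin by (intro nn_integral_cong_AE) (auto simp: g_def indicator_def less_top[symmetric])
    also have "\<dots> = emeasure N E" unfolding G(2)[symmetric] using G(1) E by (simp add: emeasure_density)
    finally show ?thesis using N[OF E] by simp
  qed
  have ig: "integrable M g"
  proof (rule integrableI_nonneg[OF gm])
    show "(\<integral>\<^sup>+x. ennreal (g x) \<partial>M) < \<infinity>"
    proof -
      have "(\<integral>\<^sup>+x. ennreal (g x) \<partial>M) = (\<integral>\<^sup>+x. ennreal (indicator (space M) x * g x) \<partial>M)"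
        by (intro nn_integral_cong) (simp add: indicator_def)
      then show ?thesis using nn[of "space M"] by simp
    qed
  qed (simp add: g_def)
  have int: "(\<integral>x. indicator E x * g x \<partial>M) = \<nu> E" if E: "E \<in> sets M" for E
  proof -
    have "(\<integral>x. indicator E x * g x \<partial>M) = enn2real (\<integral>\<^sup>+x. ennreal (indicator E x * g x) \<partial>M)"
      by (rule integral_eq_nn_integral) (use gm E in simp, simp add: g_def)
    then show ?thesis using nn[OF E] \<nu>0[OF E] by simp
  qed
  show ?thesis
  proof (intro exI[of _ "\<lambda>x. g x - C"] conjI ballI)
    show "integrable M (\<lambda>x. g x - C)" using ig by simp
    fix E assume E: "E \<in> sets M"
    have iE: "integrable M (\<lambda>x. indicator E x * C)"
      using E C by (intro bounded_integrable[of _ C]) (auto simp: indicator_def)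
    have igE: "integrable M (\<lambda>x. indicator E x * g x)"
      using integrable_mult_indicator[OF E ig] by simp
    have "(\<integral>x. indicator E x * f k x \<partial>M) = (\<integral>x. indicator E x * h k x \<partial>M) - (\<integral>x. indicator E x * C \<partial>M)" for k
      using ih[OF E, of k] iE by (subst Bochner_Integration.integral_diff[symmetric]) (auto simp: h_def algebra_simps)
    then have "m (\<lambda>k. \<integral>x. indicator E x * f k x \<partial>M) = \<nu> E - (\<integral>x. indicator E x * C \<partial>M)"
      unfolding \<nu>_def using mean_diff[OF m bs[OF E] bseq_const] mean_const[OF m] by simp
    also have "\<dots> = (\<integral>x. indicator E x * (g x - C) \<partial>M)"
      unfolding int[OF E, symmetric] using igE iE
      by (subst Bochner_Integration.integral_diff[symmetric]) (auto simp: algebra_simps)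
    finally show "m (\<lambda>k. \<integral>x. indicator E x * f k x \<partial>M) = (\<integral>x. indicator E x * (g x - C) \<partial>M)" .
  qed
qed

section \<open>Independent subsequences\<close>

text \<open>If \<open>\<phi> < \<kappa>\<close> almost everywhere on \<open>E\<close>, then
  \<open>\<phi> * \<psi> \<le> 2 * \<kappa>\<close> there. The bound 2 on the weight is made for
  weights \<open>1 + r\<close> and \<open>1 - r\<close> with values of \<open>r\<close> in
  \<open>[-1, 1]\<close>.\<close>

lemma (in finite_measure) large_integral_imp_large_set:
  assumes \<phi>: "\<phi> \<in> borel_measurable M" "\<And>x. \<bar>\<phi> x\<bar> \<le> C"
    and \<psi>: "\<psi> \<in> borel_measurable M" "\<And>x. 0 \<le> \<psi> x" "\<And>x. \<psi> x \<le> 2" and E: "E \<in> sets M" and \<kappa>: "0 \<le> \<kappa>"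
    and large: "2 * \<kappa> * measure M E < (\<integral>x. indicator E x * (\<phi> x * \<psi> x) \<partial>M)"
  shows "0 < measure M (E \<inter> {x \<in> space M. \<kappa> \<le> (\<phi> x :: real)})"
proof (rule ccontr)
  let ?D = "E \<inter> {x \<in> space M. \<kappa> \<le> \<phi> x}"
  have D: "?D \<in> sets M" using \<phi> E by measurable
  assume "\<not> 0 < measure M ?D"
  then have "measure M ?D = 0" by (simp add: zero_less_measure_iff)
  then have "?D \<in> null_sets M" using D by (simp add: null_sets_def emeasure_eq_measure)
  then have ae: "AE x in M. x \<notin> ?D" by (rule AE_not_in)
  have C: "0 \<le> C" using \<phi>(2) abs_ge_zero order_trans by blast
  have "(\<integral>x. indicator E x * (\<phi> x * \<psi> x) \<partial>M) \<le> (\<integral>x. indicator E x * (2 * \<kappa>) \<partial>M)"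
  proof (rule integral_mono_AE)
    have "\<bar>indicator E x * (\<phi> x * \<psi> x)\<bar> \<le> C * 2" for x
    proof -
      have "\<bar>indicator E x * (\<phi> x * \<psi> x)\<bar> \<le> \<bar>\<phi> x\<bar> * \<bar>\<psi> x\<bar>" by (simp add: indicator_def abs_mult)
      also have "\<dots> \<le> C * 2" using \<phi>(2)[of x] \<psi>(2,3)[of x] C by (intro mult_mono) auto
      finally show ?thesis .
    qed
    then show "integrable M (\<lambda>x. indicator E x * (\<phi> x * \<psi> x))"
      using \<phi> \<psi> E by (intro bounded_integrable[of _ "C * 2"]) auto
    show "integrable M (\<lambda>x. indicator E x * (2 * \<kappa>))"
      using E by (intro bounded_integrable[of _ "\<bar>2 * \<kappa>\<bar>"]) (auto simp: indicator_def)
    show "AE x in M. indicator E x * (\<phi> x * \<psi> x) \<le> indicator E x * (2 * \<kappa>)"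
      using ae AE_space
    proof eventually_elim
      case (elim x)
      show ?case
      proof (cases "x \<in> E")
        case True
        then have "\<phi> x < \<kappa>" using elim by auto
        then have "\<phi> x * \<psi> x \<le> \<kappa> * \<psi> x" using \<psi>(2)[of x] by (intro mult_right_mono) auto
        also have "\<dots> \<le> \<kappa> * 2" using \<psi>(3)[of x] \<kappa> by (intro mult_left_mono)
        finally show ?thesis using True by simp
      qed simp
    qed
  qed
  also have "\<dots> = 2 * \<kappa> * measure M E" using E by (simp add: sets.Int_space_eq2)
  finally show False using large by simp
qed

text \<open>Let \<open>G\<close> and \<open>w\<close> be the weak limits of \<open>g j\<close> and
  \<open>g j * r j\<close> along an ultrafilter. Where \<open>w\<close> is bounded away from 0 and
  \<open>G\<close> is nearly a constant \<open>g0\<close>, the weight \<open>1 + r j\<close> makes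
  \<open>g j - g0\<close> positive on average over any set of positive measure, and
  \<open>1 - r j\<close> does the same for \<open>g0 - g j\<close>. So each such set contains points
  where \<open>g j\<close> is well above \<open>g0\<close> and points where it is well below, which
  is the splitting needed for independence.\<close>

lemma (in finite_measure) independent_subsequence:
  fixes g r :: "nat \<Rightarrow> 'a \<Rightarrow> real"
  assumes g: "\<And>j. g j \<in> borel_measurable M" "\<And>j x. \<bar>g j x\<bar> \<le> C"
    and r: "\<And>j. r j \<in> borel_measurable M" "\<And>j x. \<bar>r j x\<bar> \<le> 1"
    and weak: "\<And>E. E \<in> sets M \<Longrightarrow> (\<lambda>j. \<integral>x. indicator E x * r j x \<partial>M) \<longlonglongrightarrow> 0"
    and \<delta>: "0 < \<delta>" "\<And>j. \<delta> \<le> (\<integral>x. g j x * r j x \<partial>M)"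
  obtains s :: "nat \<Rightarrow> nat" and \<kappa> g0 where "strict_mono s" "0 < \<kappa>"
    "\<And>n \<sigma>. \<exists>x. \<forall>i<n. if \<sigma> i then g0 + \<kappa> \<le> g (s i) x else g (s i) x \<le> g0 - \<kappa>"
proof -
  obtain U m where U: "U \<le> sequentially" "U \<noteq> bot" and m: "is_mean m" and lim: "\<And>u. bseq u \<Longrightarrow> (u \<longlongrightarrow> m u) U"
    using ultrafilter_mean by auto
  have C: "0 \<le> C" using g(2) abs_ge_zero order_trans by blast
  have gr: "(\<lambda>x. g j x * r j x) \<in> borel_measurable M" "\<bar>g j x * r j x\<bar> \<le> C" for j x
  proof -
    show "(\<lambda>x. g j x * r j x) \<in> borel_measurable M" using g(1) r(1) by measurable
    have "\<bar>g j x * r j x\<bar> \<le> C * 1" unfolding abs_mult using g(2)[of j x] r(2)[of j x] C by (intro mult_mono) auto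
    then show "\<bar>g j x * r j x\<bar> \<le> C" by simp
  qed
  obtain G where "integrable M G \<and> (\<forall>E\<in>sets M.
      m (\<lambda>k. \<integral>x. indicator E x * g k x \<partial>M) = (\<integral>x. indicator E x * G x \<partial>M))"
    using mean_density[OF m g] by (rule exE)
  note G = conjunct1[OF this] bspec[OF conjunct2[OF this]]
  obtain w where "integrable M w \<and> (\<forall>E\<in>sets M.
      m (\<lambda>k. \<integral>x. indicator E x * (g k x * r k x) \<partial>M) = (\<integral>x. indicator E x * w x \<partial>M))"
    using mean_density[OF m gr] by (rule exE)
  note w = conjunct1[OF this] bspec[OF conjunct2[OF this]]
  have limG: "((\<lambda>k. \<integral>x. indicator E x * g k x \<partial>M) \<longlongrightarrow> (\<integral>x. indicator E x * G x \<partial>M)) U" if "E \<in> sets M" for E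
    unfolding G(2)[OF that, symmetric] by (rule lim[OF bseqI[OF abs_integral_le[OF g that]]])
  have limw: "((\<lambda>k. \<integral>x. indicator E x * (g k x * r k x) \<partial>M) \<longlongrightarrow> (\<integral>x. indicator E x * w x \<partial>M)) U" if "E \<in> sets M" for E
    unfolding w(2)[OF that, symmetric] by (rule lim[OF bseqI[OF abs_integral_le[OF gr that]]])
  have limr: "((\<lambda>k. \<integral>x. indicator E x * r k x \<partial>M) \<longlongrightarrow> 0) U" if "E \<in> sets M" for E
    by (rule tendsto_mono[OF U(1) weak[OF that]])
  define T where "T = measure M (space M)"
  have T0: "0 \<le> T" by (simp add: T_def)
  \<comment> \<open>Small enough that \<open>w \<le> \<delta>'\<close> almost everywhere would force
    the integral of \<open>w\<close> below \<open>\<delta>\<close>; the summand 1 covers total mass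
    0.\<close>
  define \<delta>' where "\<delta>' = \<delta> / (2 * (T + 1))"
  have \<delta>': "0 < \<delta>'" "\<delta>' * T < \<delta>" using \<delta>(1) T0 by (auto simp: \<delta>'_def field_simps intro!: add_nonneg_pos)
  have ind_space: "(\<integral>x. indicator (space M) x * f x \<partial>M) = (\<integral>x. f x \<partial>M)" for f :: "'a \<Rightarrow> real"
    by (rule Bochner_Integration.integral_cong) auto
  have w\<delta>: "\<delta> \<le> (\<integral>x. w x \<partial>M)"
  proof (rule tendsto_lowerbound[OF _ _ U(2)])
    show "((\<lambda>k. \<integral>x. g k x * r k x \<partial>M) \<longlongrightarrow> (\<integral>x. w x \<partial>M)) U"
      using limw[of "space M"] by (simp add: ind_space)
  qed (use \<delta>(2) in simp)
  define A where "A = {x \<in> space M. \<delta>' < w x}"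
  have [measurable]: "w \<in> borel_measurable M" "G \<in> borel_measurable M" using w(1) G(1) by auto
  have A: "A \<in> sets M" unfolding A_def by measurable
  have A_null: "A \<notin> null_sets M"
  proof
    assume "A \<in> null_sets M"
    then have "AE x in M. x \<notin> A" by (rule AE_not_in)
    then have "AE x in M. w x \<le> \<delta>'" using AE_space by eventually_elim (auto simp: A_def)
    then have "(\<integral>x. w x \<partial>M) \<le> (\<integral>x. \<delta>' \<partial>M)" using w(1) by (intro integral_mono_AE) auto
    also have "\<dots> = \<delta>' * T" by (simp add: T_def)
    finally show False using w\<delta> \<delta>' by simp
  qed
  define \<eta> where "\<eta> = \<delta>' / 4"
  define \<kappa> where "\<kappa> = \<delta>' / 8"
  have \<eta>: "0 < \<eta>" "0 < \<kappa>" using \<delta>' by (auto simp: \<eta>_def \<kappa>_def)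
  \<comment> \<open>Slabs on which \<open>G\<close> varies by at most \<open>\<eta>\<close>. The
    constants leave a gap: the limits of the two weighted averages are at least
    \<open>\<delta>' - \<eta> = 6 * \<kappa>\<close>, while \<open>2 * \<kappa>\<close> is
    needed.\<close>
  define B where "B k = A \<inter> {x \<in> space M. of_int k * \<eta> \<le> G x \<and> G x < (of_int k + 1) * \<eta>}" for k :: int
  have B: "B k \<in> sets M" for k unfolding B_def using A by measurable
  have "A \<subseteq> (\<Union>k. B k)"
  proof
    fix x assume "x \<in> A"
    moreover have "of_int \<lfloor>G x / \<eta>\<rfloor> * \<eta> \<le> G x" "G x < (of_int \<lfloor>G x / \<eta>\<rfloor> + 1) * \<eta>"
      using mult_right_mono[OF of_int_floor_le[of "G x / \<eta>"], of \<eta>] \<eta>(1) floor_correct[of "G x / \<eta>"]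
      by (simp_all add: field_simps)
    ultimately show "x \<in> (\<Union>k. B k)" by (auto simp: B_def A_def intro!: exI[of _ "\<lfloor>G x / \<eta>\<rfloor>"])
  qed
  then have "\<exists>k. B k \<notin> null_sets M"
    using A_null A null_sets_subset[of "\<Union>k. B k" M A] null_sets_UN[of B M] by blast
  then obtain k where k: "B k \<notin> null_sets M" by blast
  define g0 where "g0 = of_int k * \<eta>"
  define P where "P = {E \<in> sets M. E \<subseteq> B k \<and> 0 < measure M E}"
  have BP: "B k \<in> P"
    using k B by (auto simp: P_def zero_less_measure_iff null_sets_def emeasure_eq_measure)
  have ev: "eventually (\<lambda>j. E \<inter> {x \<in> space M. g j x \<le> g0 - \<kappa>} \<in> P \<and> E \<inter> {x \<in> space M. g0 + \<kappa> \<le> g j x} \<in> P) U"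
    if EP: "E \<in> P" for E
  proof -
    have E: "E \<in> sets M" "E \<subseteq> B k" "0 < measure M E" using EP by (auto simp: P_def)
    have [measurable]: "g j \<in> borel_measurable M" "r j \<in> borel_measurable M" for j using g r by auto
    have iE: "integrable M (\<lambda>x. indicator E x * f x)" if "integrable M f" for f :: "'a \<Rightarrow> real"
      using integrable_mult_indicator[OF E(1) that] by simp
    have ig: "integrable M (g j)" "integrable M (r j)" "integrable M (\<lambda>x. g j x * r j x)" for j
      by (rule bounded_integrable[OF g], rule bounded_integrable[OF r], rule bounded_integrable[OF gr])
    have mE: "(\<integral>x. indicator E x * c \<partial>M) = c * measure M E" for c :: real
      using E(1) by (simp add: sets.Int_space_eq2)
    have \<alpha>: "\<delta>' * measure M E \<le> (\<integral>x. indicator E x * w x \<partial>M)"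
      unfolding mE[symmetric] using E(2)
      by (intro integral_mono iE w(1)) (auto simp: indicator_def B_def A_def)
    have \<beta>1: "g0 * measure M E \<le> (\<integral>x. indicator E x * G x \<partial>M)"
      unfolding mE[symmetric] using E(2)
      by (intro integral_mono iE G(1)) (auto simp: indicator_def B_def g0_def)
    have \<beta>2: "(\<integral>x. indicator E x * G x \<partial>M) \<le> (g0 + \<eta>) * measure M E"
      unfolding mE[symmetric] using E(2)
      by (intro integral_mono iE G(1)) (auto simp: indicator_def B_def g0_def algebra_simps)
    define a where "a j = (\<integral>x. indicator E x * (g j x * r j x) \<partial>M)" for j
    define b where "b j = (\<integral>x. indicator E x * g j x \<partial>M)" for j
    define \<rho> where "\<rho> j = (\<integral>x. indicator E x * r j x \<partial>M)" for j
    \<comment> \<open>In both expansions the correlation \<open>a j\<close> carries a plus sign, the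
      terms in \<open>G\<close> almost cancel against \<open>g0\<close>, and \<open>\<rho> j\<close>
      tends to 0 because the \<open>r j\<close> are weakly null.\<close>
    have split1: "(\<integral>x. indicator E x * ((g j x - g0) * (1 + r j x)) \<partial>M) = a j + b j - g0 * \<rho> j - g0 * measure M E" for j
    proof -
      have "(\<integral>x. indicator E x * ((g j x - g0) * (1 + r j x)) \<partial>M) =
        (\<integral>x. indicator E x * (g j x * r j x) + indicator E x * g j x - g0 * (indicator E x * r j x) - indicator E x * g0 \<partial>M)"
        by (intro Bochner_Integration.integral_cong) (auto simp: algebra_simps)
      then show ?thesis using iE[OF ig(1)] iE[OF ig(2)] iE[OF ig(3)] iE[of "\<lambda>x. g0"] mE[of g0]
        by (simp add: a_def b_def \<rho>_def)
    qed
    have split2: "(\<integral>x. indicator E x * ((g0 - g j x) * (1 - r j x)) \<partial>M) = a j - b j - g0 * \<rho> j + g0 * measure M E" for j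
    proof -
      have "(\<integral>x. indicator E x * ((g0 - g j x) * (1 - r j x)) \<partial>M) =
        (\<integral>x. indicator E x * (g j x * r j x) - indicator E x * g j x - g0 * (indicator E x * r j x) + indicator E x * g0 \<partial>M)"
        by (intro Bochner_Integration.integral_cong) (auto simp: algebra_simps)
      then show ?thesis using iE[OF ig(1)] iE[OF ig(2)] iE[OF ig(3)] iE[of "\<lambda>x. g0"] mE[of g0]
        by (simp add: a_def b_def \<rho>_def)
    qed
    have la: "(a \<longlongrightarrow> (\<integral>x. indicator E x * w x \<partial>M)) U" unfolding a_def by (rule limw[OF E(1)])
    have lb: "(b \<longlongrightarrow> (\<integral>x. indicator E x * G x \<partial>M)) U" unfolding b_def by (rule limG[OF E(1)])
    have l\<rho>: "(\<rho> \<longlongrightarrow> 0) U" unfolding \<rho>_def by (rule limr[OF E(1)])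
    have gap: "2 * \<kappa> * measure M E < (\<delta>' - \<eta>) * measure M E"
      using E(3) \<delta>'(1) by (intro mult_strict_right_mono) (auto simp: \<kappa>_def \<eta>_def)
    have "((\<lambda>j. a j + b j - g0 * \<rho> j - g0 * measure M E) \<longlongrightarrow>
      (\<integral>x. indicator E x * w x \<partial>M) + (\<integral>x. indicator E x * G x \<partial>M) - g0 * 0 - g0 * measure M E) U"
      by (intro tendsto_intros la lb l\<rho>)
    moreover have "2 * \<kappa> * measure M E <
      (\<integral>x. indicator E x * w x \<partial>M) + (\<integral>x. indicator E x * G x \<partial>M) - g0 * 0 - g0 * measure M E"
      using \<alpha> \<beta>1 gap mult_pos_pos[OF \<eta>(1) E(3)] by (simp add: algebra_simps)
    ultimately have e1: "eventually (\<lambda>j. 2 * \<kappa> * measure M E < a j + b j - g0 * \<rho> j - g0 * measure M E) U"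
      by (rule order_tendstoD)
    have "((\<lambda>j. a j - b j - g0 * \<rho> j + g0 * measure M E) \<longlongrightarrow>
      (\<integral>x. indicator E x * w x \<partial>M) - (\<integral>x. indicator E x * G x \<partial>M) - g0 * 0 + g0 * measure M E) U"
      by (intro tendsto_intros la lb l\<rho>)
    moreover have "2 * \<kappa> * measure M E <
      (\<integral>x. indicator E x * w x \<partial>M) - (\<integral>x. indicator E x * G x \<partial>M) - g0 * 0 + g0 * measure M E"
      using \<alpha> \<beta>2 gap by (simp add: algebra_simps)
    ultimately have e2: "eventually (\<lambda>j. 2 * \<kappa> * measure M E < a j - b j - g0 * \<rho> j + g0 * measure M E) U"
      by (rule order_tendstoD)
    show ?thesis
      using e1 e2
    proof eventually_elim
      case (elim j)
      have rb: "0 \<le> 1 + r j x" "1 + r j x \<le> 2" "0 \<le> 1 - r j x" "1 - r j x \<le> 2" for x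
        using r(2)[of j x] by (auto simp: abs_le_iff)
      have gb: "\<bar>g j x - g0\<bar> \<le> C + \<bar>g0\<bar>" "\<bar>g0 - g j x\<bar> \<le> C + \<bar>g0\<bar>" for x using g(2)[of j x] by linarith+
      have "0 < measure M (E \<inter> {x \<in> space M. \<kappa> \<le> g j x - g0})"
        using elim(1) \<eta>(2) unfolding split1[symmetric]
        by (intro large_integral_imp_large_set[OF _ gb(1) _ rb(1,2) E(1)]) auto
      moreover have "0 < measure M (E \<inter> {x \<in> space M. \<kappa> \<le> g0 - g j x})"
        using elim(2) \<eta>(2) unfolding split2[symmetric]
        by (intro large_integral_imp_large_set[OF _ gb(2) _ rb(3,4) E(1)]) auto
      moreover have "{x \<in> space M. \<kappa> \<le> g j x - g0} = {x \<in> space M. g0 + \<kappa> \<le> g j x}"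
        "{x \<in> space M. \<kappa> \<le> g0 - g j x} = {x \<in> space M. g j x \<le> g0 - \<kappa>}" by auto
      moreover have "E \<inter> {x \<in> space M. g0 + \<kappa> \<le> g j x} \<in> sets M" "E \<inter> {x \<in> space M. g j x \<le> g0 - \<kappa>} \<in> sets M"
        using E(1) by measurable
      ultimately show ?case using E(2) unfolding P_def by auto
    qed
  qed
  have step: "\<exists>j. N < j \<and> (\<forall>E\<in>\<E>. (\<exists>E'\<in>P. E' \<subseteq> E \<inter> {x. g j x \<le> g0 - \<kappa>}) \<and> (\<exists>E'\<in>P. E' \<subseteq> E \<inter> {x. g0 + \<kappa> \<le> g j x}))"
    if \<E>: "finite \<E>" "\<E> \<subseteq> P" for \<E> and N :: nat
  proof -
    have "eventually (\<lambda>j. \<forall>E\<in>\<E>. E \<inter> {x \<in> space M. g j x \<le> g0 - \<kappa>} \<in> P \<and> E \<inter> {x \<in> space M. g0 + \<kappa> \<le> g j x} \<in> P) U"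
      using \<E> ev by (intro eventually_ball_finite) auto
    moreover have "eventually (\<lambda>j. N < j) U"
      using U(1) eventually_gt_at_top[of N] by (rule filter_leD)
    ultimately have "eventually (\<lambda>j. N < j \<and> (\<forall>E\<in>\<E>. E \<inter> {x \<in> space M. g j x \<le> g0 - \<kappa>} \<in> P \<and> E \<inter> {x \<in> space M. g0 + \<kappa> \<le> g j x} \<in> P)) U"
      by eventually_elim simp
    from eventually_happens'[OF U(2) this] obtain j where j: "N < j"
      "\<And>E. E \<in> \<E> \<Longrightarrow> E \<inter> {x \<in> space M. g j x \<le> g0 - \<kappa>} \<in> P"
      "\<And>E. E \<in> \<E> \<Longrightarrow> E \<inter> {x \<in> space M. g0 + \<kappa> \<le> g j x} \<in> P" by auto
    show ?thesis
    proof (intro exI[of _ j] conjI ballI)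
      fix E assume "E \<in> \<E>"
      show "\<exists>E'\<in>P. E' \<subseteq> E \<inter> {x. g j x \<le> g0 - \<kappa>}" by (rule bexI[OF _ j(2)[OF \<open>E \<in> \<E>\<close>]]) auto
      show "\<exists>E'\<in>P. E' \<subseteq> E \<inter> {x. g0 + \<kappa> \<le> g j x}" by (rule bexI[OF _ j(3)[OF \<open>E \<in> \<E>\<close>]]) auto
    qed (rule j(1))
  qed
  have ne: "{} \<notin> P" by (simp add: P_def)
  show thesis
  proof (rule independent_sequence[OF BP ne step, where top = "\<lambda>j. j"])
    fix s :: "nat \<Rightarrow> nat" and N
    assume s: "\<And>n. s n < s (Suc n)"
      "\<And>n \<sigma>. \<exists>x. \<forall>i<n. x \<in> (if \<sigma> i then {x. g0 + \<kappa> \<le> g (s i) x} else {x. g (s i) x \<le> g0 - \<kappa>})"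
    show thesis
    proof (rule that[of s \<kappa> g0])
      show "strict_mono s" using s(1) by (simp add: strict_mono_Suc_iff)
      fix n and \<sigma> :: "nat \<Rightarrow> bool"
      obtain x where "\<forall>i<n. x \<in> (if \<sigma> i then {x. g0 + \<kappa> \<le> g (s i) x} else {x. g (s i) x \<le> g0 - \<kappa>})"
        using s(2) by blast
      then show "\<exists>x. \<forall>i<n. if \<sigma> i then g0 + \<kappa> \<le> g (s i) x else g (s i) x \<le> g0 - \<kappa>"
        by (intro exI[of _ x]) (auto split: if_splits)
    qed (use \<eta> in auto)
  qed
qed

text \<open>Bessel's inequality makes the squares of the coefficients summable. It supplies the weak
  convergence to 0 of the signs.\<close>

lemma (in finite_measure) bessel_tendsto_0:
  fixes r :: "nat \<Rightarrow> 'a \<Rightarrow> real"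
  assumes r: "\<And>j. r j \<in> borel_measurable M" "\<And>j x. \<bar>r j x\<bar> \<le> 1"
    and orth: "\<And>i j. i \<noteq> j \<Longrightarrow> (\<integral>x. r i x * r j x \<partial>M) = 0" and nrm: "\<And>j. (\<integral>x. r j x * r j x \<partial>M) \<le> 1"
    and E: "E \<in> sets M"
  shows "(\<lambda>j. \<integral>x. indicator E x * r j x \<partial>M) \<longlonglongrightarrow> 0"
proof -
  define b where "b j = (\<integral>x. indicator E x * r j x \<partial>M)" for j
  have irr: "integrable M (\<lambda>x. r i x * r j x)" for i j
    using r by (intro bounded_integrable[of _ 1]) (auto simp: abs_mult intro: mult_le_one)
  have ier: "integrable M (\<lambda>x. indicator E x * r j x)" for j
    using r E by (intro bounded_integrable[of _ 1]) (auto simp: indicator_def)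
  have iE: "integrable M (\<lambda>x. indicator E x :: real)"
    using E by (intro bounded_integrable[of _ 1]) (auto simp: indicator_def)
  have "(\<Sum>j<n. b j * b j) \<le> measure M E" for n
  proof -
    have "0 \<le> (\<integral>x. (indicator E x - (\<Sum>j<n. b j * r j x)) * (indicator E x - (\<Sum>j<n. b j * r j x)) \<partial>M)"
      by (rule integral_nonneg_AE) simp
    also have "\<dots> = (\<integral>x. indicator E x - 2 * (\<Sum>j<n. b j * (indicator E x * r j x)) +
        (\<Sum>i<n. \<Sum>j<n. b i * b j * (r i x * r j x)) \<partial>M)"
    proof (rule Bochner_Integration.integral_cong[OF refl])
      fix x
      have "(\<Sum>j<n. b j * r j x) * (\<Sum>j<n. b j * r j x) = (\<Sum>i<n. \<Sum>j<n. b i * b j * (r i x * r j x))"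
        by (simp add: sum_product algebra_simps)
      moreover have "indicator E x * (\<Sum>j<n. b j * r j x) = (\<Sum>j<n. b j * (indicator E x * r j x))"
        by (simp add: sum_distrib_left algebra_simps)
      moreover have "(indicator E x :: real) * indicator E x = indicator E x" by (simp add: indicator_def)
      ultimately show "(indicator E x - (\<Sum>j<n. b j * r j x)) * (indicator E x - (\<Sum>j<n. b j * r j x)) =
        indicator E x - 2 * (\<Sum>j<n. b j * (indicator E x * r j x)) + (\<Sum>i<n. \<Sum>j<n. b i * b j * (r i x * r j x))"
        by (simp add: algebra_simps)
    qed
    also have "\<dots> = measure M E - 2 * (\<Sum>j<n. b j * b j) + (\<Sum>i<n. \<Sum>j<n. b i * b j * (\<integral>x. r i x * r j x \<partial>M))"
      using irr ier iE E by (simp add: b_def sets.Int_space_eq2)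
    also have "(\<Sum>i<n. \<Sum>j<n. b i * b j * (\<integral>x. r i x * r j x \<partial>M)) \<le> (\<Sum>i<n. b i * b i)"
    proof (rule sum_mono)
      fix i assume "i \<in> {..<n}"
      have "(\<Sum>j<n. b i * b j * (\<integral>x. r i x * r j x \<partial>M)) = (\<Sum>j\<in>{i}. b i * b j * (\<integral>x. r i x * r j x \<partial>M))"
        using \<open>i \<in> {..<n}\<close> orth by (intro sum.mono_neutral_right) auto
      also have "\<dots> \<le> b i * b i" using nrm[of i] by (simp add: mult_left_le)
      finally show "(\<Sum>j<n. b i * b j * (\<integral>x. r i x * r j x \<partial>M)) \<le> b i * b i" .
    qed
    finally show ?thesis by simp
  qed
  then have "summable (\<lambda>j. b j * b j)"
    by (intro summableI_nonneg_bounded[where x = "measure M E"]) auto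
  then have "(\<lambda>j. b j * b j) \<longlonglongrightarrow> 0" by (rule summable_LIMSEQ_zero)
  then have "(\<lambda>j. sqrt (b j * b j)) \<longlonglongrightarrow> sqrt 0" by (intro tendsto_real_sqrt)
  then have "(\<lambda>j. \<bar>b j\<bar>) \<longlonglongrightarrow> 0" by simp
  then show ?thesis unfolding b_def by (rule tendsto_rabs_zero_cancel)
qed

section \<open>From sign patterns of convex blocks to independent iterates\<close>

definition signs :: "nat \<Rightarrow> (nat \<Rightarrow> bool) set" where
  "signs n = PiE {..<n} (\<lambda>_. UNIV)"

lemma finite_signs: "finite (signs n)" and signs_ne: "signs n \<noteq> {}"
  unfolding signs_def by (auto intro!: finite_PiE simp: PiE_eq_empty_iff)

text \<open>Flipping one coordinate is an involution of the patterns. With summands that are signs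
  or products of two signs this gives the orthogonality relations of Rademacher functions.\<close>

lemma sum_signs_flip:
  fixes F :: "(nat \<Rightarrow> bool) \<Rightarrow> real"
  assumes "i < n" "\<And>\<sigma>. F (\<sigma>(i := \<not> \<sigma> i)) = - F \<sigma>"
  shows "(\<Sum>\<sigma>\<in>signs n. F \<sigma>) = 0"
proof -
  have "(\<Sum>\<sigma>\<in>signs n. F \<sigma>) = (\<Sum>\<sigma>\<in>signs n. F (\<sigma>(i := \<not> \<sigma> i)))"
    by (rule sum.reindex_bij_witness[where i = "\<lambda>\<sigma>. \<sigma>(i := \<not> \<sigma> i)" and j = "\<lambda>\<sigma>. \<sigma>(i := \<not> \<sigma> i)"])
      (use assms(1) in \<open>auto simp: signs_def PiE_iff extensional_def\<close>)
  also have "\<dots> = - (\<Sum>\<sigma>\<in>signs n. F \<sigma>)" by (simp add: assms(2) sum_negf)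
  finally show ?thesis by simp
qed

text \<open>The points realizing the sign patterns of the convex blocks carry a measure for which the
  signs are orthonormal; the correlation of a block with its sign is inherited by one of its
  terms.\<close>

theorem convex_blocks_independent:
  fixes f c :: "nat \<Rightarrow> ('a::metric_space \<Rightarrow>\<^sub>C real)"
  assumes comp: "compact (UNIV :: 'a set)" and C: "\<And>k. norm (f k) \<le> C"
    and blk: "\<And>i. c i \<in> convex hull (f ` {N i..<T i})" and NT: "\<And>i. T i \<le> N (Suc i)"
    and ab: "a < b" and pat: "\<And>n \<sigma>. \<exists>x. \<forall>i<n. if \<sigma> i then b \<le> apply_bcontfun (c i) x else apply_bcontfun (c i) x \<le> a"
  shows "\<exists>s \<kappa> g0. strict_mono (s :: nat \<Rightarrow> nat) \<and> 0 < \<kappa> \<and>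
    (\<forall>n \<sigma>. \<exists>x. \<forall>i<n. if \<sigma> i then g0 + \<kappa> \<le> apply_bcontfun (f (s i)) x else apply_bcontfun (f (s i)) x \<le> g0 - \<kappa>)"
proof -
  have "\<forall>n \<sigma>. \<exists>x. \<forall>i<n. if \<sigma> i then b \<le> apply_bcontfun (c i) x else apply_bcontfun (c i) x \<le> a" using pat by blast
  then obtain p where p: "\<forall>n \<sigma>. \<forall>i<n. if \<sigma> i then b \<le> apply_bcontfun (c i) (p n \<sigma>) else apply_bcontfun (c i) (p n \<sigma>) \<le> a"
    by metis
  have p1: "b \<le> apply_bcontfun (c i) (p n \<sigma>)" if "i < n" "\<sigma> i" for n i \<sigma> using p that by auto
  have p0: "apply_bcontfun (c i) (p n \<sigma>) \<le> a" if "i < n" "\<not> \<sigma> i" for n i \<sigma> using p that by auto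
  obtain m where m: "is_mean m" using ultrafilter_mean by auto
  \<comment> \<open>The uniform average over the points realizing all patterns of length
    \<open>n\<close>; a mean over \<open>n\<close> yields one positive functional, and by Riesz one
    measure, for which all signs are orthogonal at once.\<close>
  define av where "av f n = (\<Sum>\<sigma>\<in>signs n. f (p n \<sigma>)) / card (signs n)" for f :: "'a \<Rightarrow> real" and n
  have cardpos: "0 < real (card (signs n))" for n using finite_signs signs_ne by (simp add: card_gt_0_iff)
  have av_le: "av f n \<le> K" if "\<And>\<sigma>. f (p n \<sigma>) \<le> K" for f n K
    unfolding av_def using cardpos[of n] sum_bounded_above[of "signs n" "\<lambda>\<sigma>. f (p n \<sigma>)" K] that
    by (simp add: divide_le_eq mult.commute)
  have av_ge: "K \<le> av f n" if "\<And>\<sigma>. K \<le> f (p n \<sigma>)" for f n K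
    unfolding av_def using cardpos[of n] sum_bounded_below[of "signs n" K "\<lambda>\<sigma>. f (p n \<sigma>)"] that
    by (simp add: le_divide_eq mult.commute)
  have av_add: "av (\<lambda>x. f x + g x) n = av f n + av g n" and av_cm: "av (\<lambda>x. k * f x) n = k * av f n" for f g n k
    unfolding av_def by (simp_all add: sum.distrib add_divide_distrib sum_distrib_left)
  have bs: "bseq (av h)" if h: "continuous_on UNIV h" for h :: "'a \<Rightarrow> real"
  proof -
    obtain K where K: "\<And>x. \<bar>h x\<bar> \<le> K" by (rule compact_continuous_bounded[OF comp h]) blast
    have "\<bar>av h n\<bar> \<le> K" for n
    proof (rule abs_leI)
      have K': "h x \<le> K" "- K \<le> h x" for x using K[of x] by (auto simp: abs_le_iff)
      show "av h n \<le> K" by (rule av_le) (rule K')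
      have "- K \<le> av h n" by (rule av_ge) (rule K')
      then show "- av h n \<le> K" by simp
    qed
    then show ?thesis by (rule bseqI)
  qed
  have pf: "pos_functional (\<lambda>h. m (av h))"
    unfolding pos_functional_def
  proof (intro conjI allI impI)
    fix f g :: "'a \<Rightarrow> real" assume "continuous_on UNIV f" "continuous_on UNIV g"
    then have "m (\<lambda>n. av f n + av g n) = m (av f) + m (av g)" by (intro mean_add[OF m] bs)
    then show "m (av (\<lambda>x. f x + g x)) = m (av f) + m (av g)" by (simp add: av_add[abs_def])
  next
    fix k and f :: "'a \<Rightarrow> real" assume "continuous_on UNIV f"
    then have "m (\<lambda>n. k * av f n) = k * m (av f)" by (intro mean_cmult[OF m] bs)
    then show "m (av (\<lambda>x. k * f x)) = k * m (av f)" by (simp add: av_cm[abs_def])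
  next
    fix f :: "'a \<Rightarrow> real" assume "continuous_on UNIV f" "\<forall>x. 0 \<le> f x"
    then show "0 \<le> m (av f)" by (intro mean_nonneg[OF m] bs av_ge) auto
  qed
  obtain M where M: "finite_measure M \<and> sets M = sets borel \<and> (\<forall>h. continuous_on UNIV h \<longrightarrow> (\<integral>x. h x \<partial>M) = m (av h))"
    using riesz_representation[OF comp pf] by (rule exE)
  then interpret finite_measure M by simp
  have sM: "sets M = sets borel" and iM: "\<And>h. continuous_on UNIV h \<Longrightarrow> (\<integral>x. h x \<partial>M) = m (av h)" using M by auto
  \<comment> \<open>The relation for the \<open>i\<close>-th sign holds only for averages with
    \<open>n > i\<close>; a mean ignores the others.\<close>
  have iM_ev: "(\<integral>x. h x \<partial>M) = K" if "continuous_on UNIV h" "\<And>n. i < n \<Longrightarrow> av h n = K" for h K i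
  proof -
    have "m (av h) = m (\<lambda>n. K)"
      using that(2) by (intro mean_cong_ev[OF m bs[OF that(1)] bseq_const]) (auto simp: eventually_sequentially intro!: exI[of _ "Suc i"])
    then show ?thesis using iM[OF that(1)] mean_const[OF m] by simp
  qed
  \<comment> \<open>The truncated affine map sending \<open>a\<close> to -1 and \<open>b\<close> to
    1: continuous, hence known to the measure through \<open>av\<close>, and exactly the prescribed
    sign at the chosen points.\<close>
  define r where "r i x = max (- 1) (min 1 ((2 * apply_bcontfun (c i) x - a - b) / (b - a)))" for i x
  have rc: "continuous_on UNIV (r i)" for i
    unfolding r_def using ab by (intro continuous_intros) auto
  have r_abs: "\<bar>r i x\<bar> \<le> 1" for i x unfolding r_def by auto
  have r_sgn: "r i (p n \<sigma>) = (if \<sigma> i then 1 else - 1)" if "i < n" for i n \<sigma>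
  proof (cases "\<sigma> i")
    case True
    then show ?thesis using p1[of i n \<sigma>, OF that True] ab unfolding r_def by (simp add: field_simps min_def max_def)
  next
    case False
    then show ?thesis using p0[of i n \<sigma>, OF that False] ab unfolding r_def by (simp add: field_simps min_def max_def)
  qed
  have orth: "(\<integral>x. r i x * r j x \<partial>M) = 0" if "i \<noteq> j" for i j
  proof (rule iM_ev)
    show "continuous_on UNIV (\<lambda>x. r i x * r j x)" by (intro continuous_intros rc)
    fix n assume n: "max i j < n"
    then have "(\<Sum>\<sigma>\<in>signs n. r i (p n \<sigma>) * r j (p n \<sigma>)) = (\<Sum>\<sigma>\<in>signs n. (if \<sigma> i then 1 else - 1) * (if \<sigma> j then 1 else - 1))"
      by (intro sum.cong) (auto simp: r_sgn)
    also have "\<dots> = 0" using n \<open>i \<noteq> j\<close> by (intro sum_signs_flip[of i]) auto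
    finally show "av (\<lambda>x. r i x * r j x) n = 0" by (simp add: av_def)
  qed
  have av_r: "av (r i) n = 0" if "i < n" for i n
  proof -
    have "(\<Sum>\<sigma>\<in>signs n. r i (p n \<sigma>)) = (\<Sum>\<sigma>\<in>signs n. (if \<sigma> i then 1 else - 1))"
      using that by (intro sum.cong) (auto simp: r_sgn)
    also have "\<dots> = 0" using that by (intro sum_signs_flip[of i]) auto
    finally show ?thesis by (simp add: av_def)
  qed
  have nrm: "(\<integral>x. r j x * r j x \<partial>M) \<le> 1" for j
  proof -
    have c: "continuous_on UNIV (\<lambda>x. r j x * r j x)" by (intro continuous_intros rc)
    have "r j x * r j x \<le> 1" for x
      using r_abs[of j x] by (metis abs_mult_self_eq abs_ge_zero mult_le_one)
    then have "m (av (\<lambda>x. r j x * r j x)) \<le> 1" by (intro mean_le[OF m bs[OF c]] always_eventually allI av_le)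
    then show ?thesis using iM[OF c] by simp
  qed
  have rm: "r j \<in> borel_measurable M" for j by (rule borel_measurableI_continuous[OF sM rc])
  \<comment> \<open>Signs have average 0, so the midpoint \<open>(a + b) / 2\<close> may be
    subtracted from a block; the difference times its sign is then at least half the gap.\<close>
  define \<delta> where "\<delta> = (b - a) / 2"
  have \<delta>: "0 < \<delta>" using ab by (simp add: \<delta>_def)
  have corr: "\<delta> \<le> (\<integral>x. apply_bcontfun (c i) x * r i x \<partial>M)" for i
  proof -
    have cc: "continuous_on UNIV (\<lambda>x. apply_bcontfun (c i) x * r i x)" by (intro continuous_intros rc) auto
    have "\<delta> \<le> av (\<lambda>x. apply_bcontfun (c i) x * r i x) n" if "i < n" for n
    proof -
      have "\<delta> \<le> av (\<lambda>x. apply_bcontfun (c i) x * r i x + (- (a + b) / 2) * r i x) n"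
      proof (rule av_ge)
        fix \<sigma>
        show "\<delta> \<le> apply_bcontfun (c i) (p n \<sigma>) * r i (p n \<sigma>) + (- (a + b) / 2) * r i (p n \<sigma>)"
          using p1[of i n \<sigma>] p0[of i n \<sigma>] that by (auto simp: r_sgn \<delta>_def field_simps)
      qed
      then show ?thesis unfolding av_add av_cm using av_r[OF that] by simp
    qed
    then have "\<delta> \<le> m (av (\<lambda>x. apply_bcontfun (c i) x * r i x))"
      by (intro mean_ge[OF m bs[OF cc]]) (auto simp: eventually_sequentially intro!: exI[of _ "Suc i"])
    then show ?thesis using iM[OF cc] by simp
  qed
  have ifr: "integrable M (\<lambda>x. apply_bcontfun v x * r i x)" for v i
  proof (rule bounded_integrable[of _ "norm v"])
    show "(\<lambda>x. apply_bcontfun v x * r i x) \<in> borel_measurable M"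
      by (intro borel_measurableI_continuous[OF sM] continuous_intros rc) auto
    fix x
    have "\<bar>apply_bcontfun v x\<bar> * \<bar>r i x\<bar> \<le> norm v * 1"
      using abs_apply_le_norm[of v x] r_abs[of i x] by (intro mult_mono) auto
    then show "\<bar>apply_bcontfun v x * r i x\<bar> \<le> norm v" by (simp add: abs_mult)
  qed
  \<comment> \<open>The correlation with \<open>r i\<close> is linear, so if it were below
    \<open>\<delta>\<close> at all terms of the block, it would be so at the convex combination
    \<open>c i\<close>.\<close>
  have "\<exists>k\<in>{N i..<T i}. \<delta> \<le> (\<integral>x. apply_bcontfun (f k) x * r i x \<partial>M)" for i
  proof (rule ccontr)
    assume no: "\<not> ?thesis"
    define l where "l v = (\<integral>x. apply_bcontfun v x * r i x \<partial>M)" for v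
    have l: "linear l"
      unfolding l_def using ifr by (intro linearI) (simp_all add: distrib_right mult.assoc)
    have "convex hull (f ` {N i..<T i}) \<subseteq> l -` {..<\<delta>}"
      using no by (intro hull_minimal convex_linear_vimage l) (auto simp: l_def not_le)
    then have "l (c i) < \<delta>" using blk[of i] by auto
    then show False using corr[of i] by (simp add: l_def)
  qed
  then have "\<forall>i. \<exists>k. k \<in> {N i..<T i} \<and> \<delta> \<le> (\<integral>x. apply_bcontfun (f k) x * r i x \<partial>M)" by blast
  from choice[OF this] obtain k where k: "\<And>i. k i \<in> {N i..<T i}" "\<And>i. \<delta> \<le> (\<integral>x. apply_bcontfun (f (k i)) x * r i x \<partial>M)"
    by auto
  have kmono: "strict_mono k"
    unfolding strict_mono_Suc_iff
  proof
    fix i show "k i < k (Suc i)" using k(1)[of i] k(1)[of "Suc i"] NT[of i] by auto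
  qed
  have gm: "apply_bcontfun (f (k j)) \<in> borel_measurable M" for j by (intro borel_measurableI_continuous[OF sM]) auto
  have gC: "\<bar>apply_bcontfun (f (k j)) x\<bar> \<le> C" for j x using abs_apply_le_norm[of "f (k j)" x] C[of "k j"] by simp
  show ?thesis
  proof (rule independent_subsequence[OF gm gC rm r_abs bessel_tendsto_0[OF rm r_abs orth nrm] \<delta> k(2)])
    fix s :: "nat \<Rightarrow> nat" and \<kappa> g0
    assume s: "strict_mono s" "0 < \<kappa>" "\<And>n \<sigma>. \<exists>x. \<forall>i<n. if \<sigma> i then g0 + \<kappa> \<le> apply_bcontfun (f (k (s i))) x
      else apply_bcontfun (f (k (s i))) x \<le> g0 - \<kappa>"
    have "strict_mono (\<lambda>i. k (s i))" using kmono s(1) by (simp add: strict_mono_def)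
    then show ?thesis using s(2,3) by (intro exI[of _ "\<lambda>i. k (s i)"] exI[of _ \<kappa>] exI[of _ g0]) auto
  qed
qed

section \<open>Functions of the first Baire class\<close>

text \<open>Compactness gives total boundedness, and the balls of radius \<open>1 / Suc n\<close>
  around finite nets form a base. Countability is what keeps unions of F-sigma sets F-sigma.\<close>

lemma compact_metric_countable_base:
  assumes "compact (UNIV :: ('a::metric_space) set)"
  shows "\<exists>\<B> :: 'a set set. countable \<B> \<and> (\<forall>B\<in>\<B>. open B) \<and>
    (\<forall>U t. open U \<longrightarrow> t \<in> U \<longrightarrow> (\<exists>B\<in>\<B>. t \<in> B \<and> B \<subseteq> U))"
proof -
  have "\<exists>K. finite K \<and> (UNIV :: 'a set) \<subseteq> (\<Union>x\<in>K. ball x (1 / real (Suc n)))" for n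
    using seq_compact_imp_totally_bounded[OF compact_imp_seq_compact[OF assms]] by simp
  then obtain K :: "nat \<Rightarrow> 'a set" where K: "\<And>n. finite (K n)" "\<And>n. UNIV \<subseteq> (\<Union>x\<in>K n. ball x (1 / real (Suc n)))" by metis
  define \<B> where "\<B> = (\<Union>n. (\<lambda>x. ball x (1 / real (Suc n))) ` K n)"
  show ?thesis
  proof (intro exI[of _ \<B>] conjI ballI allI impI)
    show "countable \<B>" unfolding \<B>_def using K(1) by (intro countable_UN) (auto intro: countable_finite)
    show "open B" if "B \<in> \<B>" for B using that by (auto simp: \<B>_def)
    fix U and t :: 'a assume "open U" "t \<in> U"
    then obtain e where e: "0 < e" "ball t e \<subseteq> U" by (meson openE)
    then obtain n where n: "1 / real (Suc n) < e / 2" using nat_approx_posE[of "e / 2"] by auto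
    obtain x where x: "x \<in> K n" "t \<in> ball x (1 / real (Suc n))" using K(2)[of n] by blast
    have "ball x (1 / real (Suc n)) \<subseteq> ball t e"
    proof
      fix y assume "y \<in> ball x (1 / real (Suc n))"
      then have "dist t y < e"
        using x(2) n dist_triangle[of t y x] by (simp add: dist_commute)
      then show "y \<in> ball t e" by simp
    qed
    then show "\<exists>B\<in>\<B>. t \<in> B \<and> B \<subseteq> U" using x e(2) unfolding \<B>_def by blast
  qed
qed

abbreviation fsig :: "'a::metric_space set \<Rightarrow> bool" where
  "fsig \<equiv> fsigma_in euclidean"

lemma fsig_closed: "closed S \<Longrightarrow> fsig S"
  by (simp add: closed_imp_fsigma_in)

lemma fsig_open: assumes "open S" shows "fsig S"
proof -
  obtain F where "\<And>n::nat. closed (F n)" "incseq F" "(\<Union>n. F n) = S" by (rule open_Union_closed[OF assms]) blast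
  then show ?thesis unfolding fsigma_in_ascending by (auto simp: incseq_Suc_iff)
qed

lemma fsig_UN: "(\<And>i::nat. fsig (A i)) \<Longrightarrow> fsig (\<Union>i. A i)"
  by (rule fsigma_in_Union) auto

lemmas fsig_Int = fsigma_in_Int[of euclidean] and fsig_Un = fsigma_in_Un[of euclidean]

text \<open>The open sets on which such a \<open>D\<close> exists have a largest element, and it cannot miss a point.\<close>

lemma oscillation_separation:
  fixes f :: "'a::metric_space \<Rightarrow> real"
  assumes comp: "compact (UNIV :: 'a set)"
    and osc: "\<And>C. C \<noteq> {} \<Longrightarrow> \<exists>U. open U \<and> U \<inter> C \<noteq> {} \<and> ((\<forall>t\<in>U \<inter> C. a < f t) \<or> (\<forall>t\<in>U \<inter> C. f t < b))"
  shows "\<exists>D. fsig D \<and> fsig (- D) \<and> (\<forall>t. f t \<le> a \<longrightarrow> t \<in> D) \<and> (\<forall>t\<in>D. f t < b)"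
proof -
  define sep where "sep U D \<longleftrightarrow> fsig D \<and> fsig (U - D) \<and> D \<subseteq> U \<and> (\<forall>t\<in>U. f t \<le> a \<longrightarrow> t \<in> D) \<and> (\<forall>t\<in>D. f t < b)" for U D
  obtain \<B> :: "'a set set" where \<B>: "countable \<B>" "\<And>B. B \<in> \<B> \<Longrightarrow> open B"
    "\<And>U t. open U \<Longrightarrow> t \<in> U \<Longrightarrow> \<exists>B\<in>\<B>. t \<in> B \<and> B \<subseteq> U"
    using compact_metric_countable_base[OF comp] by blast
  define \<S> where "\<S> = insert {} {B\<in>\<B>. \<exists>D. sep B D}"
  have "sep {} {}" by (simp add: sep_def)
  then have \<S>: "open B \<and> (\<exists>D. sep B D)" if "B \<in> \<S>" for B using that \<B>(2) by (auto simp: \<S>_def)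
  define B where "B = from_nat_into \<S>"
  have "\<S> \<subseteq> insert {} \<B>" by (auto simp: \<S>_def)
  moreover have "countable (insert {} \<B>)" using \<B>(1) by simp
  ultimately have "countable \<S>" by (rule countable_subset)
  then have rB: "range B = \<S>" unfolding B_def by (intro range_from_nat_into) (simp_all add: \<S>_def)
  have BS: "B i \<in> \<S>" for i unfolding rB[symmetric] by simp
  have oB: "open (B i)" for i :: nat using \<S>[OF BS] by simp
  have "\<forall>i. \<exists>D. sep (B i) D" using \<S>[OF BS] by simp
  from choice[OF this] obtain D where D: "\<And>i. sep (B i) (D i)" by blast
  define W where "W = (\<Union>i. B i)"
  \<comment> \<open>Each point of \<open>W\<close> follows the separating set of the first
    \<open>B i\<close> that contains it; this keeps both \<open>E\<close> and \<open>W - E\<close>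
    countable unions of F-sigma sets.\<close>
  define E where "E = (\<Union>i. D i - (\<Union>j<i. B j))"
  have cl: "closed (- (\<Union>j<i. B j))" for i using oB by auto
  have oW: "open W" using oB by (auto simp: W_def)
  have sepW: "sep W E"
    unfolding sep_def
  proof (intro conjI ballI impI)
    have "fsig (D i \<inter> - (\<Union>j<i. B j))" for i
      using D[of i] by (intro fsig_Int[OF _ fsig_closed[OF cl]]) (simp add: sep_def)
    then show "fsig E" unfolding E_def Diff_eq by (rule fsig_UN)
    have 1: "W - E = (\<Union>i. (B i - D i) \<inter> - (\<Union>j<i. B j))"
    proof (rule set_eqI)
      fix t
      show "t \<in> W - E \<longleftrightarrow> t \<in> (\<Union>i. (B i - D i) \<inter> - (\<Union>j<i. B j))"
      proof
        assume t: "t \<in> W - E"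
        define i where "i = (LEAST i. t \<in> B i)"
        have i: "t \<in> B i" using t unfolding i_def W_def by (auto intro: LeastI)
        have "t \<notin> B j" if "j < i" for j using not_less_Least[of j "\<lambda>i. t \<in> B i"] that by (simp add: i_def)
        then show "t \<in> (\<Union>i. (B i - D i) \<inter> - (\<Union>j<i. B j))" using i t unfolding E_def by blast
      next
        assume "t \<in> (\<Union>i. (B i - D i) \<inter> - (\<Union>j<i. B j))"
        then obtain i where i: "t \<in> B i" "t \<notin> D i" "\<And>j. j < i \<Longrightarrow> t \<notin> B j" by auto
        have "t \<notin> D j - (\<Union>l<j. B l)" for j
        proof (cases j i rule: linorder_cases)
          case less
          then show ?thesis using i(3) D[of j] by (auto simp: sep_def)
        qed (use i in auto)
        then show "t \<in> W - E" using i(1) by (auto simp: W_def E_def)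
      qed
    qed
    have "fsig ((B i - D i) \<inter> - (\<Union>j<i. B j))" for i
      using D[of i] by (intro fsig_Int[OF _ fsig_closed[OF cl]]) (simp add: sep_def)
    then show "fsig (W - E)" unfolding 1 by (rule fsig_UN)
    show "E \<subseteq> W" using D unfolding E_def W_def sep_def by blast
    show "f t < b" if "t \<in> E" for t using that D unfolding E_def sep_def by blast
    fix t assume t: "t \<in> W" "f t \<le> a"
    show "t \<in> E"
    proof (rule ccontr)
      assume "t \<notin> E"
      then obtain i where "t \<in> B i" "t \<notin> D i" using t 1 by blast
      then show False using D[of i] t(2) by (auto simp: sep_def)
    qed
  qed
  have "W = UNIV"
  proof (rule ccontr)
    assume "W \<noteq> UNIV"
    then have "- W \<noteq> {}" by auto
    \<comment> \<open>On a basic set \<open>V\<close> inside this \<open>U\<close>, the old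
      separation is kept in \<open>W\<close>, and the part outside \<open>W\<close> goes entirely to
      one side, which the one-sided bound permits. So \<open>V\<close> is itself one of the sets
      united in \<open>W\<close>, although it contains \<open>t\<close>.\<close>
    from osc[OF this] obtain U where U: "open U" "U \<inter> - W \<noteq> {}"
      "(\<forall>t\<in>U \<inter> - W. a < f t) \<or> (\<forall>t\<in>U \<inter> - W. f t < b)" by auto
    then obtain t where t: "t \<in> U" "t \<notin> W" by auto
    obtain V where V: "V \<in> \<B>" "t \<in> V" "V \<subseteq> U" using \<B>(3)[OF U(1) t(1)] by blast
    have fV: "fsig V" "fsig (V \<inter> - W)" "fsig W" "fsig E" "fsig (W - E)"
      using fsig_open[OF \<B>(2)[OF V(1)]] fsig_open[OF oW] sepW fsig_closed[of "- W"] oW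
      by (auto intro!: fsig_Int simp: sep_def)
    have "\<exists>D. sep V D"
      using U(3)
    proof
      assume *: "\<forall>t\<in>U \<inter> - W. a < f t"
      have eq: "V - V \<inter> E = (V \<inter> - W) \<union> (V \<inter> (W - E))" using sepW by (auto simp: sep_def)
      have "fsig (V \<inter> E)" "fsig (V - V \<inter> E)" unfolding eq by (intro fsig_Int fsig_Un fV)+
      moreover have "t \<in> V \<inter> E" if "t \<in> V" "f t \<le> a" for t
        using that * V(3) sepW by (cases "t \<in> W") (auto simp: sep_def not_less[symmetric])
      ultimately have "sep V (V \<inter> E)" using sepW unfolding sep_def by simp
      then show ?thesis by blast
    next
      assume *: "\<forall>t\<in>U \<inter> - W. f t < b"
      have eq: "V - ((V \<inter> E) \<union> (V \<inter> - W)) = V \<inter> (W - E)" by auto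
      have "fsig ((V \<inter> E) \<union> (V \<inter> - W))" "fsig (V - ((V \<inter> E) \<union> (V \<inter> - W)))" unfolding eq by (intro fsig_Int fsig_Un fV)+
      moreover have "t \<in> (V \<inter> E) \<union> (V \<inter> - W)" if "t \<in> V" "f t \<le> a" for t
        using that sepW by (auto simp: sep_def)
      moreover have "f t < b" if "t \<in> (V \<inter> E) \<union> (V \<inter> - W)" for t
        using that * V(3) sepW by (auto simp: sep_def)
      ultimately have "sep V ((V \<inter> E) \<union> (V \<inter> - W))" unfolding sep_def by simp
      then show ?thesis by blast
    qed
    then have "V \<in> \<S>" using V(1) by (auto simp: \<S>_def)
    then have "V \<subseteq> W" using rB by (auto simp: W_def)
    then show False using V(2) t(2) by auto
  qed
  then show ?thesis using sepW by (auto simp: sep_def Compl_eq_Diff_UNIV intro!: exI[of _ E])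
qed

text \<open>Exhausting \<open>D\<close> and its complement by increasing closed sets, the
  \<open>n\<close>-th stages are disjoint and a Urysohn function separates them; at each point these
  functions are eventually constant.\<close>

lemma indicator_baire1:
  fixes D :: "'a::metric_space set"
  assumes "fsig D" "fsig (- D)"
  shows "\<exists>g :: nat \<Rightarrow> 'a \<Rightarrow> real. (\<forall>n. continuous_on UNIV (g n)) \<and> (\<forall>t. (\<lambda>n. g n t) \<longlonglongrightarrow> indicator D t)"
proof -
  obtain F where F: "\<And>n::nat. closed (F n)" "\<And>n. F n \<subseteq> F (Suc n)" "(\<Union>n. F n) = D"
    using assms(1) unfolding fsigma_in_ascending by auto
  obtain G where G: "\<And>n::nat. closed (G n)" "\<And>n. G n \<subseteq> G (Suc n)" "(\<Union>n. G n) = - D"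
    using assms(2) unfolding fsigma_in_ascending by auto
  have "F n \<inter> G n = {}" for n using F(3) G(3) by blast
  then have "\<forall>n. \<exists>g :: 'a \<Rightarrow> real. continuous_on UNIV g \<and> (\<forall>x\<in>F n. g x = 1) \<and> (\<forall>x\<in>G n. g x = 0)"
    using urysohn_metric[OF F(1) G(1)] by metis
  from choice[OF this] obtain g :: "nat \<Rightarrow> 'a \<Rightarrow> real" where g: "\<And>n. continuous_on UNIV (g n)"
    "\<And>n x. x \<in> F n \<Longrightarrow> g n x = 1" "\<And>n x. x \<in> G n \<Longrightarrow> g n x = 0" by auto
  have mono: "F n \<subseteq> F k" "G n \<subseteq> G k" if "n \<le> k" for n k
    using lift_Suc_mono_le[of F n k] lift_Suc_mono_le[of G n k] F(2) G(2) that by auto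
  have "(\<lambda>n. g n t) \<longlonglongrightarrow> indicator D t" for t
  proof (rule tendsto_eventually)
    show "\<forall>\<^sub>F n in sequentially. g n t = indicator D t"
    proof (cases "t \<in> D")
      case True
      then obtain N where "t \<in> F N" using F(3) by blast
      then show ?thesis unfolding eventually_sequentially using mono(1)[of N] g(2) True by (intro exI[of _ N]) auto
    next
      case False
      then obtain N where "t \<in> G N" using G(3) by blast
      then show ?thesis unfolding eventually_sequentially using mono(2)[of N] g(3) False by (intro exI[of _ N]) auto
    qed
  qed
  then show ?thesis using g(1) by blast
qed

section \<open>Constructing limits of continuous functions\<close>

definition baire1 :: "('a::metric_space \<Rightarrow> real) \<Rightarrow> bool" where
  "baire1 f \<longleftrightarrow> (\<exists>g. (\<forall>n::nat. continuous_on UNIV (g n)) \<and> (\<forall>t. (\<lambda>n. g n t) \<longlonglongrightarrow> f t))"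

lemma baire1_indicator_combination:
  fixes D :: "nat \<Rightarrow> 'a::metric_space set"
  assumes "\<And>i. i < N \<Longrightarrow> fsig (D i) \<and> fsig (- D i)"
  shows "baire1 (\<lambda>t. c + e * (\<Sum>i<N. indicator (- D i) t))"
proof -
  have "\<forall>i. \<exists>g :: nat \<Rightarrow> 'a \<Rightarrow> real. i < N \<longrightarrow> (\<forall>n. continuous_on UNIV (g n)) \<and> (\<forall>t. (\<lambda>n. g n t) \<longlonglongrightarrow> indicator (- D i) t)"
    using indicator_baire1[of "- D i" for i] assms by (metis double_compl)
  from choice[OF this] obtain g :: "nat \<Rightarrow> nat \<Rightarrow> 'a \<Rightarrow> real" where
    g: "\<And>i n. i < N \<Longrightarrow> continuous_on UNIV (g i n)" "\<And>i t. i < N \<Longrightarrow> (\<lambda>n. g i n t) \<longlonglongrightarrow> indicator (- D i) t" by blast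
  show ?thesis
    unfolding baire1_def
  proof (intro exI[of _ "\<lambda>n t. c + e * (\<Sum>i<N. g i n t)"] conjI allI)
    show "continuous_on UNIV (\<lambda>t. c + e * (\<Sum>i<N. g i n t))" for n using g(1) by (intro continuous_intros) auto
    show "(\<lambda>n. c + e * (\<Sum>i<N. g i n t)) \<longlonglongrightarrow> c + e * (\<Sum>i<N. indicator (- D i) t)" for t
      using g(2) by (intro tendsto_intros) auto
  qed
qed

text \<open>The limit is telescoped and a diagonal is taken. Truncation makes the continuous
  approximants of the \<open>k\<close>-th difference summable uniformly in \<open>n\<close>, so that
  limit and sum may be interchanged.\<close>

lemma baire1_uniform_limit:
  fixes f :: "'a::metric_space \<Rightarrow> real"
  assumes s: "\<And>k::nat. baire1 (s k)" and close: "\<And>k t. \<bar>s k t - f t\<bar> \<le> (1/2) ^ k"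
  shows "baire1 f"
proof -
  have "\<forall>k. \<exists>g. (\<forall>n::nat. continuous_on UNIV (g n)) \<and> (\<forall>t. (\<lambda>n. g n t) \<longlonglongrightarrow> s k t)" using s unfolding baire1_def by blast
  from choice[OF this] obtain g where g: "\<And>k n::nat. continuous_on UNIV (g k n)" "\<And>k t. (\<lambda>n. g k n t) \<longlonglongrightarrow> s k t" by blast
  \<comment> \<open>Consecutive functions differ by at most
    \<open>(1/2) ^ Suc k + (1/2) ^ k\<close>, which is below this bound, so truncating at
    \<open>M k\<close> does not alter the limits.\<close>
  define M where "M k = 2 * (1/2 :: real) ^ k" for k :: nat
  have M: "summable M" "0 \<le> M k" for k unfolding M_def by (auto intro!: summable_mult summable_geometric)
  define h where "h k n t = max (- M k) (min (M k) (g (Suc k) n t - g k n t))" for k n t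
  define d where "d k t = s (Suc k) t - s k t" for k t
  have d: "\<bar>d k t\<bar> \<le> M k" for k t
  proof -
    have "\<bar>d k t\<bar> \<le> \<bar>s (Suc k) t - f t\<bar> + \<bar>s k t - f t\<bar>" unfolding d_def by linarith
    also have "\<dots> \<le> (1/2) ^ Suc k + (1/2) ^ k" using close by (intro add_mono)
    also have "\<dots> \<le> M k" by (simp add: M_def)
    finally show ?thesis .
  qed
  have hM: "\<bar>h k n t\<bar> \<le> M k" for k n t unfolding h_def using M(2)[of k] by auto
  have hlim: "(\<lambda>n. if k < n then h k n t else 0) \<longlonglongrightarrow> d k t" for k t
  proof -
    have "(\<lambda>n. h k n t) \<longlonglongrightarrow> max (- M k) (min (M k) (s (Suc k) t - s k t))"
      unfolding h_def by (intro tendsto_intros g)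
    moreover have "max (- M k) (min (M k) (s (Suc k) t - s k t)) = d k t"
      using d[of k t] unfolding d_def by auto
    moreover have "\<forall>\<^sub>F n in sequentially. h k n t = (if k < n then h k n t else 0)"
      unfolding eventually_sequentially by (intro exI[of _ "Suc k"]) auto
    ultimately show ?thesis by (simp add: tendsto_cong)
  qed
  have sum_eq: "(\<Sum>k. if k < n then h k n t else 0) = (\<Sum>k<n. h k n t)" for n t
    by (subst suminf_finite[of "{..<n}"]) auto
  have lim: "(\<lambda>n. g 0 n t + (\<Sum>k<n. h k n t)) \<longlonglongrightarrow> f t" for t
  proof -
    have "(\<lambda>n. \<Sum>k. if k < n then h k n t else 0) \<longlonglongrightarrow> (\<Sum>k. d k t)"
    proof -
      have "\<forall>\<^sub>F (k, n) in sequentially \<times>\<^sub>F sequentially. norm (if k < n then h k n t else 0) \<le> M k"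
        using hM M(2) by (auto intro!: always_eventually)
      from tannerys_theorem[OF hlim this M(1)] show ?thesis by simp
    qed
    moreover have "(\<lambda>k. s k t) \<longlonglongrightarrow> f t"
    proof (rule LIM_zero_cancel, rule Lim_null_comparison)
      show "\<forall>\<^sub>F k in sequentially. norm (s k t - f t) \<le> (1/2) ^ k" using close by simp
      show "(\<lambda>k. (1/2 :: real) ^ k) \<longlonglongrightarrow> 0" by (rule LIMSEQ_power_zero) simp
    qed
    then have "(\<lambda>k. d k t) sums (f t - s 0 t)" unfolding d_def by (rule telescope_sums)
    then have "(\<Sum>k. d k t) = f t - s 0 t" by (simp add: sums_iff)
    ultimately have "(\<lambda>n. \<Sum>k<n. h k n t) \<longlonglongrightarrow> f t - s 0 t" by (simp add: sum_eq)
    from tendsto_add[OF g(2)[of 0 t] this] show ?thesis by simp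
  qed
  show ?thesis
    unfolding baire1_def
  proof (intro exI[of _ "\<lambda>n t. g 0 n t + (\<Sum>k<n. h k n t)"] conjI allI)
    show "continuous_on UNIV (\<lambda>t. g 0 n t + (\<Sum>k<n. h k n t))" for n
      unfolding h_def by (intro continuous_intros g)
  qed (rule lim)
qed

text \<open>The sets \<open>D i\<close> separate \<open>f\<close> at equidistant levels with step
  \<open>e\<close>. Counting the \<open>D i\<close> that a point avoids determines its value up to
  \<open>e\<close>, so \<open>f\<close> is a uniform limit of such step functions.\<close>

theorem baire1I:
  fixes f :: "'a::metric_space \<Rightarrow> real"
  assumes comp: "compact (UNIV :: 'a set)" and K: "\<And>t. \<bar>f t\<bar> \<le> K"
    and osc: "\<And>a b C. a < b \<Longrightarrow> C \<noteq> {} \<Longrightarrow>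
      \<exists>U. open U \<and> U \<inter> C \<noteq> {} \<and> ((\<forall>t\<in>U \<inter> C. a < f t) \<or> (\<forall>t\<in>U \<inter> C. f t < b))"
  shows "baire1 f"
proof -
  have "\<exists>s. baire1 s \<and> (\<forall>t. \<bar>s t - f t\<bar> \<le> e)" if e: "0 < e" for e
  proof -
    obtain N :: nat where N: "2 * K / e \<le> real N" using real_arch_simple by blast
    define lev where "lev i = - K + real i * e" for i
    have "\<exists>D. fsig D \<and> fsig (- D) \<and> (\<forall>t. f t \<le> lev i \<longrightarrow> t \<in> D) \<and> (\<forall>t\<in>D. f t < lev (Suc i))" for i
      using e by (intro oscillation_separation[OF comp] osc) (auto simp: lev_def field_simps)
    then have "\<forall>i. \<exists>D. fsig D \<and> fsig (- D) \<and> (\<forall>t. f t \<le> lev i \<longrightarrow> t \<in> D) \<and> (\<forall>t\<in>D. f t < lev (Suc i))" by blast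
    from choice[OF this] obtain D where D: "\<And>i. fsig (D i) \<and> fsig (- D i)"
      "\<And>i t. f t \<le> lev i \<Longrightarrow> t \<in> D i" "\<And>i t. t \<in> D i \<Longrightarrow> f t < lev (Suc i)" by blast
    define s where "s t = - K + e * (\<Sum>i<N. indicator (- D i) t)" for t
    have "baire1 s" unfolding s_def using D(1) by (rule baire1_indicator_combination)
    moreover have "\<bar>s t - f t\<bar> \<le> e" for t
    proof -
      define y where "y = (f t + K) / e"
      have y: "0 \<le> y" "y \<le> real N" "f t = - K + e * y"
      proof -
        show "0 \<le> y" "f t = - K + e * y" using K[of t] e by (auto simp: y_def abs_le_iff)
        have "y \<le> 2 * K / e" unfolding y_def using K[of t] e by (intro divide_right_mono) auto
        then show "y \<le> real N" using N by simp
      qed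
      have lo: "of_bool (real i + 1 \<le> y) \<le> (indicator (- D i) t :: real)" for i
      proof (cases "t \<in> D i")
        case True
        then have "e * y < e * (real i + 1)" using D(3)[of t i] y(3) by (simp add: lev_def algebra_simps)
        then show ?thesis using e by simp
      qed simp
      have hi: "(indicator (- D i) t :: real) \<le> of_bool (real i < y)" for i
      proof (cases "t \<in> D i")
        case False
        then have "lev i < f t" using D(2)[of t i] by (meson not_le)
        then have "e * real i < e * y" using y(3) by (simp add: lev_def mult.commute)
        then show ?thesis using e by simp
      qed simp
      have "y \<le> 1 + (\<Sum>i<N. of_bool (real i + 1 \<le> y))" using count_levels(1)[of y N] y by simp
      also have "\<dots> \<le> 1 + (\<Sum>i<N. indicator (- D i) t)" using lo by (intro add_left_mono sum_mono) auto
      finally have 1: "y \<le> 1 + (\<Sum>i<N. indicator (- D i) t)" .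
      have "(\<Sum>i<N. indicator (- D i) t) \<le> (\<Sum>i<N. of_bool (real i < y) :: real)" using hi by (intro sum_mono) auto
      also have "\<dots> \<le> y + 1" using count_levels(2)[where y = y and m = N] y by simp
      finally have 2: "(\<Sum>i<N. indicator (- D i) t) \<le> y + 1" .
      have "\<bar>(\<Sum>i<N. indicator (- D i) t) - y\<bar> \<le> 1" using 1 2 by linarith
      then have "e * \<bar>(\<Sum>i<N. indicator (- D i) t) - y\<bar> \<le> e * 1" using e by (intro mult_left_mono) auto
      then have "\<bar>e * ((\<Sum>i<N. indicator (- D i) t) - y)\<bar> \<le> e" using e by (simp add: abs_mult)
      then show ?thesis unfolding s_def y(3) by (simp add: algebra_simps)
    qed
    ultimately show ?thesis by blast
  qed
  then have "\<forall>k::nat. \<exists>s. baire1 s \<and> (\<forall>t. \<bar>s t - f t\<bar> \<le> (1/2) ^ k)" by simp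
  from choice[OF this] obtain s where "\<And>k. baire1 (s k)" "\<And>k t. \<bar>s k t - f t\<bar> \<le> (1/2) ^ k" by blast
  then show ?thesis by (rule baire1_uniform_limit)
qed

text \<open>Truncation keeps the approximants within the bound of \<open>f\<close>, as bounded
  convergence requires.\<close>

lemma baire1_bounded:
  fixes f :: "'a::metric_space \<Rightarrow> real"
  assumes "baire1 f" and K: "\<And>t. \<bar>f t\<bar> \<le> K"
  shows "\<exists>g. (\<forall>n::nat. continuous_on UNIV (g n)) \<and> (\<forall>n t. \<bar>g n t\<bar> \<le> K) \<and> (\<forall>t. (\<lambda>n. g n t) \<longlonglongrightarrow> f t)"
proof -
  obtain g where g: "\<And>n::nat. continuous_on UNIV (g n)" "\<And>t. (\<lambda>n. g n t) \<longlonglongrightarrow> f t"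
    using assms(1) unfolding baire1_def by blast
  have "0 \<le> K" using K abs_ge_zero order_trans by blast
  show ?thesis
  proof (intro exI[of _ "\<lambda>n t. max (- K) (min K (g n t))"] conjI allI)
    show "continuous_on UNIV (\<lambda>t. max (- K) (min K (g n t)))" for n by (intro continuous_intros g)
    show "\<bar>max (- K) (min K (g n t))\<bar> \<le> K" for n t using \<open>0 \<le> K\<close> by auto
    show "(\<lambda>n. max (- K) (min K (g n t))) \<longlonglongrightarrow> f t" for t
    proof -
      have "(\<lambda>n. max (- K) (min K (g n t))) \<longlonglongrightarrow> max (- K) (min K (f t))" by (intro tendsto_intros g)
      moreover have "max (- K) (min K (f t)) = f t" using K[of t] by auto
      ultimately show ?thesis by simp
    qed
  qed
qed

lemma baire1_borel_measurable:
  assumes "baire1 f" "sets M = sets borel" shows "f \<in> borel_measurable M"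
proof -
  obtain g where g: "\<And>n::nat. continuous_on UNIV (g n)" "\<And>t. (\<lambda>n. g n t) \<longlonglongrightarrow> f t"
    using assms(1) unfolding baire1_def by blast
  show ?thesis
    by (rule borel_measurable_LIMSEQ_real[OF g(2) borel_measurableI_continuous[OF assms(2) g(1)]])
qed

section \<open>Tame systems\<close>

lemma apply_koopman:
  fixes \<phi> :: "'a::metric_space \<Rightarrow> 'a"
  assumes \<phi>: "continuous_on UNIV \<phi>"
  shows "apply_bcontfun (blinfun_apply (koopman \<phi>) x) t = apply_bcontfun x (\<phi> t)"
proof -
  have bc: "apply_bcontfun (Bcontfun (apply_bcontfun x \<circ> \<phi>)) = apply_bcontfun x \<circ> \<phi>" for x :: "'a \<Rightarrow>\<^sub>C real"
  proof (rule Bcontfun_inverse)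
    have "continuous_on UNIV (apply_bcontfun x \<circ> \<phi>)" using \<phi> by (intro continuous_on_compose) auto
    moreover have "bounded (range (apply_bcontfun x \<circ> \<phi>))"
      by (rule bounded_subset[of "range (apply_bcontfun x)"]) auto
    ultimately show "apply_bcontfun x \<circ> \<phi> \<in> bcontfun" by (simp add: bcontfun_def)
  qed
  define K where "K x = Bcontfun (apply_bcontfun x \<circ> \<phi>)" for x :: "'a \<Rightarrow>\<^sub>C real"
  have K: "apply_bcontfun (K x) t = apply_bcontfun x (\<phi> t)" for x t unfolding K_def bc by simp
  have "bounded_linear K"
  proof (rule bounded_linear_intro[where K = 1])
    show "K (x + y) = K x + K y" for x y by (rule bcontfun_eqI) (simp add: K)
    show "K (c *\<^sub>R x) = c *\<^sub>R K x" for c x by (rule bcontfun_eqI) (simp add: K)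
    show "norm (K x) \<le> norm x * 1" for x
      using norm_bound[of "K x" "norm x"] abs_apply_le_norm[of x] by (simp add: K)
  qed
  then have "blinfun_apply (koopman \<phi>) x = K x"
    unfolding koopman_def K_def[abs_def, symmetric] by (rule bounded_linear_Blinfun_apply[THEN fun_cong])
  then show ?thesis by (simp add: K)
qed

lemma opow_0: "opow T 0 = id_blinfun" and opow_Suc: "opow T (Suc k) = T o\<^sub>L opow T k"
  by (simp_all add: opow_def)

lemma apply_opow_koopman:
  fixes \<phi> :: "'a::metric_space \<Rightarrow> 'a"
  assumes \<phi>: "continuous_on UNIV \<phi>"
  shows "apply_bcontfun (blinfun_apply (opow (koopman \<phi>) k) x) t = apply_bcontfun x ((\<phi> ^^ k) t)"
  by (induction k arbitrary: t) (simp_all add: opow_0 opow_Suc apply_koopman[OF \<phi>] funpow_swap1)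

lemma apply_bcontfun_sum: "apply_bcontfun (\<Sum>i\<in>I. f i) t = (\<Sum>i\<in>I. apply_bcontfun (f i) t)"
  for f :: "_ \<Rightarrow> 'a::topological_space \<Rightarrow>\<^sub>C real"
  by (induction I rule: infinite_finite_induct) simp_all

lemma linear_eval: "linear (\<lambda>v :: 'a::topological_space \<Rightarrow>\<^sub>C real. apply_bcontfun v t)"
  by (rule linearI) simp_all

text \<open>A convex combination uses finitely many indices. The bound \<open>T\<close> tells where
  the next block may start, which keeps the blocks disjoint.\<close>

lemma convex_hull_tail:
  fixes f :: "nat \<Rightarrow> 'v::real_vector"
  assumes "v \<in> convex hull (f ` {N..})"
  shows "\<exists>T. v \<in> convex hull (f ` {N..<T})"
proof -
  define S where "S = (\<Union>T. convex hull (f ` {N..<T}))"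
  have mono: "convex hull (f ` {N..<T}) \<subseteq> convex hull (f ` {N..<T'})" if "T \<le> T'" for T T'
    using that by (intro hull_mono image_mono) auto
  have "convex S"
  proof (rule convexI)
    fix x y and u w :: real assume "x \<in> S" "y \<in> S" and uw: "0 \<le> u" "0 \<le> w" "u + w = 1"
    then obtain T T' where "x \<in> convex hull (f ` {N..<T})" "y \<in> convex hull (f ` {N..<T'})" by (auto simp: S_def)
    then have "x \<in> convex hull (f ` {N..<max T T'})" "y \<in> convex hull (f ` {N..<max T T'})"
      using mono[of T "max T T'"] mono[of T' "max T T'"] by auto
    then have "u *\<^sub>R x + w *\<^sub>R y \<in> convex hull (f ` {N..<max T T'})"
      using uw by (intro convexD[OF convex_convex_hull])
    then show "u *\<^sub>R x + w *\<^sub>R y \<in> S" by (auto simp: S_def)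
  qed
  moreover have "f ` {N..} \<subseteq> S"
  proof
    fix y assume "y \<in> f ` {N..}"
    then obtain k where "y = f k" "N \<le> k" by auto
    then have "y \<in> convex hull (f ` {N..<Suc k})" by (intro hull_inc) auto
    then show "y \<in> S" by (auto simp: S_def)
  qed
  ultimately have "convex hull (f ` {N..}) \<subseteq> S" by (intro hull_minimal)
  then show ?thesis using assms by (auto simp: S_def)
qed

section \<open>Orbits, and the exclusion of independent iterates\<close>

locale compact_system =
  fixes \<phi> :: "'a::metric_space \<Rightarrow> 'a"
  assumes comp: "compact (UNIV :: 'a set)" and cont: "continuous_on UNIV \<phi>"
begin

definition orbit :: "('a \<Rightarrow>\<^sub>C real) \<Rightarrow> nat \<Rightarrow> ('a \<Rightarrow>\<^sub>C real)" where
  "orbit x k = blinfun_apply (opow (koopman \<phi>) k) x"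

lemma apply_orbit [simp]: "apply_bcontfun (orbit x k) t = apply_bcontfun x ((\<phi> ^^ k) t)"
  by (simp add: orbit_def apply_opow_koopman[OF cont])

lemma norm_orbit: "norm (orbit x k) \<le> norm x"
  by (rule norm_bound) (simp add: abs_apply_le_norm)

definition orbit_mean :: "((nat \<Rightarrow> real) \<Rightarrow> real) \<Rightarrow> ('a \<Rightarrow>\<^sub>C real) \<Rightarrow> 'a \<Rightarrow> real" where
  "orbit_mean m x t = m (\<lambda>k. apply_bcontfun x ((\<phi> ^^ k) t))"

lemma bseq_orbit: "bseq (\<lambda>k. apply_bcontfun x ((\<phi> ^^ k) t))"
  using abs_apply_le_norm[of x] by (rule bseqI)

lemma abs_orbit_mean_le: "is_mean m \<Longrightarrow> \<bar>orbit_mean m x t\<bar> \<le> norm x"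
  unfolding orbit_mean_def by (rule mean_abs_bound) (auto intro: abs_apply_le_norm)

end

locale tame_system = compact_system +
  assumes tame: "tame \<phi>"
begin

text \<open>For coefficients \<open>a\<close> with absolute sum 1, one point has large values
  exactly at the positive coefficients and another exactly at the remaining ones. The values of the
  combination at the two points differ by at least \<open>2 * \<kappa>\<close>, the constant
  \<open>g0\<close> cancelling, so its norm is at least \<open>\<kappa>\<close>.\<close>

lemma tame_no_independent_subsequence:
  assumes s: "strict_mono (s :: nat \<Rightarrow> nat)" and \<kappa>: "0 < \<kappa>"
    and pat: "\<And>n \<sigma>. \<exists>t. \<forall>i<n. if \<sigma> i then g0 + \<kappa> \<le> apply_bcontfun (orbit x (s i)) t
      else apply_bcontfun (orbit x (s i)) t \<le> g0 - \<kappa>"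
  shows False
proof -
  define A where "A = {a::nat \<Rightarrow> real. finite {k. a k \<noteq> 0} \<and> (\<Sum>k\<in>{k. a k \<noteq> 0}. \<bar>a k\<bar>) = 1}"
  define l where "l a = norm (\<Sum>k\<in>{k. a k \<noteq> 0}. a k *\<^sub>R orbit x (s k))" for a :: "nat \<Rightarrow> real"
  have inf0: "(INF a\<in>A. l a) = 0"
    using tame s unfolding tame_def A_def l_def orbit_def by blast
  have A1: "(\<lambda>k. if k = 0 then 1 else 0) \<in> A"
  proof -
    have "{k. (if k = 0 then 1 else 0 :: real) \<noteq> 0} = {0 :: nat}" by auto
    then show ?thesis by (simp add: A_def)
  qed
  have "bdd_below (l ` A)" by (rule bdd_belowI2[of _ 0]) (simp add: l_def)
  then obtain a where a: "a \<in> A" "l a < \<kappa>"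
    using cINF_less_iff[of A l \<kappa>] A1 \<kappa> inf0 by auto
  define S where "S = {k. a k \<noteq> 0}"
  have fin: "finite S" and one: "(\<Sum>k\<in>S. \<bar>a k\<bar>) = 1" using a(1) by (auto simp: A_def S_def)
  obtain n where n: "\<And>k. k \<in> S \<Longrightarrow> k < n" using fin by (meson finite_nat_set_iff_bounded)
  obtain t1 where t1: "\<And>i. i < n \<Longrightarrow> if 0 < a i then g0 + \<kappa> \<le> apply_bcontfun (orbit x (s i)) t1
      else apply_bcontfun (orbit x (s i)) t1 \<le> g0 - \<kappa>" using pat[of n "\<lambda>i. 0 < a i"] by blast
  obtain t2 where t2: "\<And>i. i < n \<Longrightarrow> if \<not> 0 < a i then g0 + \<kappa> \<le> apply_bcontfun (orbit x (s i)) t2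
      else apply_bcontfun (orbit x (s i)) t2 \<le> g0 - \<kappa>" using pat[of n "\<lambda>i. \<not> 0 < a i"] by blast
  define v where "v = (\<Sum>k\<in>S. a k *\<^sub>R orbit x (s k))"
  have "2 * \<kappa> * \<bar>a k\<bar> \<le> a k * (apply_bcontfun (orbit x (s k)) t1 - apply_bcontfun (orbit x (s k)) t2)" if "k \<in> S" for k
  proof (cases "0 < a k")
    case True
    then have "a k * (2 * \<kappa>) \<le> a k * (apply_bcontfun (orbit x (s k)) t1 - apply_bcontfun (orbit x (s k)) t2)"
      using t1[OF n[OF that]] t2[OF n[OF that]] by (intro mult_left_mono) auto
    then show ?thesis using True by (simp add: mult.commute)
  next
    case False
    then have "(- a k) * (2 * \<kappa>) \<le> (- a k) * (apply_bcontfun (orbit x (s k)) t2 - apply_bcontfun (orbit x (s k)) t1)"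
      using t1[OF n[OF that]] t2[OF n[OF that]] by (intro mult_left_mono) auto
    then show ?thesis using False by (simp add: algebra_simps)
  qed
  then have "(\<Sum>k\<in>S. 2 * \<kappa> * \<bar>a k\<bar>) \<le> (\<Sum>k\<in>S. a k * (apply_bcontfun (orbit x (s k)) t1 - apply_bcontfun (orbit x (s k)) t2))"
    by (rule sum_mono)
  also have "\<dots> = apply_bcontfun v t1 - apply_bcontfun v t2"
    unfolding v_def apply_bcontfun_sum by (simp add: sum_subtractf[symmetric] right_diff_distrib)
  also have "(\<Sum>k\<in>S. 2 * \<kappa> * \<bar>a k\<bar>) = 2 * \<kappa>" using one by (simp add: sum_distrib_left[symmetric])
  finally have "2 * \<kappa> \<le> 2 * norm v" using abs_apply_le_norm[of v t1] abs_apply_le_norm[of v t2] by linarith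
  then show False using a(2) by (simp add: l_def v_def S_def)
qed

text \<open>The common end of both contradictions: splitting a class of sets over and over by late
  convex combinations yields disjoint blocks realizing all patterns, and hence independent
  iterates.\<close>

lemma no_splitting_family:
  assumes E0: "E0 \<in> P" and ne: "{} \<notin> P" and ab: "a < b"
    and step: "\<And>\<E> N. finite \<E> \<Longrightarrow> \<E> \<subseteq> P \<Longrightarrow> \<exists>v\<in>convex hull (orbit x ` {N..}).
      \<forall>E\<in>\<E>. (\<exists>E'\<in>P. E' \<subseteq> E \<inter> {t. apply_bcontfun v t \<le> a}) \<and> (\<exists>E'\<in>P. E' \<subseteq> E \<inter> {t. b \<le> apply_bcontfun v t})"
  shows False
proof (rule independent_sequence[where adm = "\<lambda>N c. fst c \<in> convex hull (orbit x ` {N..<snd c})" and top = snd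
      and lo = "\<lambda>c. {t. apply_bcontfun (fst c) t \<le> a}" and hi = "\<lambda>c. {t. b \<le> apply_bcontfun (fst c) t}", OF E0 ne])
  fix \<E> and N :: nat assume "finite \<E>" "\<E> \<subseteq> P"
  then obtain v where v: "v \<in> convex hull (orbit x ` {N..})"
    "\<forall>E\<in>\<E>. (\<exists>E'\<in>P. E' \<subseteq> E \<inter> {t. apply_bcontfun v t \<le> a}) \<and> (\<exists>E'\<in>P. E' \<subseteq> E \<inter> {t. b \<le> apply_bcontfun v t})"
    using step by meson
  obtain T where "v \<in> convex hull (orbit x ` {N..<T})" using convex_hull_tail[OF v(1)] by blast
  then show "\<exists>c. fst c \<in> convex hull (orbit x ` {N..<snd c}) \<and>
      (\<forall>E\<in>\<E>. (\<exists>E'\<in>P. E' \<subseteq> E \<inter> {t. apply_bcontfun (fst c) t \<le> a}) \<and> (\<exists>E'\<in>P. E' \<subseteq> E \<inter> {t. b \<le> apply_bcontfun (fst c) t}))"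
    using v(2) by (intro exI[of _ "(v, T)"]) simp
next
  fix c :: "nat \<Rightarrow> ('a \<Rightarrow>\<^sub>C real) \<times> nat" and N
  assume c0: "fst (c 0) \<in> convex hull (orbit x ` {N..<snd (c 0)})"
    and cS: "\<And>n. fst (c (Suc n)) \<in> convex hull (orbit x ` {snd (c n)..<snd (c (Suc n))})"
    and pat: "\<And>n \<sigma>. \<exists>t. \<forall>i<n. t \<in> (if \<sigma> i then {t. b \<le> apply_bcontfun (fst (c i)) t} else {t. apply_bcontfun (fst (c i)) t \<le> a})"
  \<comment> \<open>The start of the \<open>i\<close>-th block: the end of the previous one, or the
    unspecified \<open>N\<close> for the first.\<close>
  define N' where "N' i = (case i of 0 \<Rightarrow> N | Suc j \<Rightarrow> snd (c j))" for i
  have blk: "fst (c i) \<in> convex hull (orbit x ` {N' i..<snd (c i)})" for i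
    using c0 cS by (cases i) (auto simp: N'_def)
  have pat': "\<exists>t. \<forall>i<n. if \<sigma> i then b \<le> apply_bcontfun (fst (c i)) t else apply_bcontfun (fst (c i)) t \<le> a" for n \<sigma>
  proof -
    obtain t where "\<forall>i<n. t \<in> (if \<sigma> i then {t. b \<le> apply_bcontfun (fst (c i)) t} else {t. apply_bcontfun (fst (c i)) t \<le> a})"
      using pat[of n \<sigma>] by (rule exE)
    then show ?thesis by (intro exI[of _ t]) (auto split: if_splits)
  qed
  have "\<exists>s \<kappa> g0. strict_mono (s :: nat \<Rightarrow> nat) \<and> 0 < \<kappa> \<and> (\<forall>n \<sigma>. \<exists>t. \<forall>i<n. if \<sigma> i then g0 + \<kappa> \<le> apply_bcontfun (orbit x (s i)) t
      else apply_bcontfun (orbit x (s i)) t \<le> g0 - \<kappa>)"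
    by (rule convex_blocks_independent[OF comp norm_orbit[of x] blk _ ab pat']) (simp add: N'_def)
  then obtain s \<kappa> g0 where s: "strict_mono (s :: nat \<Rightarrow> nat) \<and> 0 < \<kappa> \<and>
    (\<forall>n \<sigma>. \<exists>t. \<forall>i<n. if \<sigma> i then g0 + \<kappa> \<le> apply_bcontfun (orbit x (s i)) t
      else apply_bcontfun (orbit x (s i)) t \<le> g0 - \<kappa>)" by (elim exE)
  then have s': "strict_mono s" "0 < \<kappa>" by simp_all
  show False
    by (rule tame_no_independent_subsequence[OF s']) (rule s[THEN conjunct2, THEN conjunct2, THEN spec, THEN spec])
qed

text \<open>If it fails, low and high values of the orbit mean are both dense in \<open>C\<close>.
  One convex combination of late iterates imitates the orbit mean at a low and a high point of each
  given relatively open set; being continuous, it stays low or high near these points, so relatively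
  open sets split again.\<close>

lemma orbit_mean_oscillation:
  assumes m: "is_mean m" and ab: "a < b" and C: "C \<noteq> {}"
  shows "\<exists>U. open U \<and> U \<inter> C \<noteq> {} \<and> ((\<forall>t\<in>U \<inter> C. a < orbit_mean m x t) \<or> (\<forall>t\<in>U \<inter> C. orbit_mean m x t < b))"
proof (rule ccontr)
  assume contr: "\<not> ?thesis"
  have dense: "(\<exists>t\<in>U \<inter> C. orbit_mean m x t \<le> a) \<and> (\<exists>t\<in>U \<inter> C. b \<le> orbit_mean m x t)" if "open U" "U \<inter> C \<noteq> {}" for U
  proof -
    have "\<not> (\<forall>t\<in>U \<inter> C. a < orbit_mean m x t)" "\<not> (\<forall>t\<in>U \<inter> C. orbit_mean m x t < b)"
      using contr that by auto
    then show ?thesis by (simp add: not_less)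
  qed
  \<comment> \<open>Approximation within a third of the gap on either side leaves a gap of one
    third.\<close>
  define e where "e = (b - a) / 3"
  have e: "0 < e" "a + e < b - e" using ab by (auto simp: e_def field_simps)
  define P where "P = {U \<inter> C |U. open U \<and> U \<inter> C \<noteq> {}}"
  show False
  proof (rule no_splitting_family[where P = P and x = x, OF _ _ e(2)])
    show "C \<in> P" unfolding P_def using C by (intro CollectI exI[of _ UNIV]) auto
    show "{} \<notin> P" by (auto simp: P_def)
    fix \<E> and N :: nat assume \<E>: "finite \<E>" "\<E> \<subseteq> P"
    have "\<forall>E\<in>\<E>. \<exists>t. t \<in> E \<and> orbit_mean m x t \<le> a" 
    proof
      fix E assume "E \<in> \<E>"
      then have "E \<in> P" using \<E>(2) by auto
      then obtain U where "E = U \<inter> C" "open U" "U \<inter> C \<noteq> {}" unfolding P_def by blast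
      then show "\<exists>t. t \<in> E \<and> orbit_mean m x t \<le> a" using dense[of U] by blast
    qed
    from bchoice[OF this] obtain p where p: "\<And>E. E \<in> \<E> \<Longrightarrow> p E \<in> E" "\<And>E. E \<in> \<E> \<Longrightarrow> orbit_mean m x (p E) \<le> a" by blast
    have "\<forall>E\<in>\<E>. \<exists>t. t \<in> E \<and> b \<le> orbit_mean m x t" 
    proof
      fix E assume "E \<in> \<E>"
      then have "E \<in> P" using \<E>(2) by auto
      then obtain U where "E = U \<inter> C" "open U" "U \<inter> C \<noteq> {}" unfolding P_def by blast
      then show "\<exists>t. t \<in> E \<and> b \<le> orbit_mean m x t" using dense[of U] by blast
    qed
    from bchoice[OF this] obtain q where q: "\<And>E. E \<in> \<E> \<Longrightarrow> q E \<in> E" "\<And>E. E \<in> \<E> \<Longrightarrow> b \<le> orbit_mean m x (q E)" by blast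
    define L where "L = (\<lambda>t (v :: 'a \<Rightarrow>\<^sub>C real). apply_bcontfun v t) ` (p ` \<E> \<union> q ` \<E>)"
    have L: "finite L" "\<And>l. l \<in> L \<Longrightarrow> linear l" "\<And>l. l \<in> L \<Longrightarrow> bseq (\<lambda>k. l (orbit x k))"
      unfolding L_def using \<E>(1) linear_eval bseq_orbit by auto
    obtain v where v: "v \<in> convex hull (orbit x ` {N..})" "\<And>l. l \<in> L \<Longrightarrow> \<bar>l v - m (\<lambda>k. l (orbit x k))\<bar> < e"
      using mean_in_closure_convex_hull[where f = "orbit x" and L = L and N = N, OF m L e(1)] by blast
    have near: "\<bar>apply_bcontfun v t - orbit_mean m x t\<bar> < e" if "t \<in> p ` \<E> \<union> q ` \<E>" for t
      using v(2)[of "\<lambda>v. apply_bcontfun v t"] that unfolding L_def orbit_mean_def by auto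
    show "\<exists>v\<in>convex hull (orbit x ` {N..}). \<forall>E\<in>\<E>. (\<exists>E'\<in>P. E' \<subseteq> E \<inter> {t. apply_bcontfun v t \<le> a + e}) \<and>
        (\<exists>E'\<in>P. E' \<subseteq> E \<inter> {t. b - e \<le> apply_bcontfun v t})"
    proof (intro bexI[OF _ v(1)] ballI conjI)
      fix E assume E: "E \<in> \<E>"
      then obtain U where U: "E = U \<inter> C" "open U" using \<E>(2) by (auto simp: P_def)
      have o1: "open {t. apply_bcontfun v t < a + e}" "open {t. b - e < apply_bcontfun v t}"
        by (intro open_Collect_less continuous_intros; simp)+
      have "apply_bcontfun v (p E) < a + e" using near[of "p E"] p(2)[OF E] E by (auto simp: abs_less_iff)
      then have "(U \<inter> {t. apply_bcontfun v t < a + e}) \<inter> C \<in> P"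
        unfolding P_def using p(1)[OF E] U o1 by (intro CollectI exI[of _ "U \<inter> {t. apply_bcontfun v t < a + e}"]) auto
      then show "\<exists>E'\<in>P. E' \<subseteq> E \<inter> {t. apply_bcontfun v t \<le> a + e}" by (rule bexI[rotated]) (auto simp: U)
      have "b - e < apply_bcontfun v (q E)" using near[of "q E"] q(2)[OF E] E by (auto simp: abs_less_iff)
      then have "(U \<inter> {t. b - e < apply_bcontfun v t}) \<inter> C \<in> P"
        unfolding P_def using q(1)[OF E] U o1 by (intro CollectI exI[of _ "U \<inter> {t. b - e < apply_bcontfun v t}"]) auto
      then show "\<exists>E'\<in>P. E' \<subseteq> E \<inter> {t. b - e \<le> apply_bcontfun v t}" by (rule bexI[rotated]) (auto simp: U)
    qed
  qed
qed

lemma baire1_orbit_mean: assumes "is_mean m" shows "baire1 (orbit_mean m x)"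
  using orbit_mean_oscillation[OF assms] by (intro baire1I[OF comp abs_orbit_mean_le[OF assms]])

end

text \<open>The basic open sets meeting \<open>E\<close> in a null set are countably many, so their
  union does not exhaust \<open>E\<close> up to measure 0. Such points convert an inequality at a
  single point into one on a set of positive measure.\<close>

lemma support_point:
  fixes M :: "'a::metric_space measure"
  assumes comp: "compact (UNIV :: 'a set)" and fin: "finite_measure M" and sM: "sets M = sets borel"
    and E: "E \<in> sets M" "0 < measure M E"
  shows "\<exists>t\<in>E. \<forall>V. open V \<longrightarrow> t \<in> V \<longrightarrow> 0 < measure M (V \<inter> E)"
proof -
  interpret finite_measure M by fact
  obtain \<B> :: "'a set set" where \<B>: "countable \<B>" "\<And>B. B \<in> \<B> \<Longrightarrow> open B"
    "\<And>U t. open U \<Longrightarrow> t \<in> U \<Longrightarrow> \<exists>B\<in>\<B>. t \<in> B \<and> B \<subseteq> U"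
    using compact_metric_countable_base[OF comp] by blast
  define N where "N = (\<Union>B\<in>{B\<in>\<B>. measure M (B \<inter> E) = 0}. B \<inter> E)"
  have op: "open V \<Longrightarrow> V \<inter> E \<in> sets M" for V using E(1) by (simp add: sM)
  have "N \<in> null_sets M"
    unfolding N_def
  proof (rule null_sets_UN')
    show "countable {B\<in>\<B>. measure M (B \<inter> E) = 0}" using \<B>(1) by simp
    show "B \<inter> E \<in> null_sets M" if "B \<in> {B\<in>\<B>. measure M (B \<inter> E) = 0}" for B
      using that op[OF \<B>(2)] by (auto simp: null_sets_def emeasure_eq_measure)
  qed
  then have "measure M N = 0" by (simp add: null_sets_def emeasure_eq_measure)
  have "\<not> E \<subseteq> N"
  proof
    assume "E \<subseteq> N"
    then have "measure M E \<le> measure M N" using \<open>N \<in> null_sets M\<close> by (intro finite_measure_mono) auto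
    then show False using \<open>measure M N = 0\<close> E(2) by simp
  qed
  then obtain t where t: "t \<in> E" "t \<notin> N" by blast
  have "0 < measure M (V \<inter> E)" if V: "open V" "t \<in> V" for V
  proof -
    obtain B where B: "B \<in> \<B>" "t \<in> B" "B \<subseteq> V" using \<B>(3)[OF V] by blast
    then have "measure M (B \<inter> E) \<noteq> 0" using t by (auto simp: N_def)
    then have "0 < measure M (B \<inter> E)" by (simp add: zero_less_measure_iff)
    also have "\<dots> \<le> measure M (V \<inter> E)" using B(3) op[OF V(1)] by (intro finite_measure_mono) auto
    finally show ?thesis .
  qed
  then show ?thesis using t(1) by blast
qed

section \<open>Commutation of the mean with integration\<close>

context tame_system
begin

text \<open>On the exceptional set \<open>D\<close>, averages of late convex combinations over a
  piece \<open>E\<close> are close to the average of \<open>g\<close>, hence low, while at a support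
  point of \<open>E\<close> the values are close to the orbit mean, hence high. Requiring positive
  measure of the pieces makes both conclusions reproduce the class, so a \<open>D\<close> of
  positive measure would split forever.\<close>

lemma density_gap_null:
  assumes m: "is_mean m" and fin: "finite_measure M" and sM: "sets M = sets borel" and g: "integrable M g"
    and dens: "\<And>E. E \<in> sets M \<Longrightarrow> m (\<lambda>k. \<integral>t. indicator E t * apply_bcontfun (orbit x k) t \<partial>M) = (\<integral>t. indicator E t * g t \<partial>M)"
    and ab: "a < b"
  shows "{t. g t < a \<and> b < orbit_mean m x t} \<in> null_sets M"
proof (rule ccontr)
  interpret finite_measure M by fact
  define D where "D = {t. g t < a \<and> b < orbit_mean m x t}"
  have sp: "space M = UNIV" by (rule space_eq_UNIV[OF sM])
  have [measurable]: "g \<in> borel_measurable M" "orbit_mean m x \<in> borel_measurable M"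
    using g baire1_borel_measurable[OF baire1_orbit_mean[OF m] sM] by auto
  have "{t \<in> space M. g t < a \<and> b < orbit_mean m x t} \<in> sets M" by measurable
  then have D: "D \<in> sets M" by (simp add: D_def sp)
  assume "{t. g t < a \<and> b < orbit_mean m x t} \<notin> null_sets M"
  then have D0: "0 < measure M D"
    using D unfolding D_def[symmetric] by (auto simp: zero_less_measure_iff null_sets_def emeasure_eq_measure)
  define e where "e = (b - a) / 3"
  have e: "0 < e" "0 < e / 2" "a + e < b - e" using ab by (auto simp: e_def field_simps)
  define P where "P = {U \<inter> D |U. open U \<and> 0 < measure M (U \<inter> D)}"
  have P_sets: "E \<in> sets M \<and> 0 < measure M E \<and> E \<subseteq> D" if "E \<in> P" for E
    using that D by (auto simp: P_def sM)
  show False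
  proof (rule no_splitting_family[where P = P and x = x, OF _ _ e(3)])
    show "D \<in> P" unfolding P_def using D0 by (intro CollectI exI[of _ UNIV]) auto
    show "{} \<notin> P" using P_sets[of "{}"] by auto
    fix \<E> and N :: nat assume \<E>: "finite \<E>" "\<E> \<subseteq> P"
    have "\<forall>E\<in>\<E>. \<exists>t. t \<in> E \<and> (\<forall>V. open V \<longrightarrow> t \<in> V \<longrightarrow> 0 < measure M (V \<inter> E))"
      using support_point[OF comp fin sM] P_sets \<E>(2) by (meson subsetD)
    from bchoice[OF this] obtain q where q: "\<And>E. E \<in> \<E> \<Longrightarrow> q E \<in> E"
      "\<And>E V. E \<in> \<E> \<Longrightarrow> open V \<Longrightarrow> q E \<in> V \<Longrightarrow> 0 < measure M (V \<inter> E)" by blast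
    \<comment> \<open>The low condition is imposed through an average over \<open>E\<close> and the
      high condition through a point evaluation; both are linear, so one convex combination can meet
      all of them.\<close>
    define l where "l E v = (\<integral>t. indicator E t * apply_bcontfun v t \<partial>M) / measure M E" for E and v :: "'a \<Rightarrow>\<^sub>C real"
    define L where "L = l ` \<E> \<union> (\<lambda>E (v :: 'a \<Rightarrow>\<^sub>C real). apply_bcontfun v (q E)) ` \<E>"
    have vm: "apply_bcontfun v \<in> borel_measurable M" for v :: "'a \<Rightarrow>\<^sub>C real"
      by (rule borel_measurableI_continuous[OF sM]) auto
    have iv: "integrable M (\<lambda>t. indicator E t * apply_bcontfun v t)" if "E \<in> sets M" for E and v :: "'a \<Rightarrow>\<^sub>C real"
      using integrable_mult_indicator[OF that bounded_integrable[OF vm abs_apply_le_norm, of v]] by simp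
    have lin: "linear (l E)" if "E \<in> \<E>" for E
      unfolding l_def using iv P_sets[of E] \<E>(2) that
      by (intro linearI) (auto simp: distrib_left add_divide_distrib mult.left_commute)
    have bl: "bseq (\<lambda>k. \<integral>t. indicator E t * apply_bcontfun (orbit x k) t \<partial>M)" if "E \<in> sets M" for E
    proof (rule bseqI)
      fix k
      have "\<bar>apply_bcontfun (orbit x k) t\<bar> \<le> norm x" for t by (simp add: abs_apply_le_norm)
      then show "\<bar>\<integral>t. indicator E t * apply_bcontfun (orbit x k) t \<partial>M\<bar> \<le> norm x * measure M E"
        by (rule abs_integral_le[OF vm _ that])
    qed
    have bl': "bseq (\<lambda>k. l E (orbit x k))" if "E \<in> \<E>" for E
      using bseq_cmult[OF bl, of E "1 / measure M E"] P_sets[of E] \<E>(2) that by (auto simp: l_def)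
    have L: "finite L" "\<And>l. l \<in> L \<Longrightarrow> linear l" "\<And>l. l \<in> L \<Longrightarrow> bseq (\<lambda>k. l (orbit x k))"
      unfolding L_def using \<E>(1) linear_eval bseq_orbit lin bl' by auto
    obtain v where v: "v \<in> convex hull (orbit x ` {N..})" "\<And>l. l \<in> L \<Longrightarrow> \<bar>l v - m (\<lambda>k. l (orbit x k))\<bar> < e / 2"
      using mean_in_closure_convex_hull[where f = "orbit x" and L = L and N = N, OF m L e(2)] by blast
    have near: "\<bar>apply_bcontfun v (q E) - orbit_mean m x (q E)\<bar> < e / 2" if "E \<in> \<E>" for E
      using v(2)[of "\<lambda>v. apply_bcontfun v (q E)"] that unfolding L_def orbit_mean_def by auto
    have near': "\<bar>l E v - m (\<lambda>k. l E (orbit x k))\<bar> < e / 2" if "E \<in> \<E>" for E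
      using v(2)[of "l E"] that unfolding L_def by auto
    show "\<exists>v\<in>convex hull (orbit x ` {N..}). \<forall>E\<in>\<E>. (\<exists>E'\<in>P. E' \<subseteq> E \<inter> {t. apply_bcontfun v t \<le> a + e}) \<and>
        (\<exists>E'\<in>P. E' \<subseteq> E \<inter> {t. b - e \<le> apply_bcontfun v t})"
    proof (intro bexI[OF _ v(1)] ballI conjI)
      fix E assume E: "E \<in> \<E>"
      then have EP: "E \<in> P" using \<E>(2) by auto
      then obtain U where U: "E = U \<inter> D" "open U" unfolding P_def by blast
      have Es: "E \<in> sets M" "0 < measure M E" "E \<subseteq> D" using P_sets[OF EP] by auto
      have o1: "open {t. apply_bcontfun v t < a + e}" "open {t. b - e < apply_bcontfun v t}"
        by (intro open_Collect_less continuous_intros; simp)+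
      have "(\<integral>t. indicator E t * g t \<partial>M) \<le> (\<integral>t. indicator E t * a \<partial>M)"
      proof (rule integral_mono)
        show "integrable M (\<lambda>t. indicator E t * g t)" using integrable_mult_indicator[OF Es(1) g] by simp
        show "integrable M (\<lambda>t. indicator E t * a)"
          using Es(1) by (intro bounded_integrable[of _ "\<bar>a\<bar>"]) (auto simp: indicator_def)
      qed (use Es(3) in \<open>auto simp: D_def indicator_def\<close>)
      then have "m (\<lambda>k. \<integral>t. indicator E t * apply_bcontfun (orbit x k) t \<partial>M) \<le> a * measure M E"
        unfolding dens[OF Es(1)] using Es(1) by (simp add: sets.Int_space_eq2 mult.commute)
      then have "m (\<lambda>k. (1 / measure M E) * (\<integral>t. indicator E t * apply_bcontfun (orbit x k) t \<partial>M)) \<le> a"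
        unfolding mean_cmult[OF m bl[OF Es(1)]] using Es(2) by (simp add: field_simps)
      then have "m (\<lambda>k. l E (orbit x k)) \<le> a" by (simp add: l_def)
      then have "l E v < a + e / 2" using near'[OF E] by linarith
      then have le: "(\<integral>t. indicator E t * apply_bcontfun v t \<partial>M) < (a + e / 2) * measure M E"
        using Es(2) by (simp add: l_def field_simps)
      \<comment> \<open>A low average gives a large one of \<open>K - v\<close>. The summands of
        \<open>K\<close> keep the threshold \<open>K - (a + e / 2)\<close> nonnegative, and the
        constant weight 2 fits the estimate used next.\<close>
      define K where "K = norm v + \<bar>a\<bar> + e"
      have iK: "integrable M (\<lambda>t. indicator E t * (2 * K))"
        using Es(1) by (intro bounded_integrable[of _ "\<bar>2 * K\<bar>"]) (auto simp: indicator_def)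
      have "(\<integral>t. indicator E t * ((K - apply_bcontfun v t) * 2) \<partial>M) =
        (\<integral>t. indicator E t * (2 * K) - 2 * (indicator E t * apply_bcontfun v t) \<partial>M)"
        by (intro Bochner_Integration.integral_cong) (auto simp: algebra_simps)
      also have "\<dots> = 2 * K * measure M E - 2 * (\<integral>t. indicator E t * apply_bcontfun v t \<partial>M)"
        using iK iv[OF Es(1), of v] Es(1) by (simp add: sets.Int_space_eq2)
      finally have "2 * (K - (a + e / 2)) * measure M E < (\<integral>t. indicator E t * ((K - apply_bcontfun v t) * 2) \<partial>M)"
        using le by (simp add: algebra_simps)
      then have "0 < measure M (E \<inter> {t \<in> space M. K - (a + e / 2) \<le> K - apply_bcontfun v t})"
      proof (rule large_integral_imp_large_set[rotated -1])
        show "\<bar>K - apply_bcontfun v t\<bar> \<le> \<bar>K\<bar> + norm v" for t using abs_apply_le_norm[of v t] by linarith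
        show "0 \<le> K - (a + e / 2)" using e(1) by (simp add: K_def)
      qed (use vm Es(1) in auto)
      also have "\<dots> \<le> measure M ((U \<inter> {t. apply_bcontfun v t < a + e}) \<inter> D)"
        using e(1) U o1 D by (intro finite_measure_mono) (auto simp: sM)
      finally have "(U \<inter> {t. apply_bcontfun v t < a + e}) \<inter> D \<in> P"
        unfolding P_def using U(2) o1 by (intro CollectI exI[of _ "U \<inter> {t. apply_bcontfun v t < a + e}"]) auto
      then show "\<exists>E'\<in>P. E' \<subseteq> E \<inter> {t. apply_bcontfun v t \<le> a + e}" by (rule bexI[rotated]) (auto simp: U)
      have "b < orbit_mean m x (q E)" using q(1)[OF E] Es(3) by (auto simp: D_def)
      then have "b - e < apply_bcontfun v (q E)" using near[OF E] e(1) unfolding abs_less_iff by linarith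
      then have "0 < measure M ({t. b - e < apply_bcontfun v t} \<inter> E)" using q(2)[OF E o1(2)] by simp
      then have "(U \<inter> {t. b - e < apply_bcontfun v t}) \<inter> D \<in> P"
        unfolding P_def using U o1
        by (intro CollectI exI[of _ "U \<inter> {t. b - e < apply_bcontfun v t}"]) (auto simp: Int_ac)
      then show "\<exists>E'\<in>P. E' \<subseteq> E \<inter> {t. b - e \<le> apply_bcontfun v t}" by (rule bexI[rotated]) (auto simp: U)
    qed
  qed
qed

text \<open>The set where the orbit mean exceeds the density is a countable union of gaps with
  rational ends, all null. The reverse inequality results from the same statement for
  \<open>- x\<close>.\<close>

lemma integral_orbit_mean_le:
  assumes m: "is_mean m" and fin: "finite_measure M" and sM: "sets M = sets borel"
  shows "(\<integral>t. orbit_mean m x t \<partial>M) \<le> m (\<lambda>k. \<integral>t. apply_bcontfun (orbit x k) t \<partial>M)"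
proof -
  interpret finite_measure M by fact
  have sp: "space M = UNIV" by (rule space_eq_UNIV[OF sM])
  have fm: "apply_bcontfun (orbit x k) \<in> borel_measurable M" for k
    by (rule borel_measurableI_continuous[OF sM continuous_on_apply_bcontfun])
  have fb: "\<bar>apply_bcontfun (orbit x k) t\<bar> \<le> norm x" for k t by (simp add: abs_apply_le_norm)
  obtain g where "integrable M g \<and> (\<forall>E\<in>sets M.
      m (\<lambda>k. \<integral>t. indicator E t * apply_bcontfun (orbit x k) t \<partial>M) = (\<integral>t. indicator E t * g t \<partial>M))"
    using mean_density[OF m fm fb] by (rule exE)
  note g = conjunct1[OF this] bspec[OF conjunct2[OF this]]
  define R where "R = {p \<in> \<rat> \<times> \<rat>. fst p < (snd p :: real)}"
  have "countable (\<rat> \<times> \<rat> :: (real \<times> real) set)" by (intro countable_SIGMA countable_rat)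
  then have cR: "countable R" unfolding R_def by (rule countable_subset[rotated]) auto
  have "(\<Union>p\<in>R. {t. g t < fst p \<and> snd p < orbit_mean m x t}) \<in> null_sets M"
    by (rule null_sets_UN'[OF cR]) (auto simp: R_def intro!: density_gap_null[OF m fin sM g])
  then have "AE t in M. t \<notin> (\<Union>p\<in>R. {t. g t < fst p \<and> snd p < orbit_mean m x t})" by (rule AE_not_in)
  then have ae: "AE t in M. orbit_mean m x t \<le> g t"
  proof eventually_elim
    case (elim t)
    show ?case
    proof (rule ccontr)
      assume "\<not> orbit_mean m x t \<le> g t"
      then have lt: "g t < orbit_mean m x t" by simp
      obtain a where a: "a \<in> \<rat>" "g t < a" "a < orbit_mean m x t" using Rats_dense_in_real[OF lt] by blast
      obtain b where b: "b \<in> \<rat>" "a < b" "b < orbit_mean m x t" using Rats_dense_in_real[OF a(3)] by blast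
      have "(a, b) \<in> R" using a b by (simp add: R_def)
      then show False using elim a b by force
    qed
  qed
  have om: "orbit_mean m x \<in> borel_measurable M" by (rule baire1_borel_measurable[OF baire1_orbit_mean[OF m] sM])
  have "(\<integral>t. orbit_mean m x t \<partial>M) \<le> (\<integral>t. g t \<partial>M)"
    by (rule integral_mono_AE[OF bounded_integrable[OF om abs_orbit_mean_le[OF m]] g(1) ae])
  also have "\<dots> = m (\<lambda>k. \<integral>t. apply_bcontfun (orbit x k) t \<partial>M)"
    using g(2)[of UNIV] sp sets.top[of M] by simp
  finally show ?thesis .
qed

lemma orbit_uminus: "orbit (- x) k = - orbit x k"
  by (rule bcontfun_eqI) simp

text \<open>A mean is only finitely additive; that it nevertheless commutes with integration is where
  tameness enters besides the Baire property.\<close>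

theorem integral_orbit_mean:
  assumes m: "is_mean m" and fin: "finite_measure M" and sM: "sets M = sets borel"
  shows "(\<integral>t. orbit_mean m x t \<partial>M) = m (\<lambda>k. \<integral>t. apply_bcontfun (orbit x k) t \<partial>M)"
proof (rule antisym)
  interpret finite_measure M by fact
  show "(\<integral>t. orbit_mean m x t \<partial>M) \<le> m (\<lambda>k. \<integral>t. apply_bcontfun (orbit x k) t \<partial>M)"
    by (rule integral_orbit_mean_le[OF assms])
  have fm: "apply_bcontfun (orbit x k) \<in> borel_measurable M" for k
    by (rule borel_measurableI_continuous[OF sM continuous_on_apply_bcontfun])
  have fb: "\<bar>apply_bcontfun (orbit x k) t\<bar> \<le> norm x" for k t by (simp add: abs_apply_le_norm)
  have bs: "bseq (\<lambda>k. \<integral>t. apply_bcontfun (orbit x k) t \<partial>M)"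
  proof (rule bseqI)
    fix k
    have "\<bar>\<integral>t. indicator (space M) t * apply_bcontfun (orbit x k) t \<partial>M\<bar> \<le> norm x * measure M (space M)"
      by (rule abs_integral_le[OF fm fb]) simp
    then show "\<bar>\<integral>t. apply_bcontfun (orbit x k) t \<partial>M\<bar> \<le> norm x * measure M (space M)"
      by (simp add: space_eq_UNIV[OF sM])
  qed
  have "orbit_mean m (- x) t = - orbit_mean m x t" for t
    unfolding orbit_mean_def using mean_minus[OF m bseq_orbit] by simp
  moreover have "m (\<lambda>k. \<integral>t. apply_bcontfun (orbit (- x) k) t \<partial>M) = - m (\<lambda>k. \<integral>t. apply_bcontfun (orbit x k) t \<partial>M)"
    using mean_minus[OF m bs] by (simp add: orbit_uminus)
  ultimately show "m (\<lambda>k. \<integral>t. apply_bcontfun (orbit x k) t \<partial>M) \<le> (\<integral>t. orbit_mean m x t \<partial>M)"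
    using integral_orbit_mean_le[OF assms, of "- x"] by simp
qed

end

section \<open>Extreme invariant means yield ergodic measures\<close>

definition extreme_inv_mean :: "((nat \<Rightarrow> real) \<Rightarrow> real) \<Rightarrow> bool" where
  "extreme_inv_mean m \<longleftrightarrow> is_mean m \<and> shift_inv m \<and>
    (\<forall>a b. is_mean a \<longrightarrow> is_mean b \<longrightarrow> shift_inv a \<longrightarrow> shift_inv b \<longrightarrow>
       (\<forall>u. bseq u \<longrightarrow> m u = (a u + b u) / 2) \<longrightarrow> (\<forall>u. bseq u \<longrightarrow> a u = m u))"

lemma extreme_inv_mean_exists: "\<exists>m. extreme_inv_mean m"
  by (rule extreme_banach_limit) (unfold extreme_inv_mean_def, blast)

text \<open>With \<open>s = J 1\<close>, the functionals \<open>m \<plusminus> (J - s m)\<close> are invariant means with midpoint \<open>m\<close>.\<close>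

lemma extreme_inv_mean_rigid:
  assumes m: "extreme_inv_mean m"
    and add: "\<And>u v. bseq u \<Longrightarrow> bseq v \<Longrightarrow> J (\<lambda>k. u k + v k) = J u + J v"
    and cmult: "\<And>c u. bseq u \<Longrightarrow> J (\<lambda>k. c * u k) = c * J u"
    and pos: "\<And>u. bseq u \<Longrightarrow> (\<And>k. 0 \<le> u k) \<Longrightarrow> 0 \<le> J u" "\<And>u. bseq u \<Longrightarrow> (\<And>k. 0 \<le> u k) \<Longrightarrow> J u \<le> m u"
    and inv: "\<And>u. bseq u \<Longrightarrow> J (\<lambda>k. u (Suc k)) = J u"
    and u: "bseq u"
  shows "J u = J (\<lambda>k. 1) * m u"
proof -
  have mm: "is_mean m" and mi: "\<And>u. bseq u \<Longrightarrow> m (\<lambda>k. u (Suc k)) = m u"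
    using m by (auto simp: extreme_inv_mean_def shift_inv_def)
  define s where "s = J (\<lambda>k. 1)"
  have s: "0 \<le> s" "s \<le> 1"
    using pos(1)[of "\<lambda>k. 1"] pos(2)[of "\<lambda>k. 1"] mean_const[OF mm, of 1] by (auto simp: s_def bseq_const)
  have Jw: "J (\<lambda>k. C - u k) = C * s - J u" if u: "bseq u" for C u
    using add[OF bseq_cmult[OF bseq_const, of C 1] bseq_cmult[OF u, of "- 1"]] cmult[OF bseq_const, of C 1] cmult[OF u, of "- 1"]
    by (simp add: s_def)
  have mw: "m (\<lambda>k. C - u k) = C - m u" if u: "bseq u" for C u
    using mean_diff[OF mm bseq_const u, of C] mean_const[OF mm] by simp
  define a where "a u = (1 - s) * m u + J u" for u
  define b where "b u = (1 + s) * m u - J u" for u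
  have ainv: "shift_inv a" and binv: "shift_inv b" by (simp_all add: shift_inv_def a_def b_def mi inv)
  have a: "is_mean a"
  proof (rule is_mean_shift_invI[OF _ _ _ ainv])
    fix u v assume "bseq u" "bseq v"
    then show "a (\<lambda>k. u k + v k) = a u + a v" by (simp add: a_def add mean_add[OF mm] algebra_simps)
  next
    fix c u assume "bseq u"
    then show "a (\<lambda>k. c * u k) = c * a u" by (simp add: a_def cmult mean_cmult[OF mm] algebra_simps)
  next
    fix C u assume u: "bseq u" and le: "\<And>k. u k \<le> C"
    have w: "bseq (\<lambda>k. C - u k)" "0 \<le> C - u k" for k using bseq_diff[OF bseq_const u] le by auto
    have "0 \<le> (1 - s) * m (\<lambda>k. C - u k) + J (\<lambda>k. C - u k)"
      using s by (intro add_nonneg_nonneg mult_nonneg_nonneg mean_nonneg[OF mm w] pos(1)[OF w]) auto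
    then show "a u \<le> C" by (simp add: Jw[OF u] mw[OF u] a_def algebra_simps)
  qed
  have b: "is_mean b"
  proof (rule is_mean_shift_invI[OF _ _ _ binv])
    fix u v assume "bseq u" "bseq v"
    then show "b (\<lambda>k. u k + v k) = b u + b v" by (simp add: b_def add mean_add[OF mm] algebra_simps)
  next
    fix c u assume "bseq u"
    then show "b (\<lambda>k. c * u k) = c * b u" by (simp add: b_def cmult mean_cmult[OF mm] algebra_simps)
  next
    fix C u assume u: "bseq u" and le: "\<And>k. u k \<le> C"
    have w: "bseq (\<lambda>k. C - u k)" "0 \<le> C - u k" for k using bseq_diff[OF bseq_const u] le by auto
    have "0 \<le> s * m (\<lambda>k. C - u k)" using s by (intro mult_nonneg_nonneg mean_nonneg[OF mm w]) auto
    then have "0 \<le> (1 + s) * m (\<lambda>k. C - u k) - J (\<lambda>k. C - u k)" using pos(2)[OF w] by (simp add: algebra_simps)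
    then show "b u \<le> C" by (simp add: Jw[OF u] mw[OF u] b_def algebra_simps)
  qed
  have "\<forall>u. bseq u \<longrightarrow> m u = (a u + b u) / 2" by (simp add: a_def b_def algebra_simps)
  then have "a u = m u" using m a b ainv binv u unfolding extreme_inv_mean_def by blast
  then show ?thesis by (simp add: a_def s_def algebra_simps)
qed

context compact_system
begin

text \<open>The measure represents the mean along the orbit of \<open>t\<close>, and shift
  invariance of \<open>m\<close> makes it invariant. An invariant set \<open>A\<close> defines an
  invariant functional below \<open>m\<close>, which by rigidity is \<open>s\<close> times
  \<open>m\<close>; evaluated on approximations of the indicator of \<open>A\<close> itself, this
  gives \<open>s = s * s\<close> for the measure \<open>s\<close> of \<open>A\<close>.\<close>

theorem extreme_orbit_mean_ergodic:
  assumes m: "extreme_inv_mean m"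
  shows "\<exists>M. ergodic_prob \<phi> M \<and> (\<forall>x. orbit_mean m x t = (\<integral>y. apply_bcontfun x y \<partial>M))"
proof -
  have mm: "is_mean m" and mi: "\<And>u. bseq u \<Longrightarrow> m (\<lambda>k. u (Suc k)) = m u"
    using m by (auto simp: extreme_inv_mean_def shift_inv_def)
  define \<tau> where "\<tau> k = (\<phi> ^^ k) t" for k
  have \<tau>S: "\<tau> (Suc k) = \<phi> (\<tau> k)" for k by (simp add: \<tau>_def)
  have bs: "bseq (\<lambda>k. f (\<tau> k))" if f: "continuous_on UNIV f" for f :: "'a \<Rightarrow> real"
  proof -
    obtain C where "\<And>x. \<bar>f x\<bar> \<le> C" by (rule compact_continuous_bounded[OF comp f]) blast
    then show ?thesis by (intro bseqI)
  qed
  have pf: "pos_functional (\<lambda>f. m (\<lambda>k. f (\<tau> k)))"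
    unfolding pos_functional_def
  proof (intro conjI allI impI)
    fix f g :: "'a \<Rightarrow> real" assume "continuous_on UNIV f" "continuous_on UNIV g"
    then show "m (\<lambda>k. f (\<tau> k) + g (\<tau> k)) = m (\<lambda>k. f (\<tau> k)) + m (\<lambda>k. g (\<tau> k))" by (intro mean_add[OF mm] bs)
  next
    fix c and f :: "'a \<Rightarrow> real" assume "continuous_on UNIV f"
    then show "m (\<lambda>k. c * f (\<tau> k)) = c * m (\<lambda>k. f (\<tau> k))" by (intro mean_cmult[OF mm] bs)
  next
    fix f :: "'a \<Rightarrow> real" assume "continuous_on UNIV f" "\<forall>x. 0 \<le> f x"
    then show "0 \<le> m (\<lambda>k. f (\<tau> k))" by (intro mean_nonneg[OF mm] bs) auto
  qed
  obtain M where M: "finite_measure M \<and> sets M = sets borel \<and> (\<forall>f. continuous_on UNIV f \<longrightarrow> (\<integral>x. f x \<partial>M) = m (\<lambda>k. f (\<tau> k)))"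
    using riesz_representation[OF comp pf] by (rule exE)
  have fM: "finite_measure M" and sM: "sets M = sets borel" and
    iM: "\<And>f. continuous_on UNIV f \<Longrightarrow> (\<integral>x. f x \<partial>M) = m (\<lambda>k. f (\<tau> k))" using M by auto
  interpret finite_measure M by (rule fM)
  have sp: "space M = UNIV" by (rule space_eq_UNIV[OF sM])
  have "measure M UNIV = 1" using iM[of "\<lambda>x. 1"] mean_const[OF mm, of 1] sp by simp
  then have pM: "prob_space M" by (intro prob_spaceI) (simp add: emeasure_eq_measure sp)
  have \<phi>b: "\<phi> \<in> measurable M borel"
    using borel_measurable_continuous_onI[OF cont] by (simp add: measurable_cong_sets[OF sM refl])
  have \<phi>M: "\<phi> \<in> measurable M M" using \<phi>b by (simp add: measurable_cong_sets[OF refl sM])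
  have cc: "continuous_on UNIV (\<lambda>x. f (\<phi> x))" if "continuous_on UNIV f" for f :: "'a \<Rightarrow> real"
    using that cont by (rule continuous_on_compose2) auto
  have dist: "distr M borel \<phi> = M"
  proof (rule finite_borel_measure_eqI[OF _ _ fM sM])
    show "finite_measure (distr M borel \<phi>)" by (rule finite_measure_distr[OF \<phi>b])
    fix f :: "'a \<Rightarrow> real" assume f: "continuous_on UNIV f"
    have "(\<integral>x. f x \<partial>distr M borel \<phi>) = (\<integral>x. f (\<phi> x) \<partial>M)"
      by (rule integral_distr[OF \<phi>b borel_measurable_continuous_onI[OF f]])
    also have "\<dots> = m (\<lambda>k. f (\<tau> (Suc k)))" unfolding \<tau>S by (rule iM[OF cc[OF f]])
    also have "\<dots> = (\<integral>x. f x \<partial>M)" unfolding iM[OF f] by (rule mi[OF bs[OF f]])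
    finally show "(\<integral>x. f x \<partial>distr M borel \<phi>) = (\<integral>x. f x \<partial>M)" .
  qed simp
  have inv_int: "(\<integral>x. f (\<phi> x) \<partial>M) = (\<integral>x. f x \<partial>M)" if "f \<in> borel_measurable borel" for f :: "'a \<Rightarrow> real"
    using integral_distr[OF \<phi>b that] by (simp add: dist)
  have em: "emeasure M (\<phi> -` A) = emeasure M A" if "A \<in> sets M" for A
    using emeasure_distr[OF \<phi>b, of A] that by (simp add: dist sM sp)
  have "measure M A = 0 \<or> measure M A = 1" if A: "A \<in> sets M" and Ainv: "\<phi> -` A = A" for A
  proof -
    define s where "s = measure M A"
    have "\<forall>n. \<exists>h :: 'a \<Rightarrow> real. continuous_on UNIV h \<and> (\<forall>x. 0 \<le> h x \<and> h x \<le> 1) \<and> (\<integral>x. \<bar>indicator A x - h x\<bar> \<partial>M) < 1 / real (Suc n)"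
    proof
      fix n
      obtain h :: "'a \<Rightarrow> real" where "continuous_on UNIV h" "\<And>x. 0 \<le> h x" "\<And>x. h x \<le> 1"
        "(\<integral>x. \<bar>indicator A x - h x\<bar> \<partial>M) < 1 / real (Suc n)"
        using indicator_L1_approx[OF fM sM, of A "1 / real (Suc n)"] A sM by auto
      then show "\<exists>h :: 'a \<Rightarrow> real. continuous_on UNIV h \<and> (\<forall>x. 0 \<le> h x \<and> h x \<le> 1) \<and> (\<integral>x. \<bar>indicator A x - h x\<bar> \<partial>M) < 1 / real (Suc n)"
        by blast
    qed
    from choice[OF this] obtain h :: "nat \<Rightarrow> 'a \<Rightarrow> real" where hc: "\<And>n. continuous_on UNIV (h n)"
      and h0: "\<And>n x. 0 \<le> h n x" and h1: "\<And>n x. h n x \<le> 1"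
      and hA: "\<And>n. (\<integral>x. \<bar>indicator A x - h n x\<bar> \<partial>M) < 1 / real (Suc n)" by auto
    have hm: "h n \<in> borel_measurable M" for n by (rule borel_measurableI_continuous[OF sM hc])
    have ind01: "\<bar>indicator A x - h n x\<bar> \<le> 1" for n x using h0[of n x] h1[of n x] by (auto simp: indicator_def)
    have iA: "integrable M (\<lambda>x. \<bar>indicator A x - h n x\<bar>)" for n
      using A hm ind01 by (intro bounded_integrable[of _ 1]) auto
    have hh: "(\<integral>x. \<bar>h n x - h l x\<bar> \<partial>M) \<le> 1 / real (Suc n) + 1 / real (Suc l)" for n l
    proof -
      have "(\<integral>x. \<bar>h n x - h l x\<bar> \<partial>M) \<le> (\<integral>x. \<bar>indicator A x - h n x\<bar> + \<bar>indicator A x - h l x\<bar> \<partial>M)"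
      proof (rule integral_mono)
        show "integrable M (\<lambda>x. \<bar>h n x - h l x\<bar>)"
        proof (rule bounded_integrable[of _ 1])
          show "\<bar>\<bar>h n x - h l x\<bar>\<bar> \<le> 1" for x using h0[of n x] h1[of n x] h0[of l x] h1[of l x] by (simp add: abs_le_iff)
        qed (use hm in measurable)
      qed (use iA in auto)
      also have "\<dots> = (\<integral>x. \<bar>indicator A x - h n x\<bar> \<partial>M) + (\<integral>x. \<bar>indicator A x - h l x\<bar> \<partial>M)"
        using iA by simp
      finally show ?thesis using hA[of n] hA[of l] by linarith
    qed
    have h\<phi>: "(\<integral>x. \<bar>h n x - h n (\<phi> x)\<bar> \<partial>M) \<le> 2 / real (Suc n)" for n
    proof -
      have indA: "(indicator A (\<phi> x) :: real) = indicator A x" for x using Ainv by (auto simp: indicator_def)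
      have cm: "(\<lambda>x. h n (\<phi> x)) \<in> borel_measurable M" by (rule borel_measurableI_continuous[OF sM cc[OF hc]])
      have i2: "integrable M (\<lambda>x. \<bar>indicator A x - h n (\<phi> x)\<bar>)"
        using A cm ind01[of "\<phi> x" n for x] by (intro bounded_integrable[of _ 1]) (auto simp: indA)
      have "(\<integral>x. \<bar>h n x - h n (\<phi> x)\<bar> \<partial>M) \<le> (\<integral>x. \<bar>indicator A x - h n x\<bar> + \<bar>indicator A x - h n (\<phi> x)\<bar> \<partial>M)"
      proof (rule integral_mono)
        show "integrable M (\<lambda>x. \<bar>h n x - h n (\<phi> x)\<bar>)"
        proof (rule bounded_integrable[of _ 1])
          show "\<bar>\<bar>h n x - h n (\<phi> x)\<bar>\<bar> \<le> 1" for x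
            using h0[of n x] h1[of n x] h0[of n "\<phi> x"] h1[of n "\<phi> x"] by (simp add: abs_le_iff)
        qed (use hm cm in measurable)
      qed (use iA i2 in auto)
      also have "\<dots> = (\<integral>x. \<bar>indicator A x - h n x\<bar> \<partial>M) + (\<integral>x. \<bar>indicator A x - h n (\<phi> x)\<bar> \<partial>M)"
        using iA i2 by simp
      also have "(\<integral>x. \<bar>indicator A x - h n (\<phi> x)\<bar> \<partial>M) = (\<integral>x. \<bar>indicator A (\<phi> x) - h n (\<phi> x)\<bar> \<partial>M)" by (simp add: indA)
      also have "\<dots> = (\<integral>x. \<bar>indicator A x - h n x\<bar> \<partial>M)"
      proof (rule inv_int)
        show "(\<lambda>x. \<bar>indicator A x - h n x\<bar>) \<in> borel_measurable borel"
          using A sM borel_measurable_continuous_onI[OF hc[of n]] by measurable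
      qed
      finally have "(\<integral>x. \<bar>h n x - h n (\<phi> x)\<bar> \<partial>M) \<le> 1 / real (Suc n) + 1 / real (Suc n)" using hA[of n] by linarith
      then show ?thesis by simp
    qed
    have hb: "bseq (\<lambda>k. h n (\<tau> k))" for n by (rule bs[OF hc])
    \<comment> \<open>The indicator of \<open>A\<close> along the orbit may have nothing to do with
      the measure, which sees \<open>m\<close> through continuous functions only. So it is replaced
      by the continuous \<open>h n\<close>, and the functional wanted is the limit of
      \<open>J n\<close>.\<close>
    define J where "J n u = m (\<lambda>k. u k * h n (\<tau> k))" for n and u :: "nat \<Rightarrow> real"
    have est: "\<bar>m (\<lambda>k. u k * v k)\<bar> \<le> C * m (\<lambda>k. \<bar>v k\<bar>)" if u: "\<And>k. \<bar>u k\<bar> \<le> C" and v: "bseq v" for u v :: "nat \<Rightarrow> real" and C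
    proof -
      have bu: "bseq u" using u by (rule bseqI)
      have "\<bar>m (\<lambda>k. u k * v k)\<bar> \<le> m (\<lambda>k. \<bar>u k * v k\<bar>)" by (rule mean_abs_le[OF mm bseq_mult[OF bu v]])
      also have "\<dots> \<le> m (\<lambda>k. C * \<bar>v k\<bar>)"
        using u by (intro mean_mono[OF mm] bseq_abs bseq_mult bu v bseq_cmult) (simp add: abs_mult mult_right_mono)
      also have "\<dots> = C * m (\<lambda>k. \<bar>v k\<bar>)" by (rule mean_cmult[OF mm bseq_abs[OF v]])
      finally show ?thesis .
    qed
    have conv: "convergent (\<lambda>n. J n u)" if u: "bseq u" for u
    proof -
      obtain C where C: "\<And>k. \<bar>u k\<bar> \<le> C" by (rule bseqD[OF u]) blast
      have C0: "0 \<le> C" using C[of 0] by simp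
      \<comment> \<open>The mean of the continuous function along the orbit is its integral, which
        converts closeness of the \<open>h n\<close> in \<open>L1\<close> into a Cauchy
        estimate.\<close>
      have diff: "\<bar>J n u - J l u\<bar> \<le> C * (1 / real (Suc n) + 1 / real (Suc l))" for n l
      proof -
        have "J n u - J l u = m (\<lambda>k. u k * (h n (\<tau> k) - h l (\<tau> k)))"
          unfolding J_def by (subst mean_diff[OF mm bseq_mult[OF u hb] bseq_mult[OF u hb], symmetric]) (simp add: right_diff_distrib)
        then have "\<bar>J n u - J l u\<bar> \<le> C * m (\<lambda>k. \<bar>h n (\<tau> k) - h l (\<tau> k)\<bar>)"
          using est[OF C bseq_diff[OF hb hb]] by simp
        also have "m (\<lambda>k. \<bar>h n (\<tau> k) - h l (\<tau> k)\<bar>) = (\<integral>x. \<bar>h n x - h l x\<bar> \<partial>M)"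
          by (rule iM[symmetric]) (intro continuous_intros hc)
        also have "C * \<dots> \<le> C * (1 / real (Suc n) + 1 / real (Suc l))" by (intro mult_left_mono hh C0)
        finally show ?thesis .
      qed
      have "Cauchy (\<lambda>n. J n u)"
      proof (rule metric_CauchyI)
        fix e :: real assume e: "0 < e"
        obtain N :: nat where N: "2 * C / e < real N" using reals_Archimedean2 by blast
        have "dist (J n u) (J l u) < e" if "N \<le> n" "N \<le> l" for n l
        proof -
          have "C * (1 / real (Suc n) + 1 / real (Suc l)) \<le> C * (1 / real (Suc N) + 1 / real (Suc N))"
            using that C0 by (intro mult_left_mono add_mono divide_left_mono) auto
          also have "\<dots> = 2 * C / real (Suc N)" by simp
          also have "\<dots> < e" using N e C0 by (simp add: field_simps)
          finally show ?thesis using diff[of n l] by (simp add: dist_real_def)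
        qed
        then show "\<exists>N. \<forall>n\<ge>N. \<forall>l\<ge>N. dist (J n u) (J l u) < e" by blast
      qed
      then show ?thesis by (rule Cauchy_convergent)
    qed
    define JA where "JA u = lim (\<lambda>n. J n u)" for u
    have JA: "(\<lambda>n. J n u) \<longlonglongrightarrow> JA u" if "bseq u" for u
      using conv[OF that] unfolding JA_def by (simp add: convergent_LIMSEQ_iff)
    have JAeq: "JA u = L" if "(\<lambda>n. J n u) \<longlonglongrightarrow> L" for u L unfolding JA_def by (rule limI[OF that])
    have inv_n: "(\<lambda>n. 1 / real (Suc n)) \<longlonglongrightarrow> 0" using LIMSEQ_inverse_real_of_nat by (simp add: inverse_eq_divide)
    have intA: "(\<integral>x. indicator A x \<partial>M) = s" using A by (simp add: s_def sp)
    have rigid: "JA u = JA (\<lambda>k. 1) * m u" if "bseq u" for u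
    proof (rule extreme_inv_mean_rigid[OF m _ _ _ _ _ that])
      fix u v :: "nat \<Rightarrow> real" assume uv: "bseq u" "bseq v"
      have "J n (\<lambda>k. u k + v k) = J n u + J n v" for n
        unfolding J_def using mean_add[OF mm bseq_mult[OF uv(1) hb] bseq_mult[OF uv(2) hb]] by (simp add: distrib_right)
      then show "JA (\<lambda>k. u k + v k) = JA u + JA v" using tendsto_add[OF JA JA] uv by (intro JAeq) simp
    next
      fix c and u :: "nat \<Rightarrow> real" assume u: "bseq u"
      have "J n (\<lambda>k. c * u k) = c * J n u" for n
        unfolding J_def using mean_cmult[OF mm bseq_mult[OF u hb]] by (simp add: mult.assoc)
      then show "JA (\<lambda>k. c * u k) = c * JA u" using tendsto_mult[OF tendsto_const JA] u by (intro JAeq) simp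
    next
      fix u :: "nat \<Rightarrow> real" assume u: "bseq u" "\<And>k. 0 \<le> u k"
      have "0 \<le> J n u" for n unfolding J_def using u h0 by (intro mean_nonneg[OF mm] bseq_mult hb) auto
      then show "0 \<le> JA u" by (intro LIMSEQ_le_const[OF JA[OF u(1)]]) auto
      have "J n u \<le> m u" for n
        unfolding J_def using u h1 by (intro mean_mono[OF mm] bseq_mult hb) (auto intro: mult_left_le)
      then show "JA u \<le> m u" by (intro LIMSEQ_le_const2[OF JA[OF u(1)]]) auto
    next
      fix u :: "nat \<Rightarrow> real" assume u: "bseq u"
      obtain C where C: "\<And>k. \<bar>u k\<bar> \<le> C" by (rule bseqD[OF u]) blast
      have C0: "0 \<le> C" using C[of 0] by simp
      \<comment> \<open>Shifting the whole product costs nothing, so the defect is governed by the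
        integral of \<open>|h n - h n o \<phi>|\<close>, small because the indicator of
        \<open>A\<close> is invariant.\<close>
      have d: "\<bar>J n (\<lambda>k. u (Suc k)) - J n u\<bar> \<le> C * 2 * (1 / real (Suc n))" for n
      proof -
        have "J n u = m (\<lambda>k. u (Suc k) * h n (\<tau> (Suc k)))"
          unfolding J_def by (rule mi[OF bseq_mult[OF u hb], symmetric])
        then have e2: "J n u = m (\<lambda>k. u (Suc k) * h n (\<phi> (\<tau> k)))" by (simp add: \<tau>S)
        have "J n (\<lambda>k. u (Suc k)) - J n u = m (\<lambda>k. u (Suc k) * (h n (\<tau> k) - h n (\<phi> (\<tau> k))))"
          unfolding e2 unfolding J_def
          using mean_diff[OF mm bseq_mult[OF bseq_Suc[OF u] hb] bseq_mult[OF bseq_Suc[OF u] bs[OF cc[OF hc]]]]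
          by (simp add: right_diff_distrib)
        then have "\<bar>J n (\<lambda>k. u (Suc k)) - J n u\<bar> \<le> C * m (\<lambda>k. \<bar>h n (\<tau> k) - h n (\<phi> (\<tau> k))\<bar>)"
          using est[of "\<lambda>k. u (Suc k)" C "\<lambda>k. h n (\<tau> k) - h n (\<phi> (\<tau> k))"] C bseq_diff[OF hb bs[OF cc[OF hc]]] by simp
        also have "m (\<lambda>k. \<bar>h n (\<tau> k) - h n (\<phi> (\<tau> k))\<bar>) = (\<integral>x. \<bar>h n x - h n (\<phi> x)\<bar> \<partial>M)"
          by (rule iM[symmetric]) (intro continuous_intros hc cc)
        also have "C * \<dots> \<le> C * (2 / real (Suc n))" by (intro mult_left_mono h\<phi> C0)
        finally show ?thesis by simp
      qed
      have "(\<lambda>n. C * 2 * (1 / real (Suc n))) \<longlonglongrightarrow> C * 2 * 0" by (intro tendsto_intros inv_n)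
      then have "(\<lambda>n. C * 2 * (1 / real (Suc n))) \<longlonglongrightarrow> 0" by simp
      then have "(\<lambda>n. J n (\<lambda>k. u (Suc k)) - J n u) \<longlonglongrightarrow> 0"
        by (rule Lim_null_comparison[rotated]) (use d in auto)
      from tendsto_add[OF this JA[OF u]] show "JA (\<lambda>k. u (Suc k)) = JA u" by (intro JAeq) simp
    qed
    have close: "\<bar>(\<integral>x. g x * h n x \<partial>M) - (\<integral>x. g x * indicator A x \<partial>M)\<bar> \<le> 1 / real (Suc n)"
      if g: "g \<in> borel_measurable M" "\<And>x. 0 \<le> g x" "\<And>x. g x \<le> 1" for g n
    proof -
      have i: "integrable M (\<lambda>x. g x * h n x)" "integrable M (\<lambda>x. g x * indicator A x)"
        using g hm h0 h1 A by (auto intro!: bounded_integrable[of _ 1] mult_le_one simp: abs_mult indicator_def)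
      have "\<bar>(\<integral>x. g x * h n x \<partial>M) - (\<integral>x. g x * indicator A x \<partial>M)\<bar> = \<bar>\<integral>x. g x * h n x - g x * indicator A x \<partial>M\<bar>"
        using i by simp
      also have "\<dots> \<le> (\<integral>x. \<bar>g x * h n x - g x * indicator A x\<bar> \<partial>M)" by (rule integral_abs_bound)
      also have "\<dots> \<le> (\<integral>x. \<bar>indicator A x - h n x\<bar> \<partial>M)"
      proof (rule integral_mono)
        fix x
        have "\<bar>g x * h n x - g x * indicator A x\<bar> = g x * \<bar>indicator A x - h n x\<bar>"
          using g(2)[of x] by (simp add: right_diff_distrib[symmetric] abs_mult abs_minus_commute)
        also have "\<dots> \<le> \<bar>indicator A x - h n x\<bar>" using g(2,3)[of x] by (intro mult_left_le_one_le) auto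
        finally show "\<bar>g x * h n x - g x * indicator A x\<bar> \<le> \<bar>indicator A x - h n x\<bar>" .
      qed (use i iA in auto)
      finally show ?thesis using hA[of n] by linarith
    qed
    have J1: "JA (\<lambda>k. 1) = s"
    proof (rule JAeq)
      have "J n (\<lambda>k. 1) = (\<integral>x. 1 * h n x \<partial>M)" for n unfolding J_def by (simp add: iM[OF hc])
      then have "\<bar>J n (\<lambda>k. 1) - s\<bar> \<le> 1 / real (Suc n)" for n using close[of "\<lambda>x. 1" n] intA by simp
      then have "(\<lambda>n. J n (\<lambda>k. 1) - s) \<longlonglongrightarrow> 0" by (intro Lim_null_comparison[OF _ inv_n]) auto
      then show "(\<lambda>n. J n (\<lambda>k. 1)) \<longlonglongrightarrow> s" by (rule LIM_zero_cancel)
    qed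
    have Jh: "JA (\<lambda>k. h l (\<tau> k)) = (\<integral>x. h l x * indicator A x \<partial>M)" for l
    proof (rule JAeq)
      have "J n (\<lambda>k. h l (\<tau> k)) = (\<integral>x. h l x * h n x \<partial>M)" for n
        unfolding J_def by (rule iM[symmetric]) (intro continuous_intros hc)
      then have "\<bar>J n (\<lambda>k. h l (\<tau> k)) - (\<integral>x. h l x * indicator A x \<partial>M)\<bar> \<le> 1 / real (Suc n)" for n
        using close[OF hm h0 h1] by simp
      then have "(\<lambda>n. J n (\<lambda>k. h l (\<tau> k)) - (\<integral>x. h l x * indicator A x \<partial>M)) \<longlonglongrightarrow> 0"
        by (intro Lim_null_comparison[OF _ inv_n]) auto
      then show "(\<lambda>n. J n (\<lambda>k. h l (\<tau> k))) \<longlonglongrightarrow> (\<integral>x. h l x * indicator A x \<partial>M)" by (rule LIM_zero_cancel)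
    qed
    \<comment> \<open>Rigidity is applied to \<open>h l\<close> along the orbit; only afterwards
      does \<open>l\<close> tend to infinity.\<close>
    have key: "(\<integral>x. h l x * indicator A x \<partial>M) = s * (\<integral>x. h l x \<partial>M)" for l
      using rigid[OF hb[of l]] J1 Jh iM[OF hc] by simp
    have l1: "(\<lambda>l. \<integral>x. h l x \<partial>M) \<longlonglongrightarrow> s"
    proof -
      have "\<bar>(\<integral>x. h l x \<partial>M) - s\<bar> \<le> 1 / real (Suc l)" for l using close[of "\<lambda>x. 1" l] intA by simp
      then have "(\<lambda>l. (\<integral>x. h l x \<partial>M) - s) \<longlonglongrightarrow> 0" by (intro Lim_null_comparison[OF _ inv_n]) auto
      then show ?thesis by (rule LIM_zero_cancel)
    qed
    have l2: "(\<lambda>l. \<integral>x. h l x * indicator A x \<partial>M) \<longlonglongrightarrow> s"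
    proof -
      have "(\<integral>x. indicator A x * indicator A x \<partial>M) = s"
        unfolding intA[symmetric] by (rule Bochner_Integration.integral_cong) (auto simp: indicator_def)
      moreover have "\<bar>(\<integral>x. indicator A x * h l x \<partial>M) - (\<integral>x. indicator A x * indicator A x \<partial>M)\<bar> \<le> 1 / real (Suc l)" for l
        using A by (intro close) auto
      ultimately have "\<bar>(\<integral>x. h l x * indicator A x \<partial>M) - s\<bar> \<le> 1 / real (Suc l)" for l
        by (simp only: mult.commute[of "h l _"])
      then have "(\<lambda>l. (\<integral>x. h l x * indicator A x \<partial>M) - s) \<longlonglongrightarrow> 0" by (intro Lim_null_comparison[OF _ inv_n]) auto
      then show ?thesis by (rule LIM_zero_cancel)
    qed
    have "(\<lambda>l. s * (\<integral>x. h l x \<partial>M)) \<longlonglongrightarrow> s * s" by (intro tendsto_intros l1)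
    then have "s = s * s" using l2 unfolding key by (rule LIMSEQ_unique[rotated])
    then show ?thesis unfolding s_def by simp
  qed
  then have "ergodic_prob \<phi> M" unfolding ergodic_prob_def using pM sM \<phi>M em by blast
  moreover have "orbit_mean m x t = (\<integral>y. apply_bcontfun x y \<partial>M)" for x
    unfolding orbit_mean_def using iM[of "apply_bcontfun x"] by (simp add: \<tau>_def)
  ultimately show ?thesis by blast
qed

end

section \<open>The ergodic operator sequence\<close>

text \<open>Partitions of unity subordinate to finite nets suffice: by uniform continuity, a
  function is close to the combination with its own values at the net as coefficients. Real
  coefficients are harmless because only linear spans are used.\<close>

lemma countable_total_family:
  assumes comp: "compact (UNIV :: ('a::metric_space) set)"
  shows "\<exists>X :: nat \<Rightarrow> ('a \<Rightarrow>\<^sub>C real). \<forall>x e. 0 < e \<longrightarrow> (\<exists>y\<in>span (range X). norm (x - y) \<le> e)"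
proof -
  have "\<exists>K. finite K \<and> (UNIV :: 'a set) \<subseteq> (\<Union>p\<in>K. ball p (1 / real (Suc n)))" for n
    using seq_compact_imp_totally_bounded[OF compact_imp_seq_compact[OF comp]] by simp
  then obtain K :: "nat \<Rightarrow> 'a set" where K: "\<And>n. finite (K n)" "\<And>n. UNIV \<subseteq> (\<Union>p\<in>K n. ball p (1 / real (Suc n)))" by metis
  define \<tau> where "\<tau> n p t = max 0 (1 / real (Suc n) - dist p t)" for n :: nat and p t :: 'a
  define \<sigma> where "\<sigma> n t = (\<Sum>p\<in>K n. \<tau> n p t)" for n t
  have \<tau>c: "continuous_on UNIV (\<tau> n p)" for n p unfolding \<tau>_def by (intro continuous_intros)
  have \<sigma>c: "continuous_on UNIV (\<sigma> n)" for n unfolding \<sigma>_def by (intro continuous_intros \<tau>c)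
  have \<sigma>0: "0 < \<sigma> n t" for n t
  proof -
    obtain p where p: "p \<in> K n" "dist p t < 1 / real (Suc n)" using subsetD[OF K(2)[of n], of t] by auto
    have "0 < \<tau> n p t" using p(2) by (simp add: \<tau>_def)
    also have "\<dots> \<le> \<sigma> n t" unfolding \<sigma>_def using p(1) K(1) by (intro member_le_sum) (auto simp: \<tau>_def)
    finally show ?thesis .
  qed
  define \<rho> where "\<rho> n p = Bcontfun (\<lambda>t. \<tau> n p t / \<sigma> n t)" for n p
  have \<rho>: "apply_bcontfun (\<rho> n p) t = \<tau> n p t / \<sigma> n t" for n p t
    unfolding \<rho>_def
    by (subst apply_Bcontfun_compact[OF comp]) (use \<sigma>0 in \<open>auto intro!: continuous_intros \<tau>c \<sigma>c simp: less_imp_neq[symmetric]\<close>)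
  define F where "F = insert 0 (\<Union>n. \<rho> n ` K n)"
  have "countable F" unfolding F_def using K(1) by (auto intro: countable_finite)
  then have rX: "range (from_nat_into F) = F" by (intro range_from_nat_into) (simp_all add: F_def)
  have "\<exists>y\<in>span F. norm (x - y) \<le> e" if e: "0 < e" for x :: "'a \<Rightarrow>\<^sub>C real" and e
  proof -
    have "uniformly_continuous_on UNIV (apply_bcontfun x)" by (rule compact_uniformly_continuous) (auto intro: comp)
    then obtain d where d: "0 < d" "\<And>s t. dist s t < d \<Longrightarrow> dist (apply_bcontfun x s) (apply_bcontfun x t) < e"
      using e unfolding uniformly_continuous_on_def by (metis UNIV_I)
    obtain n where n: "1 / real (Suc n) < d" using nat_approx_posE[OF d(1)] by blast
    define y where "y = (\<Sum>p\<in>K n. apply_bcontfun x p *\<^sub>R \<rho> n p)"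
    have "y \<in> span F" unfolding y_def by (intro span_sum span_scale span_base) (auto simp: F_def)
    moreover have "norm (x - y) \<le> e"
    proof (rule norm_bound)
      fix t
      have one: "(\<Sum>p\<in>K n. apply_bcontfun (\<rho> n p) t) = 1"
        unfolding \<rho> using \<sigma>0[of n t] by (simp add: sum_divide_distrib[symmetric] \<sigma>_def[symmetric])
      have "apply_bcontfun x t = (\<Sum>p\<in>K n. apply_bcontfun x t * apply_bcontfun (\<rho> n p) t)"
        using one by (simp add: sum_distrib_left[symmetric])
      then have "apply_bcontfun (x - y) t = (\<Sum>p\<in>K n. (apply_bcontfun x t - apply_bcontfun x p) * apply_bcontfun (\<rho> n p) t)"
        by (simp add: y_def apply_bcontfun_sum left_diff_distrib sum_subtractf)
      also have "norm \<dots> \<le> (\<Sum>p\<in>K n. e * apply_bcontfun (\<rho> n p) t)"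
      proof (rule sum_norm_le)
        fix p
        show "norm ((apply_bcontfun x t - apply_bcontfun x p) * apply_bcontfun (\<rho> n p) t) \<le> e * apply_bcontfun (\<rho> n p) t"
        proof (cases "dist p t < 1 / real (Suc n)")
          case True
          then have "\<bar>apply_bcontfun x t - apply_bcontfun x p\<bar> \<le> e"
            using d(2)[of t p] n by (simp add: dist_real_def dist_commute)
          moreover have "0 \<le> apply_bcontfun (\<rho> n p) t" unfolding \<rho> using \<sigma>0[of n t] by (simp add: \<tau>_def)
          ultimately show ?thesis by (simp add: abs_mult mult_right_mono)
        next
          case False
          then have "apply_bcontfun (\<rho> n p) t = 0" unfolding \<rho> by (simp add: \<tau>_def)
          then show ?thesis by simp
        qed
      qed
      also have "\<dots> = e" using one by (simp add: sum_distrib_left[symmetric])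
      finally show "norm (apply_bcontfun (x - y) t) \<le> e" .
    qed
    ultimately show ?thesis by blast
  qed
  then show ?thesis using rX by (intro exI[of _ "from_nat_into F"]) simp
qed

text \<open>Tuples of functions are placed side by side on \<open>'a \<times> nat\<close>.\<close>

definition layer :: "nat \<Rightarrow> ('a::metric_space \<Rightarrow>\<^sub>C real) \<Rightarrow> (('a \<times> nat) \<Rightarrow>\<^sub>C real)" where
  "layer j v = Bcontfun (\<lambda>p. apply_bcontfun v (fst p) * (if snd p = j then 1 else 0))"

lemma apply_layer: "apply_bcontfun (layer j v) (t, i) = (if i = j then apply_bcontfun v t else 0)"
proof -
  have "(\<lambda>p. apply_bcontfun v (fst p) * (if snd p = j then 1 else 0)) \<in> bcontfun"
  proof (rule bcontfun_normI)
    have "continuous_on UNIV (\<lambda>i :: nat. if i = j then 1 else 0 :: real)" by simp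
    then have "continuous_on UNIV (\<lambda>p :: 'a \<times> nat. if snd p = j then 1 else 0 :: real)"
      by (rule continuous_on_compose2[OF _ continuous_on_snd]) (auto intro: continuous_intros)
    moreover have "continuous_on UNIV (\<lambda>p :: 'a \<times> nat. apply_bcontfun v (fst p))"
      by (rule continuous_on_compose2[OF continuous_on_apply_bcontfun[of UNIV] continuous_on_fst]) (auto intro: continuous_intros)
    ultimately show "continuous_on UNIV (\<lambda>p :: 'a \<times> nat. apply_bcontfun v (fst p) * (if snd p = j then 1 else 0))"
      by (intro continuous_on_mult)
    show "norm (apply_bcontfun v (fst p) * (if snd p = j then 1 else 0)) \<le> norm v" for p
      using abs_apply_le_norm[of v "fst p"] by simp
  qed
  then show ?thesis unfolding layer_def by (simp add: Bcontfun_inverse)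
qed

lemma linear_layer: "linear (layer j)"
  by (rule linearI; rule bcontfun_eqI; clarify) (simp_all add: apply_layer)

lemma norm_layer: "norm (layer j v) \<le> norm v"
  by (rule norm_bound, clarify) (simp add: apply_layer abs_apply_le_norm)

section \<open>Dual operators\<close>

lemma bounded_linear_dual_op: "bounded_linear (\<lambda>\<mu>. \<mu> o\<^sub>L T)"
  by (rule bounded_bilinear.bounded_linear_left[OF bounded_bilinear_blinfun_compose])

lemma apply_dual_op: "blinfun_apply (blinfun_apply (dual_op T) \<mu>) x = blinfun_apply \<mu> (blinfun_apply T x)"
  unfolding dual_op_def by (simp add: bounded_linear_Blinfun_apply[OF bounded_linear_dual_op])

lemma linear_dual_op: "linear dual_op"
  by (rule linearI; rule blinfun_eqI; rule blinfun_eqI)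
    (simp_all add: apply_dual_op blinfun.add_left blinfun.scaleR_left blinfun.add_right blinfun.scaleR_right)

lemma apply_opow_commute: "blinfun_apply (opow T k) (blinfun_apply T x) = blinfun_apply T (blinfun_apply (opow T k) x)"
  by (induction k) (simp_all add: opow_0 opow_Suc)

text \<open>Duality reverses the order of composition, which does not matter for powers of one
  operator.\<close>

lemma dual_op_opow: "dual_op (opow T k) = opow (dual_op T) k"
proof (intro blinfun_eqI)
  fix \<mu> x
  show "blinfun_apply (blinfun_apply (dual_op (opow T k)) \<mu>) x = blinfun_apply (blinfun_apply (opow (dual_op T) k) \<mu>) x"
  proof (induction k arbitrary: x)
    case (Suc k)
    show ?case using Suc[of "blinfun_apply T x"] by (simp add: opow_Suc apply_dual_op apply_opow_commute)
  qed (simp add: opow_0 apply_dual_op)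
qed

lemma apply_dirac: "blinfun_apply (dirac t) x = apply_bcontfun x t"
proof -
  have "bounded_linear (\<lambda>x :: 'a \<Rightarrow>\<^sub>C real. apply_bcontfun x t)"
    by (rule bounded_linear_intro[where K = 1]) (simp_all add: abs_apply_le_norm)
  then show ?thesis unfolding dirac_def by (simp add: bounded_linear_Blinfun_apply)
qed

section \<open>Approximating the mean by convex combinations of iterates\<close>

context tame_system
begin

text \<open>The witness is the integral against the signed measure of \<open>\<mu>\<close>. Hiding
  it behind these two properties lets \<open>\<mu>\<close> be applied to the orbit means, which are
  limits of continuous functions but need not be continuous.\<close>

lemma dual_extension:
  fixes \<mu> :: "'a dualC"
  shows "\<exists>I. (\<forall>v f C. (\<forall>n. norm (v n) \<le> C) \<longrightarrow> (\<forall>t. (\<lambda>n. apply_bcontfun (v n) t) \<longlonglongrightarrow> f t) \<longrightarrow> (\<lambda>n. \<mu> (v n)) \<longlonglongrightarrow> I f) \<and>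
    (\<forall>m x. is_mean m \<longrightarrow> m (\<lambda>k. \<mu> (orbit x k)) = I (orbit_mean m x))"
proof (rule dualC_signed_measure[OF comp, of \<mu>])
  fix M N :: "'a measure"
  assume M: "finite_measure M" "sets M = sets borel" and N: "finite_measure N" "sets N = sets borel"
    and \<mu>: "\<And>x. blinfun_apply \<mu> x = (\<integral>t. apply_bcontfun x t \<partial>M) - (\<integral>t. apply_bcontfun x t \<partial>N)"
  have lim: "(\<lambda>n. \<integral>t. apply_bcontfun (v n) t \<partial>K) \<longlonglongrightarrow> (\<integral>t. f t \<partial>K)"
    if K: "finite_measure K" "sets K = sets borel" and v: "\<And>n. norm (v n) \<le> C" "\<And>t. (\<lambda>n. apply_bcontfun (v n) t) \<longlonglongrightarrow> f t"
    for v :: "nat \<Rightarrow> ('a \<Rightarrow>\<^sub>C real)" and f C and K :: "'a measure"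
  proof -
    interpret finite_measure K by (rule K)
    have vm: "apply_bcontfun (v n) \<in> borel_measurable K" for n
      by (rule borel_measurableI_continuous[OF K(2) continuous_on_apply_bcontfun])
    show ?thesis
    proof (rule bounded_convergence[where C = C and s = "\<lambda>n. apply_bcontfun (v n)" and f = f, OF vm])
      show "f \<in> borel_measurable K" by (rule borel_measurable_LIMSEQ_real[OF v(2) vm])
      show "(\<lambda>n. apply_bcontfun (v n) t) \<longlonglongrightarrow> f t" for t by (rule v(2))
      show "\<bar>apply_bcontfun (v n) t\<bar> \<le> C" for n t using abs_apply_le_norm[of "v n" t] v(1)[of n] by simp
    qed
  qed
  have bs: "bseq (\<lambda>k. \<integral>t. apply_bcontfun (orbit x k) t \<partial>K)"
    if K: "finite_measure K" "sets K = sets borel" for x and K :: "'a measure"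
  proof -
    interpret finite_measure K by (rule K)
    have om: "apply_bcontfun (orbit x k) \<in> borel_measurable K" for k
      by (rule borel_measurableI_continuous[OF K(2) continuous_on_apply_bcontfun])
    have ob: "\<bar>apply_bcontfun (orbit x k) t\<bar> \<le> norm x" for k t by (simp add: abs_apply_le_norm)
    have "\<bar>\<integral>t. indicator (space K) t * apply_bcontfun (orbit x k) t \<partial>K\<bar> \<le> norm x * measure K (space K)" for k
      by (rule abs_integral_le[OF om ob]) simp
    then show ?thesis by (intro bseqI) (simp add: space_eq_UNIV[OF K(2)])
  qed
  show ?thesis
  proof (intro exI[of _ "\<lambda>f. (\<integral>t. f t \<partial>M) - (\<integral>t. f t \<partial>N)"] conjI allI impI)
    fix v :: "nat \<Rightarrow> ('a \<Rightarrow>\<^sub>C real)" and f C assume "\<forall>n. norm (v n) \<le> C" "\<forall>t. (\<lambda>n. apply_bcontfun (v n) t) \<longlonglongrightarrow> f t"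
    then show "(\<lambda>n. \<mu> (v n)) \<longlonglongrightarrow> (\<integral>t. f t \<partial>M) - (\<integral>t. f t \<partial>N)"
      unfolding \<mu> by (intro tendsto_diff lim[OF M, of v C] lim[OF N, of v C]) auto
  next
    fix m x assume m: "is_mean m"
    show "m (\<lambda>k. \<mu> (orbit x k)) = (\<integral>t. orbit_mean m x t \<partial>M) - (\<integral>t. orbit_mean m x t \<partial>N)"
      unfolding \<mu> mean_diff[OF m bs[OF M] bs[OF N]] integral_orbit_mean[OF m M] integral_orbit_mean[OF m N] by (rule refl)
  qed
qed

text \<open>Mazur's argument for the first \<open>N\<close> functions at once. A functional
  separating the tuples of approximants from those of iterates would keep them apart by
  \<open>e\<close>, yet the limit in \<open>n\<close> of its values on the former and the mean in
  \<open>k\<close> of its values on the latter are the same number. The bound \<open>r\<close>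
  expresses that a convex combination of the \<open>g i n\<close> with \<open>n \<ge> N\<close>
  inherits their pointwise error.\<close>

lemma convex_combination_near_orbit_mean:
  fixes X :: "nat \<Rightarrow> ('a \<Rightarrow>\<^sub>C real)"
  assumes m: "is_mean m" and g: "\<And>i n. norm (g i n) \<le> C i" "\<And>i t. (\<lambda>n. apply_bcontfun (g i n) t) \<longlonglongrightarrow> orbit_mean m (X i) t"
  shows "\<exists>W\<in>convex hull (range (opow (koopman \<phi>))). \<forall>i<N. \<forall>t r.
    (\<forall>n\<ge>N. \<bar>apply_bcontfun (g i n) t - orbit_mean m (X i) t\<bar> \<le> r) \<longrightarrow>
    \<bar>apply_bcontfun (blinfun_apply W (X i)) t - orbit_mean m (X i) t\<bar> \<le> r + 1 / real (Suc N)"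
proof -
  define e where "e = 1 / real (Suc N)"
  have e: "0 < e" by (simp add: e_def)
  define emb where "emb v = (\<Sum>j<N. layer j (v j))" for v :: "nat \<Rightarrow> ('a \<Rightarrow>\<^sub>C real)"
  have emb: "apply_bcontfun (emb v) (t, i) = apply_bcontfun (v i) t" if "i < N" for v t i
    using that by (simp add: emb_def apply_bcontfun_sum apply_layer)
  define G where "G n = emb (\<lambda>j. g j n)" for n
  define H where "H k = emb (\<lambda>j. orbit (X j) k)" for k
  \<comment> \<open>Carrying the operator as second component makes one set of convex coefficients
    serve for the difference of the tuples and for the operator in demand.\<close>
  define S where "S = {(G n - H k, opow (koopman \<phi>) k) |n k. N \<le> n}"
  have "\<exists>s\<in>fst ` S. l s < e" if l: "linear l" "\<And>z. l z \<le> norm z" for l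
  proof (rule ccontr)
    assume no: "\<not> ?thesis"
    have far: "e \<le> l (G n) - l (H k)" if "N \<le> n" for n k
    proof -
      have "G n - H k \<in> fst ` S" unfolding S_def using that by (force intro!: image_eqI[of _ _ "(G n - H k, opow (koopman \<phi>) k)"])
      then have "e \<le> l (G n - H k)" using no by (meson not_le)
      then show ?thesis by (simp add: linear_diff[OF l(1)])
    qed
    have labs: "\<bar>l z\<bar> \<le> norm z" for z using l(2)[of z] l(2)[of "- z"] by (simp add: linear_neg[OF l(1)] abs_le_iff)
    define \<mu> where "\<mu> j = Blinfun (\<lambda>v. l (layer j v))" for j
    have \<mu>: "blinfun_apply (\<mu> j) v = l (layer j v)" for j v
    proof -
      have "bounded_linear (\<lambda>v. l (layer j v))"
      proof (rule bounded_linear_intro[where K = 1])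
        show "l (layer j (v + w)) = l (layer j v) + l (layer j w)" for v w
          by (simp add: linear_add[OF linear_layer] linear_add[OF l(1)])
        show "l (layer j (c *\<^sub>R v)) = c *\<^sub>R l (layer j v)" for c v
          by (simp add: linear_scale[OF linear_layer] linear_scale[OF l(1)])
        show "norm (l (layer j v)) \<le> norm v * 1" for v using labs[of "layer j v"] norm_layer[of j v] by simp
      qed
      then show ?thesis unfolding \<mu>_def by (simp add: bounded_linear_Blinfun_apply)
    qed
    have lemb: "l (emb v) = (\<Sum>j<N. \<mu> j (v j))" for v
      by (simp add: emb_def linear_sum[OF l(1)] \<mu>)
    define P where "P j I \<longleftrightarrow>
      (\<forall>v f C. (\<forall>n. norm (v n) \<le> C) \<longrightarrow> (\<forall>t. (\<lambda>n. apply_bcontfun (v n) t) \<longlonglongrightarrow> f t) \<longrightarrow> (\<lambda>n. \<mu> j (v n)) \<longlonglongrightarrow> I f) \<and>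
      (\<forall>m x. is_mean m \<longrightarrow> m (\<lambda>k. \<mu> j (orbit x k)) = I (orbit_mean m x))" for j I
    have "\<forall>j. \<exists>I. P j I" unfolding P_def by (rule allI) (rule dual_extension)
    from choice[OF this] obtain I where "\<forall>j. P j (I j)" by (rule exE)
    note I = this[THEN spec, unfolded P_def]
    define \<Lambda> where "\<Lambda> = (\<Sum>j<N. I j (orbit_mean m (X j)))"
    have "(\<lambda>n. \<mu> j (g j n)) \<longlonglongrightarrow> I j (orbit_mean m (X j))" for j
      by (rule I[of j, THEN conjunct1, rule_format, of "g j" "C j"]) (use g in auto)
    then have limG: "(\<lambda>n. l (G n)) \<longlonglongrightarrow> \<Lambda>" unfolding G_def lemb \<Lambda>_def by (intro tendsto_sum)
    have bs: "bseq (\<lambda>k. \<mu> j (orbit (X j) k))" for j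
    proof (rule bseqI)
      fix k
      have "\<bar>\<mu> j (orbit (X j) k)\<bar> \<le> norm (\<mu> j) * norm (orbit (X j) k)" using norm_blinfun[of "\<mu> j" "orbit (X j) k"] by simp
      also have "\<dots> \<le> norm (\<mu> j) * norm (X j)" by (intro mult_left_mono norm_orbit) simp
      finally show "\<bar>\<mu> j (orbit (X j) k)\<bar> \<le> norm (\<mu> j) * norm (X j)" .
    qed
    have "m (\<lambda>k. l (H k)) = (\<Sum>j<N. m (\<lambda>k. \<mu> j (orbit (X j) k)))" unfolding H_def lemb by (rule mean_sum[OF m bs])
    also have "\<dots> = \<Lambda>" unfolding \<Lambda>_def using I m by (intro sum.cong) auto
    finally have mH: "m (\<lambda>k. l (H k)) = \<Lambda>" .
    have "l (H k) \<le> \<Lambda> - e" for k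
    proof -
      have "e + l (H k) \<le> \<Lambda>"
        using far[of _ k] by (intro LIMSEQ_le_const[OF limG] exI[of _ N]) (auto simp: algebra_simps)
      then show ?thesis by simp
    qed
    moreover have "bseq (\<lambda>k. l (H k))" unfolding H_def lemb by (rule bseq_sum[OF bs])
    ultimately have "m (\<lambda>k. l (H k)) \<le> \<Lambda> - e" by (intro mean_le[OF m]) auto
    then show False using mH e by simp
  qed
  moreover have "fst ` S \<noteq> {}" unfolding S_def by auto
  ultimately obtain z where z: "z \<in> convex hull (fst ` S)" "norm z < e"
    using zero_in_closure_convex_hull[OF _ e] by metis
  have "convex hull (fst ` S) = fst ` (convex hull S)"
    by (rule convex_hull_linear_image[symmetric]) (rule linear_fst)
  then obtain W where zW: "(z, W) \<in> convex hull S" using z(1) by auto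
  \<comment> \<open>For a generator, \<open>z + W (X i)\<close> on layer \<open>i\<close> is exactly
    \<open>g i n\<close>. The estimate survives convex combinations, so no coefficients need to be
    recorded.\<close>
  define Q where "Q = {(z :: ('a \<times> nat) \<Rightarrow>\<^sub>C real, W). W \<in> convex hull (range (opow (koopman \<phi>))) \<and> (\<forall>i<N. \<forall>t r.
    (\<forall>n\<ge>N. \<bar>apply_bcontfun (g i n) t - orbit_mean m (X i) t\<bar> \<le> r) \<longrightarrow>
    \<bar>apply_bcontfun z (t, i) + apply_bcontfun (blinfun_apply W (X i)) t - orbit_mean m (X i) t\<bar> \<le> r)}"
  have "convex hull S \<subseteq> Q"
  proof (rule hull_minimal)
    show "S \<subseteq> Q"
    proof
      fix s assume "s \<in> S"
      then obtain n k where s: "s = (G n - H k, opow (koopman \<phi>) k)" "N \<le> n" unfolding S_def by blast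
      have "apply_bcontfun (G n - H k) (t, i) + apply_bcontfun (blinfun_apply (opow (koopman \<phi>) k) (X i)) t = apply_bcontfun (g i n) t"
        if "i < N" for i t using that by (simp add: G_def H_def emb orbit_def)
      moreover have "opow (koopman \<phi>) k \<in> convex hull (range (opow (koopman \<phi>)))" by (rule hull_inc) simp
      ultimately show "s \<in> Q" using s by (simp add: Q_def)
    qed
    show "convex Q"
    proof (rule convexI)
      fix p q and a b :: real assume p: "p \<in> Q" and q: "q \<in> Q" and ab: "0 \<le> a" "0 \<le> b" "a + b = 1"
      obtain z W z' W' where pq: "p = (z, W)" "q = (z', W')" by (cases p, cases q)
      have "\<bar>apply_bcontfun (a *\<^sub>R z + b *\<^sub>R z') (t, i) + apply_bcontfun (blinfun_apply (a *\<^sub>R W + b *\<^sub>R W') (X i)) t - orbit_mean m (X i) t\<bar> \<le> r"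
        if i: "i < N" and r: "\<forall>n\<ge>N. \<bar>apply_bcontfun (g i n) t - orbit_mean m (X i) t\<bar> \<le> r" for i t r
      proof -
        define c where "c = apply_bcontfun z (t, i) + apply_bcontfun (blinfun_apply W (X i)) t - orbit_mean m (X i) t"
        define d where "d = apply_bcontfun z' (t, i) + apply_bcontfun (blinfun_apply W' (X i)) t - orbit_mean m (X i) t"
        have cd: "\<bar>c\<bar> \<le> r" "\<bar>d\<bar> \<le> r" using p q i r unfolding Q_def pq c_def d_def by auto
        have o: "orbit_mean m (X i) t = a * orbit_mean m (X i) t + b * orbit_mean m (X i) t"
          using ab(3) by (simp add: distrib_right[symmetric])
        have eq: "apply_bcontfun (a *\<^sub>R z + b *\<^sub>R z') (t, i) + apply_bcontfun (blinfun_apply (a *\<^sub>R W + b *\<^sub>R W') (X i)) t - orbit_mean m (X i) t = a * c + b * d"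
          by (subst o) (simp add: c_def d_def blinfun.add_left blinfun.scaleR_left algebra_simps)
        have "\<bar>a * c + b * d\<bar> \<le> a * \<bar>c\<bar> + b * \<bar>d\<bar>" using ab abs_triangle_ineq[of "a * c" "b * d"] by (simp add: abs_mult)
        also have "\<dots> \<le> a * r + b * r" using ab cd by (intro add_mono mult_left_mono)
        also have "\<dots> = r" using ab(3) by (simp add: distrib_right[symmetric])
        finally show ?thesis unfolding eq .
      qed
      moreover have "a *\<^sub>R W + b *\<^sub>R W' \<in> convex hull (range (opow (koopman \<phi>)))"
        using p q ab unfolding Q_def pq by (intro convexD[OF convex_convex_hull]) auto
      ultimately show "a *\<^sub>R p + b *\<^sub>R q \<in> Q" unfolding Q_def pq by simp
    qed
  qed
  then have "(z, W) \<in> Q" using zW by blast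
  then have W: "W \<in> convex hull (range (opow (koopman \<phi>)))" and
    near: "\<And>i t r. i < N \<Longrightarrow> \<forall>n\<ge>N. \<bar>apply_bcontfun (g i n) t - orbit_mean m (X i) t\<bar> \<le> r \<Longrightarrow>
      \<bar>apply_bcontfun z (t, i) + apply_bcontfun (blinfun_apply W (X i)) t - orbit_mean m (X i) t\<bar> \<le> r"
    unfolding Q_def by auto
  show ?thesis
  proof (intro bexI[OF _ W] allI impI)
    fix i t r assume "i < N" "\<forall>n\<ge>N. \<bar>apply_bcontfun (g i n) t - orbit_mean m (X i) t\<bar> \<le> r"
    from near[OF this] show "\<bar>apply_bcontfun (blinfun_apply W (X i)) t - orbit_mean m (X i) t\<bar> \<le> r + 1 / real (Suc N)"
      using abs_apply_le_norm[of z "(t, i)"] z(2) unfolding e_def by linarith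
  qed
qed

end

section \<open>Assembling the ergodic operator sequence\<close>

context tame_system
begin

text \<open>The \<open>N\<close>-th operator handles the first \<open>N\<close> members of a total
  family with error \<open>1 / Suc N\<close>, so convergence holds on each member and on the span.
  Convex combinations of contractions are contractions, which extends it to all functions.\<close>

lemma convergent_convex_combinations:
  assumes m: "is_mean m"
  shows "\<exists>W. (\<forall>n. W n \<in> convex hull (range (opow (koopman \<phi>)))) \<and> (\<forall>n x. norm (blinfun_apply (W n) x) \<le> norm x) \<and>
    (\<forall>x t. (\<lambda>n. apply_bcontfun (blinfun_apply (W n) x) t) \<longlonglongrightarrow> orbit_mean m x t)"
proof -
  obtain X :: "nat \<Rightarrow> ('a \<Rightarrow>\<^sub>C real)" where X: "\<forall>x e. 0 < e \<longrightarrow> (\<exists>y\<in>span (range X). norm (x - y) \<le> e)"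
    using countable_total_family[OF comp] by (rule exE)
  have "\<exists>g. (\<forall>n. norm (g n) \<le> norm x) \<and> (\<forall>t. (\<lambda>n. apply_bcontfun (g n) t) \<longlonglongrightarrow> orbit_mean m x t)" for x
  proof -
    obtain h where h: "\<And>n::nat. continuous_on UNIV (h n)" "\<And>n t. \<bar>h n t\<bar> \<le> norm x" "\<And>t. (\<lambda>n. h n t) \<longlonglongrightarrow> orbit_mean m x t"
      using baire1_bounded[OF baire1_orbit_mean[OF m] abs_orbit_mean_le[OF m], of x] by blast
    have ap: "apply_bcontfun (Bcontfun (h n)) = h n" for n by (rule apply_Bcontfun_compact[OF comp h(1)])
    show ?thesis
    proof (intro exI[of _ "\<lambda>n. Bcontfun (h n)"] conjI allI)
      show "norm (Bcontfun (h n)) \<le> norm x" for n by (rule norm_bound) (simp add: ap h(2))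
    qed (simp add: ap h(3))
  qed
  then have "\<forall>i. \<exists>g. (\<forall>n. norm (g n) \<le> norm (X i)) \<and> (\<forall>t. (\<lambda>n. apply_bcontfun (g n) t) \<longlonglongrightarrow> orbit_mean m (X i) t)" by simp
  from choice[OF this] obtain g where "\<forall>i. (\<forall>n. norm (g i n) \<le> norm (X i)) \<and> (\<forall>t. (\<lambda>n. apply_bcontfun (g i n) t) \<longlonglongrightarrow> orbit_mean m (X i) t)"
    by (rule exE)
  then have g: "\<And>i n. norm (g i n) \<le> norm (X i)" "\<And>i t. (\<lambda>n. apply_bcontfun (g i n) t) \<longlonglongrightarrow> orbit_mean m (X i) t" by simp_all
  have "\<forall>N. \<exists>W. W \<in> convex hull (range (opow (koopman \<phi>))) \<and> (\<forall>i<N. \<forall>t r.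
    (\<forall>n\<ge>N. \<bar>apply_bcontfun (g i n) t - orbit_mean m (X i) t\<bar> \<le> r) \<longrightarrow>
    \<bar>apply_bcontfun (blinfun_apply W (X i)) t - orbit_mean m (X i) t\<bar> \<le> r + 1 / real (Suc N))"
    using convex_combination_near_orbit_mean[OF m g] by (simp add: Bex_def)
  from choice[OF this] obtain W where WN: "\<forall>N. W N \<in> convex hull (range (opow (koopman \<phi>))) \<and> (\<forall>i<N. \<forall>t r.
    (\<forall>n\<ge>N. \<bar>apply_bcontfun (g i n) t - orbit_mean m (X i) t\<bar> \<le> r) \<longrightarrow>
    \<bar>apply_bcontfun (blinfun_apply (W N) (X i)) t - orbit_mean m (X i) t\<bar> \<le> r + 1 / real (Suc N))" by (rule exE)
  then have W: "W N \<in> convex hull (range (opow (koopman \<phi>)))" for N by simp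
  have near: "\<bar>apply_bcontfun (blinfun_apply (W N) (X i)) t - orbit_mean m (X i) t\<bar> \<le> r + 1 / real (Suc N)"
    if "i < N" "\<forall>n\<ge>N. \<bar>apply_bcontfun (g i n) t - orbit_mean m (X i) t\<bar> \<le> r" for N i t r
    using WN that by blast
  have contr: "norm (blinfun_apply (W n) x) \<le> norm x" for n x
  proof -
    have "convex hull (range (opow (koopman \<phi>))) \<subseteq> {W. norm (blinfun_apply W x) \<le> norm x}"
    proof (rule hull_minimal)
      show "range (opow (koopman \<phi>)) \<subseteq> {W. norm (blinfun_apply W x) \<le> norm x}"
        using norm_orbit[of x] by (auto simp: orbit_def)
      have "{W :: ('a \<Rightarrow>\<^sub>C real) \<Rightarrow>\<^sub>L ('a \<Rightarrow>\<^sub>C real). norm (blinfun_apply W x) \<le> norm x} = (\<lambda>W. blinfun_apply W x) -` cball 0 (norm x)" by auto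
      moreover have "linear (\<lambda>W :: ('a \<Rightarrow>\<^sub>C real) \<Rightarrow>\<^sub>L ('a \<Rightarrow>\<^sub>C real). blinfun_apply W x)"
        by (rule linearI) (simp_all add: blinfun.add_left blinfun.scaleR_left)
      ultimately show "convex {W :: ('a \<Rightarrow>\<^sub>C real) \<Rightarrow>\<^sub>L ('a \<Rightarrow>\<^sub>C real). norm (blinfun_apply W x) \<le> norm x}"
        by (simp add: convex_linear_vimage)
    qed
    then show ?thesis using W[of n] by auto
  qed
  have base: "(\<lambda>n. apply_bcontfun (blinfun_apply (W n) (X i)) t) \<longlonglongrightarrow> orbit_mean m (X i) t" for i t
  proof (rule LIMSEQ_I)
    fix e :: real assume e: "0 < e"
    then have "0 < e / 2" by simp
    from LIMSEQ_D[OF g(2)[of i t] this] obtain N1 where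
      N1: "\<And>n. N1 \<le> n \<Longrightarrow> \<bar>apply_bcontfun (g i n) t - orbit_mean m (X i) t\<bar> < e / 2" by auto
    obtain N2 where N2: "1 / real (Suc N2) < e / 2" using nat_approx_posE[OF \<open>0 < e / 2\<close>] by blast
    show "\<exists>N0. \<forall>n\<ge>N0. norm (apply_bcontfun (blinfun_apply (W n) (X i)) t - orbit_mean m (X i) t) < e"
    proof (intro exI[of _ "Suc i + N1 + N2"] allI impI)
      fix n assume n: "Suc i + N1 + N2 \<le> n"
      have "\<bar>apply_bcontfun (blinfun_apply (W n) (X i)) t - orbit_mean m (X i) t\<bar> \<le> e / 2 + 1 / real (Suc n)"
        using n N1 by (intro near) (auto intro!: less_imp_le)
      moreover have "1 / real (Suc n) \<le> 1 / real (Suc N2)" using n by (intro divide_left_mono) auto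
      ultimately show "norm (apply_bcontfun (blinfun_apply (W n) (X i)) t - orbit_mean m (X i) t) < e" using N2 by simp
    qed
  qed
  have om_add: "orbit_mean m (x + y) t = orbit_mean m x t + orbit_mean m y t" for x y t
    unfolding orbit_mean_def using mean_add[OF m bseq_orbit bseq_orbit] by simp
  have om_scale: "orbit_mean m (c *\<^sub>R x) t = c * orbit_mean m x t" for c x t
    unfolding orbit_mean_def using mean_cmult[OF m bseq_orbit] by simp
  have sp: "(\<lambda>n. apply_bcontfun (blinfun_apply (W n) y) t) \<longlonglongrightarrow> orbit_mean m y t" if "y \<in> span (range X)" for y t
    using that
  proof (induction rule: span_induct_alt)
    case base
    have "orbit_mean m 0 t = 0" using om_scale[of 0 0 t] by simp
    then show ?case by (simp add: blinfun.zero_right)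
  next
    case (step c x y)
    then obtain i where "x = X i" by blast
    then show ?case
      using tendsto_add[OF tendsto_mult[OF tendsto_const[of c] base[of i t]] step(2)]
      by (simp add: blinfun.add_right blinfun.scaleR_right om_add om_scale)
  qed
  have "(\<lambda>n. apply_bcontfun (blinfun_apply (W n) x) t) \<longlonglongrightarrow> orbit_mean m x t" for x t
  proof (rule LIMSEQ_I)
    fix e :: real assume e: "0 < e"
    obtain y where y: "y \<in> span (range X)" "norm (x - y) \<le> e / 4" using X e by (meson divide_pos_pos zero_less_numeral)
    obtain N where N: "\<And>n. N \<le> n \<Longrightarrow> \<bar>apply_bcontfun (blinfun_apply (W n) y) t - orbit_mean m y t\<bar> < e / 2"
      using LIMSEQ_D[OF sp[OF y(1), of t], of "e / 2"] e by auto
    show "\<exists>N. \<forall>n\<ge>N. norm (apply_bcontfun (blinfun_apply (W n) x) t - orbit_mean m x t) < e"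
    proof (intro exI[of _ N] allI impI)
      fix n assume n: "N \<le> n"
      have "\<bar>apply_bcontfun (blinfun_apply (W n) (x - y)) t\<bar> \<le> e / 4"
        using abs_apply_le_norm[of "blinfun_apply (W n) (x - y)" t] contr[of n "x - y"] y(2) by linarith
      then have 1: "\<bar>apply_bcontfun (blinfun_apply (W n) x) t - apply_bcontfun (blinfun_apply (W n) y) t\<bar> \<le> e / 4"
        by (simp add: blinfun.diff_right)
      have "orbit_mean m (x - y) t = orbit_mean m x t - orbit_mean m y t" using om_add[of "x - y" y t] by simp
      then have 2: "\<bar>orbit_mean m x t - orbit_mean m y t\<bar> \<le> e / 4"
        using abs_orbit_mean_le[OF m, of "x - y" t] y(2) by simp
      show "norm (apply_bcontfun (blinfun_apply (W n) x) t - orbit_mean m x t) < e"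
        using 1 2 N[OF n] by (simp add: abs_if split: if_splits)
    qed
  qed
  then show ?thesis using W contr by (intro exI[of _ W]) auto
qed

theorem ergodically_decomposable: "ergodically_decomposable \<phi>"
proof -
  obtain m where m: "extreme_inv_mean m" using extreme_inv_mean_exists by (rule exE)
  then have mm: "is_mean m" and mi: "\<And>u. bseq u \<Longrightarrow> m (\<lambda>k. u (Suc k)) = m u"
    by (auto simp: extreme_inv_mean_def shift_inv_def)
  obtain W where "(\<forall>n. W n \<in> convex hull (range (opow (koopman \<phi>)))) \<and> (\<forall>n x. norm (blinfun_apply (W n) x) \<le> norm x) \<and>
    (\<forall>x t. (\<lambda>n. apply_bcontfun (blinfun_apply (W n) x) t) \<longlonglongrightarrow> orbit_mean m x t)"
    using convergent_convex_combinations[OF mm] by (rule exE)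
  then have W: "\<And>n. W n \<in> convex hull (range (opow (koopman \<phi>)))" "\<And>n x. norm (blinfun_apply (W n) x) \<le> norm x"
    "\<And>x t. (\<lambda>n. apply_bcontfun (blinfun_apply (W n) x) t) \<longlonglongrightarrow> orbit_mean m x t" by simp_all
  have "\<exists>I. \<forall>x. (\<lambda>n. blinfun_apply \<mu> (blinfun_apply (W n) x)) \<longlonglongrightarrow> I (orbit_mean m x)" for \<mu> :: "'a dualC"
  proof -
    obtain I where I: "\<forall>v f C. (\<forall>n. norm (v n) \<le> C) \<longrightarrow> (\<forall>t. (\<lambda>n. apply_bcontfun (v n) t) \<longlonglongrightarrow> f t) \<longrightarrow> (\<lambda>n. \<mu> (v n)) \<longlonglongrightarrow> I f"
      using dual_extension[of \<mu>] by (elim exE conjE) (rule that)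
    have "(\<lambda>n. blinfun_apply \<mu> (blinfun_apply (W n) x)) \<longlonglongrightarrow> I (orbit_mean m x)" for x
      by (rule I[rule_format, of "\<lambda>n. blinfun_apply (W n) x" "norm x"]) (use W in auto)
    then show ?thesis by blast
  qed
  then have "\<forall>\<mu> :: 'a dualC. \<exists>I. \<forall>x. (\<lambda>n. blinfun_apply \<mu> (blinfun_apply (W n) x)) \<longlonglongrightarrow> I (orbit_mean m x)" by simp
  from choice[OF this] obtain I :: "'a dualC \<Rightarrow> ('a \<Rightarrow> real) \<Rightarrow> real" where "\<forall>\<mu> :: 'a dualC. \<forall>x. (\<lambda>n. blinfun_apply \<mu> (blinfun_apply (W n) x)) \<longlonglongrightarrow> I \<mu> (orbit_mean m x)"
    by (rule exE)
  then have lim: "(\<lambda>n. blinfun_apply \<mu> (blinfun_apply (W n) x)) \<longlonglongrightarrow> I \<mu> (orbit_mean m x)" for \<mu> :: "'a dualC" and x by simp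
  \<comment> \<open>By construction the limit depends on \<open>x\<close> only through its orbit
    mean, and this is what makes it invariant under the Koopman operator.\<close>
  define q where "q \<mu> x = I \<mu> (orbit_mean m x)" for \<mu> x
  have qI: "q \<mu> x = l" if "(\<lambda>n. blinfun_apply \<mu> (blinfun_apply (W n) x)) \<longlonglongrightarrow> l" for \<mu> x l
    using LIMSEQ_unique[OF lim that] by (simp add: q_def)
  have q: "(\<lambda>n. blinfun_apply \<mu> (blinfun_apply (W n) x)) \<longlonglongrightarrow> q \<mu> x" for \<mu> x unfolding q_def by (rule lim)
  have qb: "\<bar>q \<mu> x\<bar> \<le> norm \<mu> * norm x" for \<mu> x
  proof (rule LIMSEQ_le_const2[OF tendsto_rabs[OF q]], intro exI allI impI)
    fix n
    have "\<bar>blinfun_apply \<mu> (blinfun_apply (W n) x)\<bar> \<le> norm \<mu> * norm (blinfun_apply (W n) x)" using norm_blinfun[of \<mu>] by simp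
    also have "\<dots> \<le> norm \<mu> * norm x" by (intro mult_left_mono W(2)) simp
    finally show "\<bar>blinfun_apply \<mu> (blinfun_apply (W n) x)\<bar> \<le> norm \<mu> * norm x" .
  qed
  have ql: "bounded_linear (q \<mu>)" for \<mu>
  proof (rule bounded_linear_intro[where K = "norm \<mu>"])
    show "q \<mu> (x + y) = q \<mu> x + q \<mu> y" for x y
      by (rule qI) (simp add: blinfun.add_right tendsto_add q)
    show "q \<mu> (c *\<^sub>R x) = c *\<^sub>R q \<mu> x" for c x
      by (rule qI) (simp add: blinfun.scaleR_right tendsto_mult_left q)
    show "norm (q \<mu> x) \<le> norm x * norm \<mu>" for x using qb[of \<mu> x] by (simp add: mult.commute)
  qed
  have qapp: "blinfun_apply (Blinfun (q \<mu>)) x = q \<mu> x" for \<mu> x by (simp add: bounded_linear_Blinfun_apply[OF ql])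
  define Q where "Q = Blinfun (\<lambda>\<mu>. Blinfun (q \<mu>))"
  have "bounded_linear (\<lambda>\<mu>. Blinfun (q \<mu>))"
  proof (rule bounded_linear_intro[where K = 1])
    show "Blinfun (q (\<mu> + \<nu>)) = Blinfun (q \<mu>) + Blinfun (q \<nu>)" for \<mu> \<nu>
    proof (rule blinfun_eqI)
      show "blinfun_apply (Blinfun (q (\<mu> + \<nu>))) x = blinfun_apply (Blinfun (q \<mu>) + Blinfun (q \<nu>)) x" for x
        unfolding qapp blinfun.add_left by (rule qI) (simp add: blinfun.add_left tendsto_add q)
    qed
    show "Blinfun (q (c *\<^sub>R \<mu>)) = c *\<^sub>R Blinfun (q \<mu>)" for c \<mu>
    proof (rule blinfun_eqI)
      show "blinfun_apply (Blinfun (q (c *\<^sub>R \<mu>))) x = blinfun_apply (c *\<^sub>R Blinfun (q \<mu>)) x" for x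
        unfolding qapp blinfun.scaleR_left by (rule qI) (simp add: blinfun.scaleR_left tendsto_mult_left q)
    qed
    show "norm (Blinfun (q \<mu>)) \<le> norm \<mu> * 1" for \<mu>
      using qb[of \<mu>] by (intro norm_blinfun_bound) (auto simp: qapp)
  qed
  then have Q: "blinfun_apply (blinfun_apply Q \<mu>) x = q \<mu> x" for \<mu> x
    unfolding Q_def by (simp add: bounded_linear_Blinfun_apply qapp)
  define V where "V n = dual_op (W n)" for n
  have V: "blinfun_apply (blinfun_apply (V n) \<mu>) x = blinfun_apply \<mu> (blinfun_apply (W n) x)" for n \<mu> x
    by (simp add: V_def apply_dual_op)
  have "V n \<in> convex hull (range (opow (dual_op (koopman \<phi>))))" for n
  proof -
    have "V n \<in> dual_op ` (convex hull (range (opow (koopman \<phi>))))" unfolding V_def using W(1) by (rule imageI)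
    also have "\<dots> = convex hull (dual_op ` range (opow (koopman \<phi>)))" by (rule convex_hull_linear_image[OF linear_dual_op])
    also have "dual_op ` range (opow (koopman \<phi>)) = range (opow (dual_op (koopman \<phi>)))"
      by (simp add: image_image dual_op_opow)
    finally show ?thesis .
  qed
  moreover have "(\<lambda>n. blinfun_apply (blinfun_apply (id_blinfun - dual_op (koopman \<phi>)) (blinfun_apply (V n) \<mu>)) x) \<longlonglongrightarrow> 0" for \<mu> x
  proof -
    \<comment> \<open>Here shift invariance of the mean becomes ergodicity of the operator sequence:
      the value of \<open>(Id - V) (V n \<mu>)\<close> at \<open>x\<close> converges to the
      difference of two limits with the same orbit mean.\<close>
    have "orbit_mean m (blinfun_apply (koopman \<phi>) x) t = orbit_mean m x t" for t
    proof -
      have "apply_bcontfun (blinfun_apply (koopman \<phi>) x) ((\<phi> ^^ k) t) = apply_bcontfun x ((\<phi> ^^ Suc k) t)" for k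
        by (simp add: apply_koopman[OF cont])
      then show ?thesis unfolding orbit_mean_def by (simp only: mi[OF bseq_orbit])
    qed
    then have "q \<mu> (blinfun_apply (koopman \<phi>) x) = q \<mu> x" unfolding q_def by presburger
    then have "(\<lambda>n. blinfun_apply \<mu> (blinfun_apply (W n) x) - blinfun_apply \<mu> (blinfun_apply (W n) (blinfun_apply (koopman \<phi>) x))) \<longlonglongrightarrow> q \<mu> x - q \<mu> x"
      using tendsto_diff[OF q[of \<mu> x] q[of \<mu> "blinfun_apply (koopman \<phi>) x"]] by simp
    then show ?thesis by (simp add: blinfun.diff_left apply_dual_op V)
  qed
  ultimately have "ergodic_op_seq \<phi> V" unfolding ergodic_op_seq_def by blast
  moreover have "wstar_op_conv V Q" unfolding wstar_op_conv_def Q V using q by blast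
  moreover have "\<exists>M. ergodic_prob \<phi> M \<and> (\<forall>x. Q (dirac \<omega>) x = (\<integral>t. apply_bcontfun x t \<partial>M))" for \<omega>
  proof -
    have "q (dirac \<omega>) x = orbit_mean m x \<omega>" for x by (rule qI) (simp add: apply_dirac W(3))
    then show ?thesis using extreme_orbit_mean_ergodic[OF m, of \<omega>] by (simp add: Q)
  qed
  ultimately show ?thesis unfolding ergodically_decomposable_def by blast
qed

end

theorem theorem4p5:
  fixes \<phi> :: "'a::metric_space \<Rightarrow> 'a"
  assumes "compact (UNIV :: 'a set)"
    and "continuous_on UNIV \<phi>"
    and "tame \<phi>"
  shows "ergodically_decomposable \<phi>"
proof -
  interpret tame_system \<phi> by standard (use assms in auto)
  show ?thesis by (rule ergodically_decomposable)
qed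

end
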